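(* Let $\Omega,k,D,\rho,\mathbf a$ be as specified in the context, let $F\in\{H^1_0(\Omega)\}^*$ be either $F=\rho\chi_D$ or $F=\nabla\cdot\{\rho\chi_D\mathbf a\}$, and let $u\in H^1(\Omega)$ be a weak solution of $\Delta u+k^2u=F$ in $\Omega$. Let $\omega\in S^1$ be regular with respect to $D$. Then $h_D(\omega)$ can be calculated from the Cauchy data $(u|_{\partial\Omega},\,\partial u/\partial\nu|_{\partial\Omega})$ by the following formula: for $\omega^\perp\in S^1$ with $\omega\cdot\omega^\perp=0$, $\tau>0$ and $t\in\mathbb R$, put $$v(x)=v_{\tau,t}(x)=\exp\{x\cdot(\tau\omega+i\sqrt{\tau^2+k^2}\,\omega^\perp)-\tau t\},$$ $$\mathcal I(\tau,t)=\Big\langle \frac{\partial u}{\partial\nu}\Big|_{\partial\Omega},v|_{\partial\Omega}\Big\rangle-\Big\langle \frac{\partial v}{\partial\nu}\Big|_{\partial\Omega},u|_{\partial\Omega}\Big\rangle ;$$ then for every $t\in\mathbb R$ $$h_D(\omega)-t=\lim_{\tau\to\infty}\frac{\log|\mathcal I(\tau,t)|}{\tau}.$$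
   Context: $\Omega\subset\mathbb R^2$ is a bounded domain with Lipschitz boundary and unit outward normal $\nu$; $k\ge 0$ is fixed. Function spaces are complex valued, and all pairings and the dot product are bilinear. Assumptions on the source: $D$ is an open polygon (interior of a simple closed polygonal curve) with $\overline D\subset\Omega$; $\rho\in L^2(D)$; for each vertex $p$ of $D$ there exist an open disk $B(p,\eta)$ centred at $p$ with radius $\eta>0$, a number $0<\alpha\le1$ and a function $\tilde\rho\in C^{0,\alpha}(\overline{B(p,\eta)})$ such that $\rho=\tilde\rho$ on $B(p,\eta)\cap\overline D$ (a.e.) and $\tilde\rho(p)\ne0$. $\mathbf a\in\mathbb R^2$ is a non-zero constant vector. $\chi_D$ is the characteristic function of $D$. For $\varphi\in H^1_0(\Omega)$: if $F=\rho\chi_D$ then $F(\varphi)=\int_D\rho\varphi\,dx$; if $F=\nabla\cdot\{\rho\chi_D\mathbf a\}$ then $F(\varphi)=-\int_D\rho\,\mathbf a\cdot\nabla\varphi\,dx$. Weak solution of $\Delta u+k^2u=F$: $u\in H^1(\Omega)$ with $\int_\Omega\nabla u\cdot\nabla\varphi\,dx-k^2\int_\Omega u\varphi\,dx=-F(\varphi)$ for all $\varphi\in H^1_0(\Omega)$. Since $\operatorname{supp}F$ is a compact subset of $\Omega$, put $\tilde F(w)=F(\psi w)$ for $w\in H^1(\Omega)$, where $\psi\in C_0^\infty(\Omega)$ equals $1$ near $\operatorname{supp}F$ (independent of the choice of $\psi$). The Neumann derivative $\partial u/\partial\nu|_{\partial\Omega}$ is the element of the dual of $H^{1/2}(\partial\Omega)$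 given by $\langle\partial u/\partial\nu|_{\partial\Omega},g\rangle=\int_\Omega\nabla u\cdot\nabla w\,dx-k^2\int_\Omega uw\,dx+\tilde F(w)$, where $w\in H^1(\Omega)$ is any lifting of $g$; for solutions of the homogeneous equation (such as $v$) the same formula is used with $\tilde F=0$. Support function: $h_D(\omega)=\sup_{x\in D}x\cdot\omega$, $\omega\in S^1$. A direction $\omega\in S^1$ is regular with respect to $D$ if $\{x\in\mathbb R^2: x\cdot\omega=h_D(\omega)\}\cap\partial D$ consists of exactly one point. *)

theory Defs
  imports "HOL-Analysis.Analysis"
begin

section \<open>Bilinear dot product and smooth functions\<close>

text \<open>The dot product on complex vectors is bilinear, without complex conjugation.\<close>

definition bdot :: "complex^2 \<Rightarrow> complex^2 \<Rightarrow> complex" where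
  "bdot a b = (\<Sum>i\<in>UNIV. a $ i * b $ i)"

definition cvec :: "real^2 \<Rightarrow> complex^2" where
  "cvec x = (\<chi> i. of_real (x $ i))"

definition pd :: "2 \<Rightarrow> (real^2 \<Rightarrow> complex) \<Rightarrow> real^2 \<Rightarrow> complex" where
  "pd i f x = frechet_derivative f (at x) (axis i 1)"

primrec Ck :: "nat \<Rightarrow> (real^2 \<Rightarrow> complex) \<Rightarrow> bool" where
  "Ck 0 f \<longleftrightarrow> continuous_on UNIV f"
| "Ck (Suc n) f \<longleftrightarrow> (\<forall>x. f differentiable at x) \<and> (\<forall>i. Ck n (pd i f))"

definition smooth :: "(real^2 \<Rightarrow> complex) \<Rightarrow> bool" where
  "smooth f \<longleftrightarrow> (\<forall>n. Ck n f)"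

definition test_functions :: "(real^2) set \<Rightarrow> (real^2 \<Rightarrow> complex) set" where
  "test_functions \<Omega> = {\<phi>. smooth \<phi> \<and> (\<exists>K. compact K \<and> K \<subseteq> \<Omega> \<and> (\<forall>x. x \<notin> K \<longrightarrow> \<phi> x = 0))}"


section \<open>Sobolev spaces\<close>

text \<open>Elements of Lebesgue and Sobolev spaces are represented by functions; every notion
  below depends on such a function only up to equality almost everywhere in the domain.\<close>

definition L2 :: "'a measure \<Rightarrow> ('a \<Rightarrow> 'b::{real_normed_vector, second_countable_topology}) set" where
  "L2 M = {f. f \<in> borel_measurable M \<and> integrable M (\<lambda>x. (norm (f x))\<^sup>2)}"

definition is_weak_grad :: "(real^2) set \<Rightarrow> (real^2 \<Rightarrow> complex) \<Rightarrow> (real^2 \<Rightarrow> complex^2) \<Rightarrow> bool" where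
  "is_weak_grad \<Omega> u G \<longleftrightarrow> G \<in> L2 (lebesgue_on \<Omega>) \<and>
     (\<forall>\<phi>\<in>test_functions \<Omega>. \<forall>i.
        (LINT x|lebesgue_on \<Omega>. u x * pd i \<phi> x) = - (LINT x|lebesgue_on \<Omega>. G x $ i * \<phi> x))"

definition H1 :: "(real^2) set \<Rightarrow> (real^2 \<Rightarrow> complex) set" where
  "H1 \<Omega> = {u. u \<in> L2 (lebesgue_on \<Omega>) \<and> (\<exists>G. is_weak_grad \<Omega> u G)}"

text \<open>The weak gradient is unique up to equality almost everywhere.\<close>

definition wgrad :: "(real^2) set \<Rightarrow> (real^2 \<Rightarrow> complex) \<Rightarrow> real^2 \<Rightarrow> complex^2" where
  "wgrad \<Omega> u = (SOME G. is_weak_grad \<Omega> u G)"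

definition H1_norm :: "(real^2) set \<Rightarrow> (real^2 \<Rightarrow> complex) \<Rightarrow> real" where
  "H1_norm \<Omega> u = sqrt ((LINT x|lebesgue_on \<Omega>. (norm (u x))\<^sup>2)
                      + (LINT x|lebesgue_on \<Omega>. (norm (wgrad \<Omega> u x))\<^sup>2))"

definition H10 :: "(real^2) set \<Rightarrow> (real^2 \<Rightarrow> complex) set" where
  "H10 \<Omega> = {u \<in> H1 \<Omega>. \<exists>\<phi>. (\<forall>n::nat. \<phi> n \<in> test_functions \<Omega>) \<and>
                        (\<lambda>n. H1_norm \<Omega> (\<lambda>x. \<phi> n x - u x)) \<longlonglongrightarrow> 0}"


section \<open>Lipschitz boundaries and traces\<close>

text \<open>A chart: in the orthonormal coordinates \<open>x + s a + t b\<close>, inside the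
  rectangle \<open>|s| < r\<close>, \<open>|t| < h\<close>, the domain is the region below the graph of a Lipschitz
  function \<open>\<gamma>\<close>. Inside the rectangle the boundary of the domain is then the graph itself.\<close>

definition lipschitz_chart ::
  "(real^2) set \<Rightarrow> real^2 \<Rightarrow> real^2 \<Rightarrow> real^2 \<Rightarrow> real \<Rightarrow> real \<Rightarrow> (real \<Rightarrow> real) \<Rightarrow> bool" where
  "lipschitz_chart \<Omega> x a b r h \<gamma> \<longleftrightarrow>
     norm a = 1 \<and> norm b = 1 \<and> a \<bullet> b = 0 \<and> r > 0 \<and> h > 0 \<and>
     (\<exists>L. L-lipschitz_on UNIV \<gamma>) \<and> (\<forall>s. \<bar>s\<bar> < r \<longrightarrow> \<bar>\<gamma> s\<bar> < h) \<and>
     (\<forall>s t. \<bar>s\<bar> < r \<and> \<bar>t\<bar> < h \<longrightarrow> (x + s *\<^sub>R a + t *\<^sub>R b \<in> \<Omega> \<longleftrightarrow> t < \<gamma> s))"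

definition lipschitz_boundary :: "(real^2) set \<Rightarrow> bool" where
  "lipschitz_boundary \<Omega> \<longleftrightarrow> (\<forall>x\<in>frontier \<Omega>. \<exists>a b r h \<gamma>. lipschitz_chart \<Omega> x a b r h \<gamma>)"

text \<open>Convergence in \<open>L\<^sup>2(\<partial>\<Omega>)\<close>, expressed in the charts: the arc length element is
  \<open>sqrt (1 + \<gamma>'\<^sup>2) ds\<close>, whose density lies between two positive constants, and
  the compact set \<open>\<partial>\<Omega>\<close> is covered by finitely many charts.\<close>

definition L2_boundary_tendsto ::
  "(real^2) set \<Rightarrow> (nat \<Rightarrow> real^2 \<Rightarrow> complex) \<Rightarrow> (real^2 \<Rightarrow> complex) \<Rightarrow> bool" where
  "L2_boundary_tendsto \<Omega> w g \<longleftrightarrow>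
     (\<forall>x a b r h \<gamma>. lipschitz_chart \<Omega> x a b r h \<gamma> \<longrightarrow>
        (let \<Phi> = (\<lambda>s. x + s *\<^sub>R a + \<gamma> s *\<^sub>R b); M = lebesgue_on {-r<..<r} in
          (\<forall>n. (\<lambda>s. w n (\<Phi> s) - g (\<Phi> s)) \<in> L2 M) \<and>
          (\<lambda>n. LINT s|M. (cmod (w n (\<Phi> s) - g (\<Phi> s)))\<^sup>2) \<longlonglongrightarrow> 0))"

text \<open>The trace operator is the continuous extension to \<open>H\<^sup>1(\<Omega>)\<close>, with values in \<open>L\<^sup>2(\<partial>\<Omega>)\<close>,
  of the restriction of smooth functions to \<open>\<partial>\<Omega>\<close>; here it is given through its graph.
  Thus \<open>is_trace \<Omega> w g\<close> says \<open>w|\<^sub>\<partial>\<^sub>\<Omega> = g\<close>, equivalently that \<open>w\<close> is a lifting of \<open>g\<close>, and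
  \<open>H\<^sup>1\<^sup>/\<^sup>2(\<partial>\<Omega>)\<close> consists of the \<open>g\<close> that have a lifting. Only the values of \<open>g\<close> on \<open>\<partial>\<Omega>\<close> matter.\<close>

definition is_trace :: "(real^2) set \<Rightarrow> (real^2 \<Rightarrow> complex) \<Rightarrow> (real^2 \<Rightarrow> complex) \<Rightarrow> bool" where
  "is_trace \<Omega> w g \<longleftrightarrow> w \<in> H1 \<Omega> \<and>
     (\<exists>f. (\<forall>n. smooth (f n)) \<and> (\<lambda>n. H1_norm \<Omega> (\<lambda>x. f n x - w x)) \<longlonglongrightarrow> 0 \<and>
          L2_boundary_tendsto \<Omega> f g)"


section \<open>Weak solutions and the Neumann derivative\<close>

type_synonym functional = "(real^2 \<Rightarrow> complex) \<Rightarrow> complex"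

definition energy_form ::
  "(real^2) set \<Rightarrow> real \<Rightarrow> (real^2 \<Rightarrow> complex) \<Rightarrow> (real^2 \<Rightarrow> complex) \<Rightarrow> complex" where
  "energy_form \<Omega> k u w = (LINT x|lebesgue_on \<Omega>. bdot (wgrad \<Omega> u x) (wgrad \<Omega> w x))
                       - of_real (k\<^sup>2) * (LINT x|lebesgue_on \<Omega>. u x * w x)"

definition weak_solution ::
  "(real^2) set \<Rightarrow> real \<Rightarrow> functional \<Rightarrow> (real^2 \<Rightarrow> complex) \<Rightarrow> bool" where
  "weak_solution \<Omega> k F u \<longleftrightarrow> u \<in> H1 \<Omega> \<and> (\<forall>\<phi>\<in>H10 \<Omega>. energy_form \<Omega> k u \<phi> = - F \<phi>)"

definition support :: "(real^2) set \<Rightarrow> functional \<Rightarrow> (real^2) set" where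
  "support \<Omega> F = {x \<in> \<Omega>. \<forall>U. open U \<and> x \<in> U \<and> U \<subseteq> \<Omega> \<longrightarrow> (\<exists>\<phi>\<in>test_functions U. F \<phi> \<noteq> 0)}"

text \<open>The extension of a compactly supported functional to \<open>H\<^sup>1(\<Omega>)\<close>; the result does not depend on the
  cut-off function.\<close>

definition cutoff :: "(real^2) set \<Rightarrow> functional \<Rightarrow> (real^2 \<Rightarrow> complex) \<Rightarrow> bool" where
  "cutoff \<Omega> F \<psi> \<longleftrightarrow> \<psi> \<in> test_functions \<Omega> \<and>
     (\<exists>U. open U \<and> support \<Omega> F \<subseteq> U \<and> (\<forall>x\<in>U. \<psi> x = 1))"

definition ext_functional :: "(real^2) set \<Rightarrow> functional \<Rightarrow> functional" where
  "ext_functional \<Omega> F w = (let \<psi> = (SOME \<psi>. cutoff \<Omega> F \<psi>) in F (\<lambda>x. \<psi> x * w x))"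

text \<open>The pairing of the Neumann derivative of a weak solution \<open>u\<close> with \<open>g\<close>; the value does not depend
  on the lifting of \<open>g\<close>. For a solution of the homogeneous equation, \<open>F\<close> is the zero functional.\<close>

definition neumann :: "(real^2) set \<Rightarrow> real \<Rightarrow> functional \<Rightarrow> (real^2 \<Rightarrow> complex) \<Rightarrow> functional" where
  "neumann \<Omega> k F u g = (let w = (SOME w. is_trace \<Omega> w g) in
      energy_form \<Omega> k u w + ext_functional \<Omega> F w)"


section \<open>Polygonal sources\<close>

fun polygonal_path :: "(real^2) list \<Rightarrow> real \<Rightarrow> real^2" where
  "polygonal_path [] = linepath 0 0"
| "polygonal_path [p] = linepath p p"
| "polygonal_path [p, q] = linepath p q"
| "polygonal_path (p # q # r # ps) = linepath p q +++ polygonal_path (q # r # ps)"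

definition open_polygon :: "(real^2) list \<Rightarrow> (real^2) set \<Rightarrow> bool" where
  "open_polygon ps D \<longleftrightarrow> length ps \<ge> 3 \<and> simple_path (polygonal_path (ps @ [hd ps])) \<and>
     D = inside (path_image (polygonal_path (ps @ [hd ps])))"

definition holder_on :: "(real^2) set \<Rightarrow> real \<Rightarrow> (real^2 \<Rightarrow> complex) \<Rightarrow> bool" where
  "holder_on S \<alpha> f \<longleftrightarrow> (\<exists>C. \<forall>x\<in>S. \<forall>y\<in>S. cmod (f x - f y) \<le> C * dist x y powr \<alpha>)"

definition source :: "(real^2) set \<Rightarrow> (real^2 \<Rightarrow> complex) \<Rightarrow> functional" where
  "source D \<rho> \<phi> = (LINT x|lebesgue_on D. \<rho> x * \<phi> x)"

definition div_source ::
  "(real^2) set \<Rightarrow> (real^2) set \<Rightarrow> (real^2 \<Rightarrow> complex) \<Rightarrow> real^2 \<Rightarrow> functional" where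
  "div_source \<Omega> D \<rho> a \<phi> = - (LINT x|lebesgue_on D. \<rho> x * bdot (cvec a) (wgrad \<Omega> \<phi> x))"


section \<open>Support function and indicator function\<close>

definition support_fun :: "(real^2) set \<Rightarrow> real^2 \<Rightarrow> real" where
  "support_fun D \<omega> = (SUP x\<in>D. x \<bullet> \<omega>)"

definition regular_direction :: "(real^2) set \<Rightarrow> real^2 \<Rightarrow> bool" where
  "regular_direction D \<omega> \<longleftrightarrow> norm \<omega> = 1 \<and>
     (\<exists>!x. x \<in> {x. x \<bullet> \<omega> = support_fun D \<omega>} \<inter> frontier D)"

definition cgo :: "real \<Rightarrow> real^2 \<Rightarrow> real^2 \<Rightarrow> real \<Rightarrow> real \<Rightarrow> real^2 \<Rightarrow> complex" where
  "cgo k \<omega> \<omega>' \<tau> t x =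
     exp (bdot (cvec x) (\<chi> i. of_real (\<tau> * \<omega> $ i) + \<i> * of_real (sqrt (\<tau>\<^sup>2 + k\<^sup>2) * \<omega>' $ i))
          - of_real (\<tau> * t))"

text \<open>The indicator function is a function of the Cauchy data only: \<open>f\<close> stands for \<open>u|\<^sub>\<partial>\<^sub>\<Omega>\<close> and \<open>N\<close> for the
  functional \<open>\<partial>u/\<partial>\<nu>|\<^sub>\<partial>\<^sub>\<Omega>\<close>.\<close>

definition indicator_fun ::
  "(real^2) set \<Rightarrow> real \<Rightarrow> (real^2 \<Rightarrow> complex) \<Rightarrow> functional \<Rightarrow> real^2 \<Rightarrow> real^2 \<Rightarrow> real \<Rightarrow> real \<Rightarrow> complex" where
  "indicator_fun \<Omega> k f N \<omega> \<omega>' \<tau> t =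
     N (cgo k \<omega> \<omega>' \<tau> t) - neumann \<Omega> k (\<lambda>_. 0) (cgo k \<omega> \<omega>' \<tau> t) f"

end

(* The Cauchy data pair with the exponential solution v to give F(v): by Green's formula the difference of the
   two boundary pairings is F(v), once it is known that functions of H^1 with the same trace differ by an element
   of H^1_0 and that F does not see the cut-off. In a regular direction the polygon D touches its supporting line
   only at a vertex p, near which it is a sector {c1 y < z < c2 y} in the coordinates y = (p - x).omega,
   z = (x - p).omega'. Up to the factor exp (tau (h_D(omega) - t)) and a polynomial one, F(v) is the integral of
   rho exp (-tau y + i s z) over D with s = sqrt (tau^2 + k^2). The part away from p is exponentially small, and
   for constant rho the sector contributes (c2 - c1) / ((tau - i s c1) (tau - i s c2)), which is of exact order
   tau^-2; the oscillation of rho at p perturbs it by a small multiple of tau^-2. *)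

theory Submission
  imports Defs
begin

section \<open>Calculus of smooth functions\<close>

text \<open>Weak gradients, liftings and cut-offs are all fixed by choice. Of a chosen lifting only
  the trace is known; a chosen cut-off is known to be 1 only near \<open>support \<Omega> F\<close>,
  which may be smaller than the closure of \<open>D\<close>. Both choices have to be shown harmless.
  The hard step is that zero trace implies membership in H^1_0. The smooth approximants have
  boundary values that are small only in L^2, so they must be cut off near the boundary. A cut-off
  at scale \<delta> costs 1/\<delta> in the gradient. A collar estimate with weight \<delta> on the
  boundary values and \<delta>^2 on the gradient pays for this, provided that the approximant is
  chosen after \<delta>. In the asymptotics, absolute values yield only upper bounds, so the lower
  bound rests on an exact integral over a triangle. The error from the oscillation of the source has
  the same order as the main term; it is beaten through its constant, by shrinking the triangle. For
  the divergence source the extra factor is the product of the vector \<open>a\<close> with the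
  complex frequency; it grows at most linearly and stays away from 0.\<close>

lemma pd_eqI: "(f has_derivative f') (at x) \<Longrightarrow> pd i f x = f' (axis i 1)"
  by (metis pd_def frechet_derivative_at)

lemma frechet_has_derivative: "f differentiable at x \<Longrightarrow> (f has_derivative frechet_derivative f (at x)) (at x)"
  using frechet_derivative_works by blast

lemma pd_const [simp]: "pd i (\<lambda>_. c) x = 0"
  by (rule pd_eqI[of _ "\<lambda>_. 0", simplified]) auto

lemma pd_add:
  "f differentiable at x \<Longrightarrow> g differentiable at x \<Longrightarrow> pd i (\<lambda>x. f x + g x) x = pd i f x + pd i g x"
  unfolding pd_def[of i f] pd_def[of i g]
  by (rule pd_eqI) (auto intro!: has_derivative_add frechet_has_derivative)

lemma pd_diff:
  "f differentiable at x \<Longrightarrow> g differentiable at x \<Longrightarrow> pd i (\<lambda>x. f x - g x) x = pd i f x - pd i g x"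
  unfolding pd_def[of i f] pd_def[of i g]
  by (rule pd_eqI) (auto intro!: has_derivative_diff frechet_has_derivative)

lemma pd_mult:
  "f differentiable at x \<Longrightarrow> g differentiable at x \<Longrightarrow>
     pd i (\<lambda>x. f x * g x) x = f x * pd i g x + pd i f x * g x"
  unfolding pd_def[of i f] pd_def[of i g]
  by (rule pd_eqI) (auto intro!: has_derivative_mult frechet_has_derivative)

lemma pd_inverse:
  assumes "f differentiable at x" "f x \<noteq> 0"
  shows "pd i (\<lambda>x. inverse (f x)) x = - (inverse (f x) * pd i f x * inverse (f x))"
  unfolding pd_def[of i f]
  by (rule pd_eqI[OF Deriv.has_derivative_inverse[OF assms(2) frechet_has_derivative[OF assms(1)]]])

lemma pd_affine:
  assumes "f differentiable at (c *\<^sub>R (x - z))"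
  shows "pd i (\<lambda>x. f (c *\<^sub>R (x - z))) x = of_real c * pd i f (c *\<^sub>R (x - z))"
proof -
  let ?D = "frechet_derivative f (at (c *\<^sub>R (x - z)))"
  have "((\<lambda>x. f (c *\<^sub>R (x - z))) has_derivative (\<lambda>v. ?D (c *\<^sub>R v))) (at x)"
    by (rule has_derivative_compose[of "\<lambda>x. c *\<^sub>R (x - z)" "\<lambda>v. c *\<^sub>R v" x UNIV f, OF _ frechet_has_derivative[OF assms]])
       (auto intro!: derivative_eq_intros)
  from pd_eqI[OF this, of i] have "pd i (\<lambda>x. f (c *\<^sub>R (x - z))) x = ?D (c *\<^sub>R axis i 1)" .
  also have "\<dots> = c *\<^sub>R ?D (axis i 1)"
    by (rule linear_cmul[OF has_derivative_linear[OF frechet_has_derivative[OF assms]]])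
  finally show ?thesis by (simp add: pd_def scaleR_conv_of_real)
qed

lemma Ck_differentiable: "Ck (Suc n) f \<Longrightarrow> f differentiable at x"
  by simp

lemma Ck_continuous: "Ck n f \<Longrightarrow> continuous_on UNIV f"
  by (cases n) (auto intro!: differentiable_imp_continuous_on simp: differentiable_on_def)

lemma Ck_SucD: "Ck (Suc n) f \<Longrightarrow> Ck n f"
proof (induction n arbitrary: f)
  case 0
  then show ?case using Ck_continuous[of 1 f] by simp
qed simp

lemma Ck_const: "Ck n (\<lambda>_. c)"
proof (induction n arbitrary: c)
  case (Suc n)
  have "pd i (\<lambda>_. c) = (\<lambda>_. 0)" for i by (rule ext) simp
  with Suc[of 0] show ?case by simp
qed simp

lemma Ck_add: "Ck n f \<Longrightarrow> Ck n g \<Longrightarrow> Ck n (\<lambda>x. f x + g x)"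
proof (induction n arbitrary: f g)
  case (Suc n)
  then have "pd i (\<lambda>x. f x + g x) = (\<lambda>x. pd i f x + pd i g x)" for i by (auto intro!: pd_add)
  with Suc show ?case by (auto intro!: differentiable_add)
qed (auto intro!: continuous_intros)

lemma Ck_mult: "Ck n f \<Longrightarrow> Ck n g \<Longrightarrow> Ck n (\<lambda>x. f x * g x)"
proof (induction n arbitrary: f g)
  case (Suc n)
  then have "pd i (\<lambda>x. f x * g x) = (\<lambda>x. f x * pd i g x + pd i f x * g x)" for i by (auto intro!: pd_mult)
  with Suc Ck_SucD[OF Suc.prems(1)] Ck_SucD[OF Suc.prems(2)] show ?case
    by (auto intro!: differentiable_mult Ck_add Suc.IH)
qed (auto intro!: continuous_intros)

lemma Ck_diff: "Ck n f \<Longrightarrow> Ck n g \<Longrightarrow> Ck n (\<lambda>x. f x - g x)"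
  using Ck_add[of n f "\<lambda>x. -1 * g x"] Ck_mult[OF Ck_const[of n "-1"], of g] by simp

lemma Ck_inverse: "Ck n f \<Longrightarrow> (\<And>x. f x \<noteq> 0) \<Longrightarrow> Ck n (\<lambda>x. inverse (f x))"
proof (induction n arbitrary: f)
  case (Suc n)
  then have "pd i (\<lambda>x. inverse (f x)) = (\<lambda>x. (-1) * ((inverse (f x) * pd i f x) * inverse (f x)))" for i
    by (auto simp: pd_inverse)
  moreover have "Ck n (\<lambda>x. inverse (f x))" using Suc.IH[OF Ck_SucD[OF Suc.prems(1)] Suc.prems(2)] .
  then have "Ck n (\<lambda>x. (-1) * ((inverse (f x) * pd i f x) * inverse (f x)))" for i
    using Suc.prems by (intro Ck_mult Ck_const) auto
  ultimately show ?case using Suc.prems by auto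
qed (auto intro!: continuous_intros)

lemma Ck_affine: "Ck n f \<Longrightarrow> Ck n (\<lambda>x. f (c *\<^sub>R (x - z)))"
proof (induction n arbitrary: f)
  case 0
  then show ?case
    by (auto intro!: continuous_on_compose2[of UNIV f UNIV "\<lambda>x. c *\<^sub>R (x - z)"] continuous_intros)
next
  case (Suc n)
  then have eq: "pd i (\<lambda>x. f (c *\<^sub>R (x - z))) = (\<lambda>x. of_real c * pd i f (c *\<^sub>R (x - z)))" for i
    by (intro ext pd_affine) auto
  have "(\<lambda>x. f (c *\<^sub>R (x - z))) differentiable at x" for x
    using Suc.prems by (intro differentiable_compose[of f "\<lambda>x. c *\<^sub>R (x - z)"]) (auto simp: differentiable_def intro!: exI derivative_intros)
  with Suc eq show ?case by (auto intro!: Ck_mult Ck_const)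
qed

lemma Ck_component: "Ck n (\<lambda>x. of_real (x $ j))"
proof (cases n)
  case (Suc m)
  have d: "((\<lambda>x::real^2. complex_of_real (x $ j)) has_derivative (\<lambda>v. of_real (v $ j))) (at x)" for x
    by (intro has_derivative_of_real bounded_linear_imp_has_derivative bounded_linear_vec_nth)
  then have "pd i (\<lambda>x. of_real (x $ j)) = (\<lambda>_. of_real (axis i 1 $ j))" for i
    by (intro ext) (rule pd_eqI[OF d])
  then show ?thesis using Suc d by (auto simp: Ck_const differentiable_def)
qed (auto intro!: continuous_intros)

text \<open>Powers of \<open>inverse t\<close> are carried along because differentiating exp (-1/t)
  produces them: up to linear combinations the family over \<open>m\<close> is closed under
  differentiation, which permits an induction on the order.\<close>

definition flat_exp :: "nat \<Rightarrow> real \<Rightarrow> real" where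
  "flat_exp m t = (if t > 0 then exp (- inverse t) * inverse t ^ m else 0)"

text \<open>This is the difference quotient at 0, where \<open>flat_exp m\<close> vanishes. On the
  right, u = 1/t turns it into u^(m+1) / exp u.\<close>

lemma flat_exp_quotient_tendsto: "((\<lambda>t. flat_exp m t / t) \<longlongrightarrow> 0) (at 0)"
proof -
  have "((\<lambda>t. flat_exp m t / t) \<longlongrightarrow> 0) (at_left 0)"
    by (rule tendsto_eventually) (auto simp: eventually_at_filter flat_exp_def)
  moreover have "((\<lambda>t::real. inverse t ^ Suc m / exp (inverse t)) \<longlongrightarrow> 0) (at_right 0)"
    by (rule filterlim_compose[OF tendsto_power_div_exp_0 filterlim_inverse_at_top_right])
  then have "((\<lambda>t. flat_exp m t / t) \<longlongrightarrow> 0) (at_right 0)"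
    by (rule Lim_transform_eventually)
       (auto simp: eventually_at_filter flat_exp_def exp_minus divide_inverse)
  ultimately show ?thesis
    by (simp add: filterlim_split_at)
qed

lemma flat_exp_has_derivative:
  "(flat_exp m has_real_derivative flat_exp (m + 2) t - real m * flat_exp (m + 1) t) (at t)"
proof -
  consider "t > 0" | "t < 0" | "t = 0" by linarith
  then show ?thesis
  proof cases
    case 1
    have "((\<lambda>t. exp (- inverse t) * inverse t ^ m) has_real_derivative
        flat_exp (m + 2) t - real m * flat_exp (m + 1) t) (at t)"
    proof -
      \<comment> \<open>The power rule leaves the exponent \<open>n - Suc 0\<close>, truncated for n
        = 0; the factor \<open>real n\<close> vanishes there.\<close>
      have *: "real n * inverse t ^ (n - Suc 0) * (inverse t * inverse t) = real n * inverse t ^ Suc n" for n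
        by (cases n) auto
      have "((\<lambda>t. exp (- inverse t) * inverse t ^ m) has_real_derivative
          exp (- inverse t) * (inverse t * inverse t) * inverse t ^ m
          - exp (- inverse t) * (real m * inverse t ^ (m - Suc 0) * (inverse t * inverse t))) (at t)"
        using 1 by (auto intro!: derivative_eq_intros simp: algebra_simps)
      with 1 show ?thesis unfolding * by (simp add: flat_exp_def algebra_simps)
    qed
    then show ?thesis
      by (rule DERIV_cong_ev[THEN iffD1, rotated -1])
         (use 1 in \<open>auto simp: flat_exp_def intro!: eventually_mono[OF eventually_nhds_in_open[of "{0<..}"]]\<close>)
  next
    case 2
    have "((\<lambda>_. 0) has_real_derivative 0) (at t)" by simp
    then have "(flat_exp m has_real_derivative 0) (at t)"
      by (rule DERIV_cong_ev[THEN iffD1, rotated -1])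
         (use 2 in \<open>auto simp: flat_exp_def intro!: eventually_mono[OF eventually_nhds_in_open[of "{..<0}"]]\<close>)
    with 2 show ?thesis by (simp add: flat_exp_def)
  next
    case 3
    then show ?thesis using flat_exp_quotient_tendsto[of m]
      by (simp add: has_field_derivative_iff flat_exp_def cong: if_cong)
  qed
qed

text \<open>Induction with \<open>m\<close> arbitrary: a derivative lowers the order
  \<open>n\<close> but raises the index to \<open>m + 1\<close> and \<open>m + 2\<close>.\<close>

lemma Ck_flat_exp:
  "Ck n (\<lambda>x. complex_of_real (q x)) \<Longrightarrow> Ck n (\<lambda>x. complex_of_real (flat_exp m (q x)))"
proof (induction n arbitrary: m)
  case 0
  have "continuous_on UNIV (flat_exp m)"
    using DERIV_isCont[OF flat_exp_has_derivative] by (simp add: continuous_at_imp_continuous_on)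
  moreover have "continuous_on UNIV q" using continuous_on_Re[of UNIV "\<lambda>x. complex_of_real (q x)"] 0 by simp
  ultimately show ?case
    by (auto intro!: continuous_on_of_real continuous_on_compose2[of UNIV "flat_exp m" UNIV q])
next
  case (Suc n)
  let ?q = "\<lambda>x. complex_of_real (q x)"
  have q: "(q has_derivative (\<lambda>v. Re (frechet_derivative ?q (at x) v))) (at x)" for x
    using has_derivative_Re[OF frechet_has_derivative[OF Ck_differentiable[OF Suc.prems]], of x] by simp
  have pdq: "pd i ?q x = of_real (Re (frechet_derivative ?q (at x) (axis i 1)))" for i x
    by (rule pd_eqI[OF has_derivative_of_real[OF q]])
  have d: "((\<lambda>x. complex_of_real (flat_exp m (q x))) has_derivative
      (\<lambda>v. of_real (Re (frechet_derivative ?q (at x) v) *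
          (flat_exp (m + 2) (q x) - real m * flat_exp (m + 1) (q x))))) (at x)" for x
    by (rule has_derivative_of_real[OF DERIV_compose_FDERIV[OF flat_exp_has_derivative q]])
  have "pd i (\<lambda>x. complex_of_real (flat_exp m (q x))) = (\<lambda>x. pd i ?q x *
      (of_real (flat_exp (m + 2) (q x)) - of_real m * of_real (flat_exp (m + 1) (q x))))" for i
    unfolding pdq by (rule ext) (simp add: pd_eqI[OF d])
  moreover have "Ck n ?q" using Ck_SucD[OF Suc.prems] .
  ultimately show ?case using Suc.prems d
    by (auto intro!: Ck_mult Ck_diff Ck_const Suc.IH simp: differentiable_def simp del: of_real_of_nat_eq)
qed

section \<open>Algebra of smooth functions\<close>

lemma smooth_continuous: "smooth f \<Longrightarrow> continuous_on UNIV f"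
  using Ck_continuous smooth_def by blast

lemma smooth_differentiable: "smooth f \<Longrightarrow> f differentiable at x"
  using Ck_differentiable smooth_def by blast

lemma smooth_pd: "smooth f \<Longrightarrow> smooth (pd i f)"
  by (meson Ck.simps(2) smooth_def)

lemma smooth_const: "smooth (\<lambda>_. c)"
  by (simp add: smooth_def Ck_const)

lemma smooth_diff: "smooth f \<Longrightarrow> smooth g \<Longrightarrow> smooth (\<lambda>x. f x - g x)"
  by (simp add: smooth_def Ck_diff)

lemma smooth_mult: "smooth f \<Longrightarrow> smooth g \<Longrightarrow> smooth (\<lambda>x. f x * g x)"
  by (simp add: smooth_def Ck_mult)

lemma smooth_affine: "smooth f \<Longrightarrow> smooth (\<lambda>x. f (c *\<^sub>R (x - z)))"
  by (simp add: smooth_def Ck_affine)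

lemma smooth_prod: "(\<And>i. i \<in> I \<Longrightarrow> smooth (f i)) \<Longrightarrow> smooth (\<lambda>x. \<Prod>i\<in>I. f i x)"
  by (induction I rule: infinite_finite_induct) (auto intro!: smooth_const smooth_mult)

lemma smooth_pd_mult: "smooth f \<Longrightarrow> smooth g \<Longrightarrow>
     pd i (\<lambda>x. f x * g x) x = f x * pd i g x + pd i f x * g x"
  by (simp add: pd_mult smooth_differentiable)

lemma smooth_pd_diff: "smooth f \<Longrightarrow> smooth g \<Longrightarrow>
     pd i (\<lambda>x. f x - g x) x = pd i f x - pd i g x"
  by (simp add: pd_diff smooth_differentiable)


section \<open>Cut-off functions\<close>

text \<open>The norm enters squared, as a polynomial, so no singularity arises at the origin. The
  two terms of the denominator never vanish together, because 4 - r and r - 1 cannot both be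
  non-positive.\<close>

definition bump :: "real^2 \<Rightarrow> real" where
  "bump x = flat_exp 0 (4 - (norm x)\<^sup>2) / (flat_exp 0 (4 - (norm x)\<^sup>2) + flat_exp 0 ((norm x)\<^sup>2 - 1))"

lemma flat_exp_nonneg: "flat_exp m t \<ge> 0"
  by (simp add: flat_exp_def)

lemma bump_denominator_pos: "flat_exp 0 (4 - r) + flat_exp 0 (r - 1) > 0"
  by (cases "r < 4") (auto simp: flat_exp_def add_pos_nonneg)

lemma bump_bounds: "0 \<le> bump x" "bump x \<le> 1"
  using bump_denominator_pos[of "(norm x)\<^sup>2"]
  by (auto simp: bump_def flat_exp_nonneg divide_le_eq)

lemma bump_eq_1: "norm x \<le> 1 \<Longrightarrow> bump x = 1"
  using bump_denominator_pos[of "(norm x)\<^sup>2"] power_le_one[of "norm x" 2]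
  by (auto simp: bump_def flat_exp_def split: if_splits)

lemma bump_eq_0: "norm x \<ge> 2 \<Longrightarrow> bump x = 0"
  using power_mono[of 2 "norm x" 2] by (auto simp: bump_def flat_exp_def)

lemma smooth_bump: "smooth (\<lambda>x. complex_of_real (bump x))"
proof -
  have q: "complex_of_real ((norm x)\<^sup>2) = of_real (x $ 1) * of_real (x $ 1) + of_real (x $ 2) * of_real (x $ 2)"
    for x :: "real^2"
    by (simp add: power2_norm_eq_inner inner_vec_def UNIV_2)
  have Q: "Ck n (\<lambda>x. of_real ((norm x)\<^sup>2))" for n
    unfolding q by (intro Ck_add Ck_mult Ck_component)
  have 1: "Ck n (\<lambda>x. complex_of_real (flat_exp 0 (4 - (norm x)\<^sup>2)))" for n
    by (rule Ck_flat_exp) (use Ck_diff[OF Ck_const[of n 4] Q] in simp)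
  have 2: "Ck n (\<lambda>x. complex_of_real (flat_exp 0 ((norm x)\<^sup>2 - 1)))" for n
    by (rule Ck_flat_exp) (use Ck_diff[OF Q Ck_const[of n 1]] in simp)
  have "(of_real (flat_exp 0 (4 - (norm x)\<^sup>2)) + of_real (flat_exp 0 ((norm x)\<^sup>2 - 1)) :: complex) \<noteq> 0" for x :: "real^2"
    using bump_denominator_pos[of "(norm x)\<^sup>2"] by (metis less_irrefl of_real_add of_real_eq_0_iff)
  from Ck_mult[OF 1 Ck_inverse[OF Ck_add[OF 1 2] this]]
  show ?thesis unfolding smooth_def bump_def by (simp add: divide_inverse)
qed

section \<open>Test functions and cut-offs of compact sets\<close>

lemma test_functionsI:
  "smooth \<phi> \<Longrightarrow> compact K \<Longrightarrow> K \<subseteq> U \<Longrightarrow> (\<And>x. x \<notin> K \<Longrightarrow> \<phi> x = 0) \<Longrightarrow> \<phi> \<in> test_functions U"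
  unfolding test_functions_def by blast

lemma test_functionsE:
  assumes "\<phi> \<in> test_functions U"
  obtains K where "smooth \<phi>" "compact K" "K \<subseteq> U" "\<And>x. x \<notin> K \<Longrightarrow> \<phi> x = 0"
  using assms unfolding test_functions_def by blast

lemma test_functions_mult:
  assumes "\<phi> \<in> test_functions U" "smooth f"
  shows "(\<lambda>x. f x * \<phi> x) \<in> test_functions U"
  using assms(1)
proof (rule test_functionsE)
  fix K assume "smooth \<phi>" "compact K" "K \<subseteq> U" "\<And>x. x \<notin> K \<Longrightarrow> \<phi> x = 0"
  then show ?thesis using assms(2) by (intro test_functionsI[of _ K] smooth_mult) auto
qed

lemma test_functions_mono: "U \<subseteq> V \<Longrightarrow> \<phi> \<in> test_functions U \<Longrightarrow> \<phi> \<in> test_functions V"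
  by (elim test_functionsE) (auto intro: test_functionsI)

lemma norm_rescale: "r > 0 \<Longrightarrow> norm ((1 / r) *\<^sub>R (x - z)) = dist z x / r"
  by (simp add: dist_commute dist_norm del: scaleR_right_diff_distrib)

lemma bump_test_function:
  assumes "r > 0" "cball z (2 * r) \<subseteq> U"
  shows "(\<lambda>x. complex_of_real (bump ((1 / r) *\<^sub>R (x - z)))) \<in> test_functions U"
proof -
  have "bump ((1 / r) *\<^sub>R (x - z)) = 0" if "x \<notin> cball z (2 * r)" for x
    using that assms(1) by (intro bump_eq_0) (simp only: norm_rescale, simp add: le_divide_eq)
  with smooth_affine[OF smooth_bump, of "1 / r" z] assms show ?thesis
    by (intro test_functionsI[of _ "cball z (2 * r)"]) auto
qed

lemma bump_ball_eq_1: "dist z x < r \<Longrightarrow> bump ((1 / r) *\<^sub>R (x - z)) = 1"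
  using zero_le_dist[of z x] norm_rescale[of r x z]
  by (intro bump_eq_1) (simp del: zero_le_dist scaleR_right_diff_distrib)

text \<open>One minus the product of \<open>1 - bump\<close> over a finite cover: a single vanishing
  factor makes the value 1, and all factors are 1 outside the doubled balls.\<close>

lemma compact_cutoff:
  assumes "compact K" "open U" "K \<subseteq> U"
  obtains \<psi> V where "(\<lambda>x. complex_of_real (\<psi> x)) \<in> test_functions U" "\<And>x. 0 \<le> \<psi> x" "\<And>x. \<psi> x \<le> 1"
    "open V" "K \<subseteq> V" "\<And>x. x \<in> V \<Longrightarrow> \<psi> x = 1"
proof -
  have "\<exists>r>0. cball z (2 * r) \<subseteq> U" if "z \<in> K" for z
  proof -
    obtain e where "e > 0" "cball z e \<subseteq> U" using assms \<open>z \<in> K\<close> by (meson open_contains_cball subsetD)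
    \<comment> \<open>Half the radius, since a bump of scale r lives on the ball of radius 2
      r.\<close>
    then show ?thesis by (intro exI[of _ "e/2"]) auto
  qed
  then obtain r where r: "\<And>z. z \<in> K \<Longrightarrow> r z > 0" "\<And>z. z \<in> K \<Longrightarrow> cball z (2 * r z) \<subseteq> U" by metis
  obtain T where T: "T \<subseteq> K" "finite T" "K \<subseteq> (\<Union>z\<in>T. ball z (r z))"
    using compactE_image[OF assms(1), of K "\<lambda>z. ball z (r z)"] r by force
  define \<beta> where "\<beta> z x = bump ((1 / r z) *\<^sub>R (x - z))" for z x
  define \<psi> where "\<psi> x = 1 - (\<Prod>z\<in>T. 1 - \<beta> z x)" for x
  define V where "V = (\<Union>z\<in>T. ball z (r z))"
  have \<beta>: "0 \<le> \<beta> z x" "\<beta> z x \<le> 1" for z x by (auto simp: \<beta>_def bump_bounds)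
  have "smooth (\<lambda>x. complex_of_real (\<psi> x))"
    unfolding \<psi>_def \<beta>_def of_real_diff of_real_prod of_real_1
    by (intro smooth_diff smooth_const smooth_prod smooth_affine[OF smooth_bump])
  moreover have "\<psi> x = 0" if "x \<notin> (\<Union>z\<in>T. cball z (2 * r z))" for x
  proof -
    have "1 - \<beta> z x = 1" if "z \<in> T" for z
    proof -
      from that T r have "r z > 0" by auto
      moreover from \<open>x \<notin> _\<close> that have "2 * r z < dist z x" by auto
      ultimately have "norm ((1 / r z) *\<^sub>R (x - z)) \<ge> 2" by (simp only: norm_rescale) (simp add: le_divide_eq)
      then show ?thesis by (simp add: \<beta>_def bump_eq_0 del: scaleR_right_diff_distrib)
    qed
    then show ?thesis by (simp add: \<psi>_def)
  qed
  moreover have "compact (\<Union>z\<in>T. cball z (2 * r z))" using T by (intro compact_UN) auto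
  moreover have "(\<Union>z\<in>T. cball z (2 * r z)) \<subseteq> U" using T r by blast
  ultimately have "(\<lambda>x. complex_of_real (\<psi> x)) \<in> test_functions U"
    by (intro test_functionsI[of _ "\<Union>z\<in>T. cball z (2 * r z)"]) auto
  moreover have "0 \<le> \<psi> x" "\<psi> x \<le> 1" for x
    using prod_le_1[of T "\<lambda>z. 1 - \<beta> z x"] prod_nonneg[of T "\<lambda>z. 1 - \<beta> z x"] \<beta> by (auto simp: \<psi>_def)
  moreover have "open V" "K \<subseteq> V" using T by (auto simp: V_def)
  moreover have "\<psi> x = 1" if "x \<in> V" for x
  proof -
    from that obtain z where z: "z \<in> T" "dist z x < r z" by (auto simp: V_def)
    then have "1 - \<beta> z x = 0" by (simp add: \<beta>_def bump_ball_eq_1)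
    with z T show ?thesis by (auto simp: \<psi>_def prod_zero_iff)
  qed
  ultimately show thesis using that by blast
qed

text \<open>Every partial derivative is a constant multiple of \<open>f\<close>, so smoothness
  follows by induction on the order. The shape with \<open>\<zeta> 1\<close> and
  \<open>\<zeta> 2\<close> is the one to which \<open>cgo\<close> is brought later.\<close>

lemma smooth_exp_linear:
  assumes "\<And>x. f x = exp (\<zeta> 1 * of_real (x $ 1) + \<zeta> 2 * of_real (x $ 2) + c)"
  shows "pd i f x = \<zeta> i * f x" and "smooth f"
proof -
  have d: "(f has_derivative (\<lambda>v. (\<zeta> 1 * of_real (v $ 1) + \<zeta> 2 * of_real (v $ 2)) * f x)) (at x)" for x
  proof -
    have "((\<lambda>x. \<zeta> 1 * of_real (x $ 1) + \<zeta> 2 * of_real (x $ 2) + c) has_derivative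
        (\<lambda>v. \<zeta> 1 * of_real (v $ 1) + \<zeta> 2 * of_real (v $ 2) + 0)) (at x)"
      by (intro has_derivative_add has_derivative_const has_derivative_mult_right has_derivative_of_real
          bounded_linear_imp_has_derivative bounded_linear_vec_nth)
    from has_derivative_compose[OF this DERIV_exp[unfolded has_field_derivative_def]]
    show ?thesis by (simp add: assms[abs_def] mult.commute)
  qed
  show pd: "pd i f x = \<zeta> i * f x" for i x
    using exhaust_2[of i] by (subst pd_eqI[OF d]) (auto simp: axis_def)
  have "Ck n f" for n
  proof (induction n)
    case 0
    have "continuous_on UNIV (\<lambda>x. exp (\<zeta> 1 * of_real (x $ 1) + \<zeta> 2 * of_real (x $ 2) + c))"
      by (intro continuous_intros)
    then show ?case unfolding assms[abs_def] by simp
  next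
    case (Suc n)
    have "pd i f = (\<lambda>x. \<zeta> i * f x)" for i by (rule ext) (rule pd)
    with Suc d show ?case by (auto simp: differentiable_def intro!: Ck_mult Ck_const)
  qed
  then show "smooth f" by (simp add: smooth_def)
qed


section \<open>Square integrable functions\<close>

lemma power2_sum_le: "(a + b)\<^sup>2 \<le> 2 * a\<^sup>2 + 2 * b\<^sup>2" for a b :: real
  using sum_squares_bound[of a b] by (simp add: power2_sum)

lemma power2_norm_add_le: "(norm (a + b))\<^sup>2 \<le> 2 * (norm a)\<^sup>2 + 2 * (norm b)\<^sup>2"
  by (rule order_trans[OF power_mono[OF norm_triangle_ineq] power2_sum_le]) simp

lemma power2_norm_diff_le: "(norm (a - b))\<^sup>2 \<le> 2 * (norm a)\<^sup>2 + 2 * (norm b)\<^sup>2"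
  using power2_norm_add_le[of a "-b"] by simp

lemma L2_measurable: "f \<in> L2 M \<Longrightarrow> f \<in> borel_measurable M"
  and L2_integrable: "f \<in> L2 M \<Longrightarrow> integrable M (\<lambda>x. (norm (f x))\<^sup>2)"
  by (auto simp: L2_def)

lemma L2_add:
  assumes "f \<in> L2 M" "g \<in> L2 M"
  shows "(\<lambda>x. f x + g x) \<in> L2 M"
proof -
  have [measurable]: "f \<in> borel_measurable M" "g \<in> borel_measurable M" using assms by (auto simp: L2_def)
  have "integrable M (\<lambda>x. 2 * (norm (f x))\<^sup>2 + 2 * (norm (g x))\<^sup>2)"
    using assms by (auto simp: L2_def)
  then have "integrable M (\<lambda>x. (norm (f x + g x))\<^sup>2)"
    by (rule Bochner_Integration.integrable_bound) (auto intro!: power2_norm_add_le)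
  then show ?thesis by (simp add: L2_def)
qed

lemma L2_uminus: "f \<in> L2 M \<Longrightarrow> (\<lambda>x. - f x) \<in> L2 M"
  by (auto simp: L2_def)

lemma L2_diff: "f \<in> L2 M \<Longrightarrow> g \<in> L2 M \<Longrightarrow> (\<lambda>x. f x - g x) \<in> L2 M"
  using L2_add[of f M "\<lambda>x. - g x"] L2_uminus[of g M] by simp

lemma L2_mult_bounded:
  fixes f h :: "'a \<Rightarrow> complex"
  assumes "f \<in> L2 M" "h \<in> borel_measurable M" "\<And>x. x \<in> space M \<Longrightarrow> cmod (h x) \<le> C"
  shows "(\<lambda>x. h x * f x) \<in> L2 M"
proof -
  have [measurable]: "f \<in> borel_measurable M" "h \<in> borel_measurable M" using assms by (auto simp: L2_def)
  have "integrable M (\<lambda>x. C\<^sup>2 * (norm (f x))\<^sup>2)"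
    using assms by (auto simp: L2_def)
  then have "integrable M (\<lambda>x. (norm (h x * f x))\<^sup>2)"
    by (rule Bochner_Integration.integrable_bound)
       (auto simp: norm_mult power_mult_distrib intro!: AE_I2 mult_right_mono power_mono assms)
  then show ?thesis by (simp add: L2_def)
qed

lemma L2_mult_integrable:
  fixes f g :: "'a \<Rightarrow> complex"
  assumes "f \<in> L2 M" "g \<in> L2 M"
  shows "integrable M (\<lambda>x. f x * g x)"
proof -
  have [measurable]: "f \<in> borel_measurable M" "g \<in> borel_measurable M" using assms by (auto simp: L2_def)
  have "integrable M (\<lambda>x. (cmod (f x))\<^sup>2 + (cmod (g x))\<^sup>2)"
    using assms by (auto simp: L2_def)
  then show ?thesis
  proof (rule Bochner_Integration.integrable_bound, goal_cases)
    case 2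
    have "cmod (f x * g x) \<le> norm ((cmod (f x))\<^sup>2 + (cmod (g x))\<^sup>2)" for x
  proof -
    have "2 * (cmod (f x) * cmod (g x)) \<le> (cmod (f x))\<^sup>2 + (cmod (g x))\<^sup>2"
      using sum_squares_bound[of "cmod (f x)" "cmod (g x)"] by simp
    moreover have "0 \<le> cmod (f x) * cmod (g x)" by simp
    ultimately show ?thesis unfolding norm_mult real_norm_def by linarith
    qed
    then show ?case by simp
  qed simp
qed

text \<open>The inequality for nonnegative extended integrals is applied to the moduli and
  transferred back to real integrals.\<close>

lemma L2_Cauchy_Schwarz:
  fixes f g :: "'a \<Rightarrow> complex"
  assumes "f \<in> L2 M" "g \<in> L2 M"
  shows "(cmod (LINT x|M. f x * g x))\<^sup>2 \<le> (LINT x|M. (cmod (f x))\<^sup>2) * (LINT x|M. (cmod (g x))\<^sup>2)"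
proof -
  have [measurable]: "f \<in> borel_measurable M" "g \<in> borel_measurable M" using assms by (auto simp: L2_def)
  let ?F = "LINT x|M. (cmod (f x))\<^sup>2" and ?G = "LINT x|M. (cmod (g x))\<^sup>2" and ?H = "LINT x|M. cmod (f x * g x)"
  have F: "(\<integral>\<^sup>+x. (ennreal (cmod (f x)))\<^sup>2 \<partial>M) = ennreal ?F"
    using assms(1) by (subst nn_integral_eq_integral[symmetric]) (auto simp: L2_def ennreal_power)
  have G: "(\<integral>\<^sup>+x. (ennreal (cmod (g x)))\<^sup>2 \<partial>M) = ennreal ?G"
    using assms(2) by (subst nn_integral_eq_integral[symmetric]) (auto simp: L2_def ennreal_power)
  have H: "(\<integral>\<^sup>+x. ennreal (cmod (f x)) * ennreal (cmod (g x)) \<partial>M) = ennreal ?H"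
    using integrable_norm[OF L2_mult_integrable[OF assms]]
    by (subst nn_integral_eq_integral[symmetric]) (auto simp: norm_mult ennreal_mult)
  have "(ennreal ?H)\<^sup>2 \<le> ennreal ?F * ennreal ?G"
    using Cauchy_Schwarz_nn_integral[of "\<lambda>x. ennreal (cmod (f x))" M "\<lambda>x. ennreal (cmod (g x))"]
    unfolding F G H by simp
  moreover have nonneg: "0 \<le> ?F" "0 \<le> ?G" "0 \<le> ?H" by auto
  moreover have "(ennreal ?H)\<^sup>2 = ennreal (?H\<^sup>2)" by (rule ennreal_power[OF nonneg(3)])
  moreover have "ennreal ?F * ennreal ?G = ennreal (?F * ?G)" by (rule ennreal_mult[OF nonneg(1,2), symmetric])
  ultimately have "?H\<^sup>2 \<le> ?F * ?G"
    by (metis ennreal_le_iff mult_nonneg_nonneg)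
  moreover have "cmod (LINT x|M. f x * g x) \<le> ?H" by (rule integral_norm_bound)
  ultimately show ?thesis by (meson norm_ge_zero order_trans power_mono)
qed

lemma L2_tendsto_integral_mult:
  fixes f :: "nat \<Rightarrow> 'a \<Rightarrow> complex" and f' g :: "'a \<Rightarrow> complex"
  assumes "\<And>n. f n \<in> L2 M" "f' \<in> L2 M" "g \<in> L2 M"
    and "(\<lambda>n. LINT x|M. (cmod (f n x - f' x))\<^sup>2) \<longlonglongrightarrow> 0"
  shows "(\<lambda>n. LINT x|M. f n x * g x) \<longlonglongrightarrow> (LINT x|M. f' x * g x)"
proof -
  let ?e = "\<lambda>n. (LINT x|M. (cmod (f n x - f' x))\<^sup>2) * (LINT x|M. (cmod (g x))\<^sup>2)"
  have "?e \<longlonglongrightarrow> 0" using tendsto_mult_left_zero[OF assms(4)] .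
  then have *: "(\<lambda>n. sqrt (?e n)) \<longlonglongrightarrow> 0" using tendsto_real_sqrt by fastforce
  have "cmod ((LINT x|M. f n x * g x) - (LINT x|M. f' x * g x)) \<le> sqrt (?e n)" for n
  proof -
    have "(LINT x|M. f n x * g x) - (LINT x|M. f' x * g x) = (LINT x|M. (f n x - f' x) * g x)"
      using L2_mult_integrable[OF assms(1,3), of n] L2_mult_integrable[OF assms(2,3)]
      by (simp add: left_diff_distrib)
    then show ?thesis
      using L2_Cauchy_Schwarz[OF L2_diff[OF assms(1)[of n] assms(2)] assms(3)] by (simp add: real_le_rsqrt)
  qed
  then show ?thesis
    using Lim_null_comparison[OF _ *] Lim_null by (metis (no_types, lifting) always_eventually)
qed

lemma L2_vec_iff:
  fixes G :: "'a \<Rightarrow> complex^2"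
  shows "G \<in> L2 M \<longleftrightarrow> (\<forall>i. (\<lambda>x. G x $ i) \<in> L2 M)"
proof
  assume G: "G \<in> L2 M"
  then have [measurable]: "G \<in> borel_measurable M" by (auto simp: L2_def)
  have m: "(\<lambda>x. G x $ i) \<in> borel_measurable M" for i
    by (rule measurable_compose[OF _ borel_measurable_continuous_onI])  (auto intro!: continuous_intros)
  have "integrable M (\<lambda>x. (norm (G x $ i))\<^sup>2)" for i
    by (rule Bochner_Integration.integrable_bound[OF L2_integrable[OF G]])
       (use m in \<open>auto intro!: AE_I2 power_mono Finite_Cartesian_Product.norm_nth_le\<close>)
  then show "\<forall>i. (\<lambda>x. G x $ i) \<in> L2 M" using m by (auto simp: L2_def)
next
  assume G: "\<forall>i. (\<lambda>x. G x $ i) \<in> L2 M"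
  then have m[measurable]: "(\<lambda>x. G x $ i) \<in> borel_measurable M" for i by (auto simp: L2_def)
  have "G \<in> borel_measurable M"
    by (rule borel_measurable_euclidean_space[THEN iffD2]) (auto simp: Basis_vec_def inner_axis)
  moreover have "integrable M (\<lambda>x. (norm (G x))\<^sup>2)"
    using G by (auto simp: norm_vec_def L2_set_def sum_nonneg L2_def)
  ultimately show "G \<in> L2 M" by (simp add: L2_def)
qed

lemma power2_norm_complex_vec: "(norm (v :: complex^2))\<^sup>2 = (cmod (v $ 1))\<^sup>2 + (cmod (v $ 2))\<^sup>2"
  by (simp add: norm_vec_def L2_set_def sum_2)


section \<open>Integration by parts\<close>

text \<open>\<open>frechet_derivative\<close> is a choice among the derivatives at \<open>x\<close>;
  both functions have the same ones there, so the choices agree even if there are none.\<close>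

lemma pd_cong_open:
  assumes "open V" "x \<in> V" "\<And>y. y \<in> V \<Longrightarrow> f y = g y"
  shows "pd i f x = pd i g x"
proof -
  have "(f has_derivative D) (at x) \<longleftrightarrow> (g has_derivative D) (at x)" for D
    using assms has_derivative_transform_within_open[of f D x UNIV V g]
      has_derivative_transform_within_open[of g D x UNIV V f] by auto
  then show ?thesis by (simp add: pd_def frechet_derivative_def)
qed

lemma pd_test_functions:
  assumes "\<phi> \<in> test_functions U" shows "pd i \<phi> \<in> test_functions U"
proof -
  obtain K where K: "smooth \<phi>" "compact K" "K \<subseteq> U" "\<And>x. x \<notin> K \<Longrightarrow> \<phi> x = 0"
    using test_functionsE[OF assms] by metis
  have "pd i \<phi> x = 0" if "x \<notin> K" for x
    using pd_cong_open[of "-K" x \<phi> "\<lambda>_. 0" i] K that by (auto simp: compact_imp_closed open_Compl)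
  with K show ?thesis by (intro test_functionsI[of _ K] smooth_pd) auto
qed

definition dird :: "real^2 \<Rightarrow> (real^2 \<Rightarrow> complex) \<Rightarrow> real^2 \<Rightarrow> complex" where
  "dird b f x = of_real (b $ 1) * pd 1 f x + of_real (b $ 2) * pd 2 f x"

lemma has_vector_derivative_line:
  assumes "smooth f"
  shows "((\<lambda>t. f (x + t *\<^sub>R b)) has_vector_derivative dird b f (x + t *\<^sub>R b)) (at t)"
proof -
  let ?D = "frechet_derivative f (at (x + t *\<^sub>R b))"
  have D: "(f has_derivative ?D) (at (x + t *\<^sub>R b))"
    by (rule frechet_has_derivative[OF smooth_differentiable[OF assms]])
  have lin: "linear ?D" using D by (rule has_derivative_linear)
  have b: "b = b $ 1 *\<^sub>R axis 1 1 + b $ 2 *\<^sub>R axis 2 1"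
    by (simp add: vec_eq_iff forall_2 axis_def)
  have "?D b = b $ 1 *\<^sub>R ?D (axis 1 1) + b $ 2 *\<^sub>R ?D (axis 2 1)"
    by (subst b) (simp add: linear_add[OF lin] linear_cmul[OF lin])
  then have Db: "?D b = dird b f (x + t *\<^sub>R b)" by (simp add: dird_def pd_def scaleR_conv_of_real)
  have "((\<lambda>t. f (x + t *\<^sub>R b)) has_derivative (\<lambda>s. ?D (s *\<^sub>R b))) (at t)"
    by (rule has_derivative_compose[of "\<lambda>t. x + t *\<^sub>R b" "\<lambda>s. s *\<^sub>R b" t UNIV f, OF _ D])
       (auto intro!: derivative_eq_intros)
  then show ?thesis
    by (simp add: has_vector_derivative_def linear_cmul[OF lin] Db)
qed

lemma dird_axis: "dird (axis i 1) f x = pd i f x"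
  using exhaust_2[of i] by (auto simp: dird_def axis_def)

lemma smooth_bounded:
  assumes "smooth f" "bounded S"
  obtains C where "C > 0" "\<And>x. x \<in> S \<Longrightarrow> cmod (f x) \<le> C"
proof -
  have "bounded (f ` closure S)"
    using assms by (intro compact_imp_bounded compact_continuous_image continuous_on_subset[OF smooth_continuous])
      (auto simp: compact_closure)
  then obtain C where "C > 0" "\<forall>y\<in>f ` closure S. norm y \<le> C" unfolding bounded_pos by blast
  then show thesis using that closure_subset by blast
qed

lemma test_function_integrable:
  assumes "\<phi> \<in> test_functions U"
  shows "integrable lborel \<phi>"
proof -
  obtain K where K: "smooth \<phi>" "compact K" "\<And>x. x \<notin> K \<Longrightarrow> \<phi> x = 0"
    using test_functionsE[OF assms] by metis
  have "integrable lborel (\<lambda>x. indicator K x *\<^sub>R \<phi> x)"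
    by (rule borel_integrable_compact[OF K(2)]) (use smooth_continuous[OF K(1)] continuous_on_subset in blast)
  also have "(\<lambda>x. indicator K x *\<^sub>R \<phi> x) = \<phi>" using K(3) by (auto simp: indicator_def)
  finally show ?thesis .
qed

lemma test_function_integral_translate:
  assumes "\<phi> \<in> test_functions U"
  shows "integrable lborel (\<lambda>x. \<phi> (x + c))" "(LINT x|lborel. \<phi> (x + c)) = (LINT x|lborel. \<phi> x)"
proof -
  have m: "\<phi> \<in> borel_measurable borel"
    using test_functionsE[OF assms] smooth_continuous borel_measurable_continuous_onI by metis
  have d: "(lborel :: (real^2) measure) = distr lborel borel (\<lambda>x. x + c)"
    using lborel_distr_plus[of c] by (metis (no_types, lifting) add.commute distr_cong)
  show "integrable lborel (\<lambda>x. \<phi> (x + c))"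
    using test_function_integrable[OF assms] m by (subst (asm) d) (simp add: integrable_distr_eq)
  show "(LINT x|lborel. \<phi> (x + c)) = (LINT x|lborel. \<phi> x)"
    using m by (subst (2) d) (simp add: integral_distr)
qed

text \<open>Translation invariance makes the integral of every difference quotient zero; dominated
  convergence passes this on to the derivative.\<close>

lemma integral_pd_eq_0:
  assumes "\<phi> \<in> test_functions U"
  shows "(LINT x|lborel. pd i \<phi> x) = 0"
proof -
  obtain K where K: "smooth \<phi>" "compact K" "\<And>x. x \<notin> K \<Longrightarrow> \<phi> x = 0"
    using test_functionsE[OF assms] by metis
  define e :: "real^2" where "e = axis i 1"
  \<comment> \<open>Thickening by the unit ball catches the supports of all difference quotients,
    whose steps are at most 1; this yields one integrable majorant.\<close>
  define K' where "K' = {x + y |x y. x \<in> K \<and> y \<in> cball 0 1}"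
  have K': "compact K'" unfolding K'_def by (intro compact_sums K compact_cball)
  have neg: "x \<in> K'" if "x + t *\<^sub>R e \<in> K" "\<bar>t\<bar> \<le> 1" for x t
    unfolding K'_def using that by (intro CollectI exI[of _ "x + t *\<^sub>R e"] exI[of _ "- (t *\<^sub>R e)"]) (auto simp: e_def)
  obtain C where C: "C > 0" "\<And>x. x \<in> K \<Longrightarrow> cmod (pd i \<phi> x) \<le> C"
    using smooth_bounded[OF smooth_pd[OF K(1)] compact_imp_bounded[OF K(2)]] by metis
  have C': "cmod (pd i \<phi> x) \<le> C" for x
  proof (cases "x \<in> K")
    case False
    then have "pd i \<phi> x = 0"
      using pd_cong_open[of "-K" x \<phi> "\<lambda>_. 0" i] K by (auto simp: compact_imp_closed open_Compl)
    then show ?thesis using C by simp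
  qed (use C in auto)
  have line: "((\<lambda>t. \<phi> (x + t *\<^sub>R e)) has_vector_derivative pd i \<phi> (x + t *\<^sub>R e)) (at t)" for x t
    using has_vector_derivative_line[OF K(1), of x e t] by (simp add: e_def dird_axis)
  define q where "q n x = of_real (Suc n) * (\<phi> (x + (1 / Suc n) *\<^sub>R e) - \<phi> x)" for n x
  have "(\<lambda>n. LINT x|lborel. q n x) \<longlonglongrightarrow> (LINT x|lborel. pd i \<phi> x)"
  proof (rule integral_dominated_convergence[where w="\<lambda>x. indicator K' x *\<^sub>R C"])
    show "integrable lborel (\<lambda>x. indicator K' x *\<^sub>R C)"
      by (rule borel_integrable_compact[OF K']) auto
    show "pd i \<phi> \<in> borel_measurable lborel"
      using smooth_continuous[OF smooth_pd[OF K(1)]] by (simp add: borel_measurable_continuous_onI)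
    have [measurable]: "\<phi> \<in> borel_measurable borel" using smooth_continuous[OF K(1)] by (simp add: borel_measurable_continuous_onI)
    show "q n \<in> borel_measurable lborel" for n unfolding q_def by measurable
    show "AE x in lborel. (\<lambda>n. q n x) \<longlonglongrightarrow> pd i \<phi> x"
    proof (rule AE_I2)
      fix x
      let ?h = "\<lambda>n. 1 / real (Suc n)"
      have h: "filterlim ?h (at 0) sequentially"
        using LIMSEQ_inverse_real_of_nat by (auto simp: filterlim_at divide_inverse)
      have "((\<lambda>h. norm (\<phi> (x + h *\<^sub>R e) - \<phi> x - h *\<^sub>R pd i \<phi> x) / norm h) \<longlongrightarrow> 0) (at 0)"
        using line[of x 0] by (simp add: has_vector_derivative_def has_derivative_at)
      from filterlim_compose[OF this h]
      have "(\<lambda>n. norm (\<phi> (x + ?h n *\<^sub>R e) - \<phi> x - ?h n *\<^sub>R pd i \<phi> x) / norm (?h n)) \<longlonglongrightarrow> 0" .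
      also have "(\<lambda>n. norm (\<phi> (x + ?h n *\<^sub>R e) - \<phi> x - ?h n *\<^sub>R pd i \<phi> x) / norm (?h n)) = (\<lambda>n. norm (q n x - pd i \<phi> x))"
      proof
        fix n
        have "q n x - pd i \<phi> x = of_real (Suc n) * (\<phi> (x + ?h n *\<^sub>R e) - \<phi> x - ?h n *\<^sub>R pd i \<phi> x)"
          by (simp add: q_def right_diff_distrib scaleR_conv_of_real del: of_nat_Suc)
        then show "norm (\<phi> (x + ?h n *\<^sub>R e) - \<phi> x - ?h n *\<^sub>R pd i \<phi> x) / norm (?h n) = norm (q n x - pd i \<phi> x)"
          by (simp only: norm_mult norm_of_real) (simp del: of_nat_Suc)
      qed
      finally show "(\<lambda>n. q n x) \<longlonglongrightarrow> pd i \<phi> x"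
        by (simp add: tendsto_norm_zero_iff LIM_zero_iff)
    qed
    show "AE x in lborel. cmod (q n x) \<le> indicator K' x *\<^sub>R C" for n
    proof (rule AE_I2)
      fix x
      have le1: "1 / real (Suc n) \<le> 1" by simp
      show "cmod (q n x) \<le> indicator K' x *\<^sub>R C"
      proof (cases "x \<in> K'")
        case True
        have "cmod (\<phi> (x + (1 / Suc n) *\<^sub>R e) - \<phi> (x + 0 *\<^sub>R e)) \<le> C * norm (1 / Suc n - 0)"
        proof (rule differentiable_bound[where S=UNIV and f="\<lambda>t. \<phi> (x + t *\<^sub>R e)"])
          show "((\<lambda>t. \<phi> (x + t *\<^sub>R e)) has_derivative (\<lambda>s. s *\<^sub>R pd i \<phi> (x + t *\<^sub>R e))) (at t within UNIV)" for t
            using line[of x t] by (simp add: has_vector_derivative_def)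
          show "onorm (\<lambda>s. s *\<^sub>R pd i \<phi> (x + t *\<^sub>R e)) \<le> C" for t
            by (rule onorm_bound) (use C' C(1) in \<open>auto simp: mult.commute[of C] mult_left_mono\<close>)
        qed auto
        then have "cmod (q n x) \<le> real (Suc n) * (C * (1 / Suc n))"
          unfolding q_def norm_mult norm_of_real by (intro mult_mono) (auto simp del: of_nat_Suc)
        then show ?thesis using True by simp
      next
        case False
        then have "x \<notin> K" "x + (1 / Suc n) *\<^sub>R e \<notin> K" using neg[of x 0] neg[of x "1 / Suc n"] le1 by auto
        then show ?thesis using False K(3) by (simp add: q_def)
      qed
    qed
  qed
  moreover have "(LINT x|lborel. q n x) = 0" for n
    using test_function_integral_translate[OF assms, of "(1 / Suc n) *\<^sub>R e"] test_function_integrable[OF assms]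
    by (simp add: q_def)
  ultimately show ?thesis by (simp add: LIMSEQ_const_iff)
qed


section \<open>Weak gradients\<close>

text \<open>Cut-offs that are 1 on an exhaustion of \<open>U\<close> by compact sets tend pointwise
  to its indicator and never exceed 1, so the modulus of \<open>G\<close> is a majorant.\<close>

lemma fundamental_lemma_open:
  assumes "open U" "U \<subseteq> \<Omega>" "open \<Omega>" "integrable lebesgue (\<lambda>x. indicator \<Omega> x *\<^sub>R (G x :: complex))"
    and "\<And>\<phi>. \<phi> \<in> test_functions \<Omega> \<Longrightarrow> (LINT x|lebesgue. indicator \<Omega> x *\<^sub>R (G x * \<phi> x)) = 0"
  shows "(LINT x|lebesgue. indicator U x *\<^sub>R (indicator \<Omega> x *\<^sub>R G x)) = 0"
proof -
  obtain K where K: "\<And>n::nat. compact (K n)" "\<And>n. K n \<subseteq> U" "\<And>n. K n \<subseteq> interior (K (Suc n))"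
    "\<Union>(range K) = U" "\<And>C. \<lbrakk>compact C; C \<subseteq> U\<rbrakk> \<Longrightarrow> \<exists>N. \<forall>n\<ge>N. C \<subseteq> K n"
    using open_Union_compact_subsets[OF assms(1)] by metis
  have "\<exists>\<psi>. (\<lambda>x. complex_of_real (\<psi> x)) \<in> test_functions U \<and> (\<forall>x. 0 \<le> \<psi> x \<and> \<psi> x \<le> 1) \<and> (\<forall>x\<in>K n. \<psi> x = 1)" for n
    by (rule compact_cutoff[OF K(1)[of n] assms(1) K(2)[of n]]) blast
  then obtain \<psi> where \<psi>: "\<And>n. (\<lambda>x. complex_of_real (\<psi> n x)) \<in> test_functions U"
    "\<And>n x. 0 \<le> \<psi> n x" "\<And>n x. \<psi> n x \<le> 1" "\<And>n x. x \<in> K n \<Longrightarrow> \<psi> n x = 1" by metis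
  have m: "(\<lambda>x. complex_of_real (\<psi> n x)) \<in> borel_measurable lebesgue" for n
  proof -
    have "smooth (\<lambda>x. complex_of_real (\<psi> n x))" using \<psi>(1) by (auto elim: test_functionsE)
    then have "(\<lambda>x. complex_of_real (\<psi> n x)) \<in> borel_measurable lborel"
      using smooth_continuous borel_measurable_continuous_onI by auto
    then show ?thesis by (rule measurable_completion)
  qed
  have U: "U \<in> sets lebesgue" using assms(1) by (simp add: borel_open)
  have gm: "(\<lambda>x. indicator \<Omega> x *\<^sub>R G x) \<in> borel_measurable lebesgue"
    using assms(4) by (rule borel_measurable_integrable)
  have "(\<lambda>n. LINT x|lebesgue. (indicator \<Omega> x *\<^sub>R G x) * complex_of_real (\<psi> n x))
      \<longlonglongrightarrow> (LINT x|lebesgue. indicator U x *\<^sub>R (indicator \<Omega> x *\<^sub>R G x))"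
  proof (rule integral_dominated_convergence[where w="\<lambda>x. norm (indicator \<Omega> x *\<^sub>R G x)"])
    show "(\<lambda>x. indicator U x *\<^sub>R (indicator \<Omega> x *\<^sub>R G x)) \<in> borel_measurable lebesgue"
      by (rule borel_measurable_scaleR[OF borel_measurable_indicator[OF U] gm])
    show "(\<lambda>x. (indicator \<Omega> x *\<^sub>R G x) * complex_of_real (\<psi> n x)) \<in> borel_measurable lebesgue" for n
      by (rule borel_measurable_times[OF gm m])
    show "integrable lebesgue (\<lambda>x. norm (indicator \<Omega> x *\<^sub>R G x))" using assms(4) by (rule integrable_norm)
    show "AE x in lebesgue. (\<lambda>n. (indicator \<Omega> x *\<^sub>R G x) * complex_of_real (\<psi> n x))
        \<longlonglongrightarrow> indicator U x *\<^sub>R (indicator \<Omega> x *\<^sub>R G x)"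
    proof (rule AE_I2)
      fix x
      show "(\<lambda>n. (indicator \<Omega> x *\<^sub>R G x) * complex_of_real (\<psi> n x)) \<longlonglongrightarrow> indicator U x *\<^sub>R (indicator \<Omega> x *\<^sub>R G x)"
      proof (cases "x \<in> U")
        case True
        then obtain N where "\<forall>n\<ge>N. x \<in> K n" using K(5)[of "{x}"] by auto
        then have "\<forall>\<^sub>F n in sequentially. (indicator \<Omega> x *\<^sub>R G x) * complex_of_real (\<psi> n x) = indicator U x *\<^sub>R (indicator \<Omega> x *\<^sub>R G x)"
          using \<psi>(4) True by (auto simp: eventually_sequentially)
        then show ?thesis by (rule tendsto_eventually)
      next
        case False
        have "\<psi> n x = 0" for n
        proof -
          obtain L where "L \<subseteq> U" "\<And>x. x \<notin> L \<Longrightarrow> complex_of_real (\<psi> n x) = 0"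
            using test_functionsE[OF \<psi>(1)[of n]] by metis
          then show ?thesis using False by auto
        qed
        then show ?thesis using False by simp
      qed
    qed
    show "AE x in lebesgue. norm ((indicator \<Omega> x *\<^sub>R G x) * complex_of_real (\<psi> n x)) \<le> norm (indicator \<Omega> x *\<^sub>R G x)" for n
      using \<psi>(2,3) unfolding norm_mult norm_of_real by (intro AE_I2 mult_left_le) auto
  qed
  moreover have "(LINT x|lebesgue. (indicator \<Omega> x *\<^sub>R G x) * complex_of_real (\<psi> n x)) = 0" for n
    using assms(5)[OF test_functions_mono[OF assms(2) \<psi>(1)], of n] by simp
  ultimately show ?thesis by (simp add: LIMSEQ_const_iff)
qed

text \<open>Open sets are an intersection-stable generator of the Borel sets, so vanishing integrals
  spread to Borel sets by a Dynkin argument and to Lebesgue sets by completion. Uniqueness of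
  densities is then applied to real and imaginary parts.\<close>

lemma fundamental_lemma:
  assumes \<Omega>: "open \<Omega>" and G: "integrable (lebesgue_on \<Omega>) (G :: real^2 \<Rightarrow> complex)"
    and 0: "\<And>\<phi>. \<phi> \<in> test_functions \<Omega> \<Longrightarrow> (LINT x|lebesgue_on \<Omega>. G x * \<phi> x) = 0"
  shows "AE x in lebesgue_on \<Omega>. G x = 0"
proof -
  have \<Omega>s: "\<Omega> \<inter> space lebesgue \<in> sets lebesgue" using \<Omega> by (simp add: borel_open)
  define g where "g x = indicator \<Omega> x *\<^sub>R G x" for x
  have g: "integrable lebesgue g" unfolding g_def
    using G integrable_restrict_space[OF \<Omega>s, of G] by simp
  have gs: "set_integrable lebesgue A g" if "A \<in> sets lebesgue" for A
    using integrable_mult_indicator[OF that g] by (simp add: set_integrable_def)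
  have opn: "(LINT x:U|lebesgue. g x) = 0" if "open U" for U
  proof -
    have "(LINT x|lebesgue. indicator (U \<inter> \<Omega>) x *\<^sub>R (indicator \<Omega> x *\<^sub>R G x)) = 0"
      using that \<Omega> g 0 unfolding g_def
      by (intro fundamental_lemma_open) (auto simp: integral_restrict_space[OF \<Omega>s, symmetric])
    also have "(\<lambda>x. indicator (U \<inter> \<Omega>) x *\<^sub>R (indicator \<Omega> x *\<^sub>R G x)) = (\<lambda>x. indicator U x *\<^sub>R g x)"
      by (auto simp: g_def indicator_def)
    finally show ?thesis by (simp add: set_lebesgue_integral_def)
  qed
  have bor: "(LINT x:A|lebesgue. g x) = 0" if "A \<in> sets borel" for A
  proof -
    have A: "A \<in> sigma_sets UNIV {S. open S}" using that by (simp add: borel_def)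
    have bl: "B \<in> sets lebesgue" if "B \<in> sigma_sets UNIV {S :: (real^2) set. open S}" for B
    proof -
      have "sets borel = sigma_sets UNIV {S :: (real^2) set. open S}" by (simp add: borel_def)
      with that have "B \<in> sets lborel" by simp
      then show ?thesis by (rule sets_completionI_sets)
    qed
    have stable: "Int_stable {S. open (S :: (real^2) set)}" by (auto simp: Int_stable_def)
    from stable subset_UNIV[of "{S. open (S :: (real^2) set)}", folded Pow_UNIV] A show ?thesis
    proof (induction rule: sigma_sets_induct_disjoint)
      case (compl A)
      have A: "A \<in> sets lebesgue" using compl(1) by (rule bl)
      have "(LINT x:A \<union> (UNIV - A)|lebesgue. g x) = (LINT x:A|lebesgue. g x) + (LINT x:UNIV - A|lebesgue. g x)"
        using A by (intro set_integral_Un gs) auto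
      moreover have "A \<union> (UNIV - A) = UNIV" by auto
      ultimately show ?case using compl opn[of UNIV] by simp
    next
      case (union A)
      have A: "A i \<in> sets lebesgue" for i using union(2) by (auto intro: bl)
      have "(LINT x:(\<Union>i. A i)|lebesgue. g x) = (\<Sum>i. LINT x:A i|lebesgue. g x)"
        using A union(1) by (intro lebesgue_integral_countable_add gs) (auto simp: disjoint_family_on_def)
      then show ?case using union by simp
    qed (auto simp: opn)
  qed
  have all: "(LINT x:A|lebesgue. g x) = 0" if A0: "A \<in> sets lebesgue" for A
  proof -
    obtain S N N' where A: "A = S \<union> N" "N \<subseteq> N'" "N' \<in> null_sets lborel" "S \<in> sets lborel"
      using A0 by (elim sets_completionE)
    have N': "N' \<in> null_sets lebesgue" using A(3) by (rule null_sets_completionI)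
    have gm: "g \<in> borel_measurable lebesgue" using g by (rule borel_measurable_integrable)
    have AS: "A \<in> sets lebesgue" "S \<in> sets lebesgue" using A0 A(4) by (auto intro: sets_completionI_sets)
    have "(LINT x:A|lebesgue. g x) = (LINT x:S|lebesgue. g x)"
      unfolding set_lebesgue_integral_def
    proof (rule integral_cong_AE)
      show "AE x in lebesgue. indicator A x *\<^sub>R g x = indicator S x *\<^sub>R g x"
        using AE_not_in[OF N'] by eventually_elim (use A(1,2) in \<open>auto simp: indicator_def\<close>)
    qed (intro borel_measurable_scaleR borel_measurable_indicator AS gm)+
    then show ?thesis using bor A(4) by simp
  qed
  have "AE x in lebesgue. Re (g x) = 0"
  proof (rule density_unique_real)
    show "integrable lebesgue (\<lambda>x. Re (g x))" using g by (rule integrable_Re)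
    fix A :: "(real^2) set" assume "A \<in> sets lebesgue"
    then show "(LINT x:A|lebesgue. Re (g x)) = (LINT x:A|lebesgue. 0)"
      using arg_cong[OF all, of A Re] integrable_mult_indicator[OF _ g, of A]
      by (simp add: set_lebesgue_integral_def flip: integral_Re)
  qed simp
  moreover have "AE x in lebesgue. Im (g x) = 0"
  proof (rule density_unique_real)
    show "integrable lebesgue (\<lambda>x. Im (g x))" using g by (rule integrable_Im)
    fix A :: "(real^2) set" assume "A \<in> sets lebesgue"
    then show "(LINT x:A|lebesgue. Im (g x)) = (LINT x:A|lebesgue. 0)"
      using arg_cong[OF all, of A Im] integrable_mult_indicator[OF _ g, of A]
      by (simp add: set_lebesgue_integral_def flip: integral_Im)
  qed simp
  ultimately have "AE x in lebesgue. g x = 0" by eventually_elim (simp add: complex_eq_iff)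
  then show ?thesis
    using AE_restrict_space_iff[OF \<Omega>s] by (simp add: g_def indicator_def)
qed

definition cgrad :: "(real^2 \<Rightarrow> complex) \<Rightarrow> real^2 \<Rightarrow> complex^2" where
  "cgrad f x = (\<chi> i. pd i f x)"

lemma cgrad_nth [simp]: "cgrad f x $ i = pd i f x"
  by (simp add: cgrad_def)

text \<open>Boundedness gives finite measure and bounds on smooth functions, so that functions
  smooth on the plane belong to \<open>H1 \<Omega>\<close>.\<close>

locale bounded_open =
  fixes \<Omega> :: "(real^2) set"
  assumes opn: "open \<Omega>" and bdd: "bounded \<Omega>"
begin

abbreviation M where "M \<equiv> lebesgue_on \<Omega>"

section \<open>Smooth functions and weak gradients on a bounded open set\<close>

lemma space_Int: "\<Omega> \<inter> space lebesgue \<in> sets lebesgue"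
  using opn by (simp add: borel_open)

lemma lmeasurable: "\<Omega> \<in> lmeasurable"
  using bounded_set_imp_lmeasurable[OF bdd] opn by (simp add: borel_open)

lemma finite_M: "finite_measure M"
  by (rule finite_measure_lebesgue_on[OF lmeasurable])

lemma smooth_measurable: "smooth f \<Longrightarrow> f \<in> borel_measurable M"
  using measurable_completion[of f lborel borel] smooth_continuous[of f] measurable_restrict_space1
  by (auto simp: borel_measurable_continuous_onI)

lemma smooth_L2: "smooth f \<Longrightarrow> f \<in> L2 M"
proof -
  assume f: "smooth f"
  obtain C where "C > 0" "\<And>x. x \<in> \<Omega> \<Longrightarrow> cmod (f x) \<le> C" using smooth_bounded[OF f bdd] by metis
  then have "integrable M (\<lambda>x. (norm (f x))\<^sup>2)"
    using smooth_measurable[OF f]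
    by (intro finite_measure.integrable_const_bound[OF finite_M, of _ "C\<^sup>2"])
       (auto simp: power_mono intro!: AE_I2)
  then show ?thesis using smooth_measurable[OF f] by (simp add: L2_def)
qed

lemma cgrad_L2: "smooth f \<Longrightarrow> cgrad f \<in> L2 M"
  by (simp add: L2_vec_iff smooth_L2 smooth_pd)

lemma smooth_mult_L2: "smooth h \<Longrightarrow> f \<in> L2 M \<Longrightarrow> (\<lambda>x. h x * f x) \<in> L2 M"
  using smooth_bounded[OF _ bdd, of h] L2_mult_bounded[of f M h] smooth_measurable[of h] by (metis space_lebesgue_on)

lemma L2_integrable1: "f \<in> L2 M \<Longrightarrow> integrable M f" for f :: "real^2 \<Rightarrow> complex"
  using L2_mult_integrable[OF _ smooth_L2[OF smooth_const[of 1]], of f] by simp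

lemma integral_test_function:
  assumes "\<phi> \<in> test_functions \<Omega>"
  shows "(LINT x|M. \<phi> x) = (LINT x|lborel. \<phi> x)"
proof -
  obtain K where K: "smooth \<phi>" "K \<subseteq> \<Omega>" "\<And>x. x \<notin> K \<Longrightarrow> \<phi> x = 0"
    using test_functionsE[OF assms] by metis
  have "(LINT x|M. \<phi> x) = (LINT x|lebesgue. indicator \<Omega> x *\<^sub>R \<phi> x)"
    by (rule integral_restrict_space[OF space_Int])
  also have "(\<lambda>x. indicator \<Omega> x *\<^sub>R \<phi> x) = \<phi>" using K by (auto simp: indicator_def fun_eq_iff)
  finally show ?thesis
    using K(1) by (simp add: integral_completion smooth_continuous borel_measurable_continuous_onI)
qed

lemma integration_by_parts:
  assumes "smooth f" "\<phi> \<in> test_functions \<Omega>"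
  shows "(LINT x|M. f x * pd i \<phi> x) = - (LINT x|M. pd i f x * \<phi> x)"
proof -
  have \<phi>: "smooth \<phi>" using assms(2) by (rule test_functionsE)
  have p: "(\<lambda>x. f x * \<phi> x) \<in> test_functions \<Omega>" by (rule test_functions_mult[OF assms(2,1)])
  have "(LINT x|M. f x * pd i \<phi> x + pd i f x * \<phi> x) = (LINT x|M. pd i (\<lambda>x. f x * \<phi> x) x)"
    by (simp add: smooth_pd_mult[OF assms(1) \<phi>])
  also have "\<dots> = 0"
    using integral_test_function[OF pd_test_functions[OF p], of i] integral_pd_eq_0[OF p, of i] by simp
  finally show ?thesis
    using L2_mult_integrable[OF smooth_L2 smooth_L2, of f "pd i \<phi>"]
      L2_mult_integrable[OF smooth_L2 smooth_L2, of "pd i f" \<phi>] assms(1) \<phi>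
    by (simp add: smooth_pd eq_neg_iff_add_eq_0)
qed

lemma is_weak_grad_smooth: "smooth f \<Longrightarrow> is_weak_grad \<Omega> f (cgrad f)"
  by (simp add: is_weak_grad_def cgrad_L2 integration_by_parts)

lemma is_weak_gradD:
  assumes "is_weak_grad \<Omega> u G"
  shows "(\<lambda>x. G x $ i) \<in> L2 M"
    and "\<phi> \<in> test_functions \<Omega> \<Longrightarrow> (LINT x|M. u x * pd i \<phi> x) = - (LINT x|M. G x $ i * \<phi> x)"
  using assms by (auto simp: is_weak_grad_def L2_vec_iff)

lemma test_function_L2: "\<phi> \<in> test_functions U \<Longrightarrow> \<phi> \<in> L2 M"
  by (auto elim: test_functionsE intro: smooth_L2)

text \<open>\<open>wgrad\<close> is fixed by choice; uniqueness lets any explicit weak gradient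
  replace it under an integral.\<close>

lemma weak_grad_unique:
  assumes "is_weak_grad \<Omega> u G" "is_weak_grad \<Omega> u H"
  shows "AE x in M. G x = H x"
proof -
  have "AE x in M. G x $ i - H x $ i = 0" for i
  proof (rule fundamental_lemma[OF opn])
    show "integrable M (\<lambda>x. G x $ i - H x $ i)"
      using assms by (intro Bochner_Integration.integrable_diff L2_integrable1 is_weak_gradD)
    fix \<phi> assume \<phi>: "\<phi> \<in> test_functions \<Omega>"
    have "(LINT x|M. G x $ i * \<phi> x) = (LINT x|M. H x $ i * \<phi> x)"
      using is_weak_gradD(2)[OF assms(1) \<phi>, of i] is_weak_gradD(2)[OF assms(2) \<phi>, of i] by simp
    then show "(LINT x|M. (G x $ i - H x $ i) * \<phi> x) = 0"
      using L2_mult_integrable[OF is_weak_gradD(1)[OF assms(1)] test_function_L2[OF \<phi>]]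
        L2_mult_integrable[OF is_weak_gradD(1)[OF assms(2)] test_function_L2[OF \<phi>]]
      by (simp add: left_diff_distrib)
  qed
  from this[of 1] this[of 2] show ?thesis
    by eventually_elim (simp add: vec_eq_iff forall_2)
qed

lemma is_weak_grad_wgrad: "u \<in> H1 \<Omega> \<Longrightarrow> is_weak_grad \<Omega> u (wgrad \<Omega> u)"
  unfolding H1_def wgrad_def by (auto intro: someI[of "is_weak_grad \<Omega> u"])

lemma wgrad_AE: "is_weak_grad \<Omega> u G \<Longrightarrow> AE x in M. wgrad \<Omega> u x = G x"
  using weak_grad_unique[of u "wgrad \<Omega> u" G] unfolding wgrad_def by (metis someI_ex)

lemma H1I: "u \<in> L2 M \<Longrightarrow> is_weak_grad \<Omega> u G \<Longrightarrow> u \<in> H1 \<Omega>"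
  by (auto simp: H1_def)

lemma H1_L2: "u \<in> H1 \<Omega> \<Longrightarrow> u \<in> L2 M"
  by (simp add: H1_def)

lemma wgrad_L2: "u \<in> H1 \<Omega> \<Longrightarrow> (\<lambda>x. wgrad \<Omega> u x $ i) \<in> L2 M"
  by (rule is_weak_gradD(1)[OF is_weak_grad_wgrad])

lemma smooth_H1: "smooth f \<Longrightarrow> f \<in> H1 \<Omega>"
  by (rule H1I[OF smooth_L2 is_weak_grad_smooth])

lemma wgrad_smooth: "smooth f \<Longrightarrow> AE x in M. wgrad \<Omega> f x = cgrad f x"
  by (rule wgrad_AE[OF is_weak_grad_smooth])

lemma is_weak_grad_diff:
  assumes "u \<in> L2 M" "v \<in> L2 M" "is_weak_grad \<Omega> u G" "is_weak_grad \<Omega> v H"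
  shows "is_weak_grad \<Omega> (\<lambda>x. u x - v x) (\<lambda>x. G x - H x)"
  unfolding is_weak_grad_def
proof (intro conjI ballI allI)
  show "(\<lambda>x. G x - H x) \<in> L2 M" using assms by (auto simp: is_weak_grad_def intro: L2_diff)
  fix \<phi> i assume \<phi>: "\<phi> \<in> test_functions \<Omega>"
  note L = test_function_L2[OF \<phi>] test_function_L2[OF pd_test_functions[OF \<phi>], of i]
  show "(LINT x|M. (u x - v x) * pd i \<phi> x) = - (LINT x|M. (G x - H x) $ i * \<phi> x)"
    using is_weak_gradD(2)[OF assms(3) \<phi>, of i] is_weak_gradD(2)[OF assms(4) \<phi>, of i]
      L2_mult_integrable[OF assms(1) L(2)] L2_mult_integrable[OF assms(2) L(2)]
      L2_mult_integrable[OF is_weak_gradD(1)[OF assms(3)] L(1), of i]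
      L2_mult_integrable[OF is_weak_gradD(1)[OF assms(4)] L(1), of i]
    by (simp add: left_diff_distrib)
qed

lemma H1_diff: "u \<in> H1 \<Omega> \<Longrightarrow> v \<in> H1 \<Omega> \<Longrightarrow> (\<lambda>x. u x - v x) \<in> H1 \<Omega>"
  by (rule H1I[OF L2_diff is_weak_grad_diff]) (auto intro: H1_L2 is_weak_grad_wgrad)

lemma wgrad_diff:
  assumes "u \<in> H1 \<Omega>" "v \<in> H1 \<Omega>"
  shows "AE x in M. wgrad \<Omega> (\<lambda>x. u x - v x) x = wgrad \<Omega> u x - wgrad \<Omega> v x"
  by (rule wgrad_AE[OF is_weak_grad_diff]) (auto intro: assms H1_L2 is_weak_grad_wgrad)

text \<open>Leibniz rule: the weak gradient of \<open>u\<close> is tested with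
  \<open>h * \<phi>\<close>, again a test function, and the term with the derivative of
  \<open>h\<close> changes sides.\<close>

lemma is_weak_grad_mult:
  assumes "smooth h" "u \<in> L2 M" "is_weak_grad \<Omega> u G"
  shows "is_weak_grad \<Omega> (\<lambda>x. h x * u x) (\<lambda>x. \<chi> i. h x * G x $ i + pd i h x * u x)"
  unfolding is_weak_grad_def L2_vec_iff
proof (intro conjI ballI allI)
  show "(\<lambda>x. (\<chi> i. h x * G x $ i + pd i h x * u x) $ i) \<in> L2 M" for i
    using assms by (auto intro!: L2_add smooth_mult_L2 smooth_pd is_weak_gradD)
  fix \<phi> i assume \<phi>: "\<phi> \<in> test_functions \<Omega>"
  have s: "smooth \<phi>" using \<phi> by (rule test_functionsE)
  note L = test_function_L2[OF \<phi>] test_function_L2[OF pd_test_functions[OF \<phi>], of i]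
  have "(LINT x|M. u x * pd i (\<lambda>x. h x * \<phi> x) x) = - (LINT x|M. G x $ i * (h x * \<phi> x))"
    by (rule is_weak_gradD(2)[OF assms(3) test_functions_mult[OF \<phi> assms(1)]])
  also have "(\<lambda>x. u x * pd i (\<lambda>x. h x * \<phi> x) x) = (\<lambda>x. (h x * u x) * pd i \<phi> x + (pd i h x * u x) * \<phi> x)"
    by (simp only: smooth_pd_mult[OF assms(1) s]) (simp add: algebra_simps)
  also have "(LINT x|M. (h x * u x) * pd i \<phi> x + (pd i h x * u x) * \<phi> x) =
      (LINT x|M. (h x * u x) * pd i \<phi> x) + (LINT x|M. (pd i h x * u x) * \<phi> x)"
    using L assms by (intro Bochner_Integration.integral_add L2_mult_integrable smooth_mult_L2 smooth_pd)
  finally have *: "(LINT x|M. (h x * u x) * pd i \<phi> x) =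
      - (LINT x|M. G x $ i * (h x * \<phi> x)) - (LINT x|M. (pd i h x * u x) * \<phi> x)" by (simp add: algebra_simps)
  have "(LINT x|M. (\<chi> i. h x * G x $ i + pd i h x * u x) $ i * \<phi> x) =
     (LINT x|M. (h x * G x $ i) * \<phi> x + (pd i h x * u x) * \<phi> x)"
    by (simp add: algebra_simps)
  also have "\<dots> = (LINT x|M. (h x * G x $ i) * \<phi> x) + (LINT x|M. (pd i h x * u x) * \<phi> x)"
    using L assms by (intro Bochner_Integration.integral_add L2_mult_integrable smooth_mult_L2 smooth_pd is_weak_gradD)
  finally show "(LINT x|M. h x * u x * pd i \<phi> x) = - (LINT x|M. (\<chi> i. h x * G x $ i + pd i h x * u x) $ i * \<phi> x)"
    using * by (simp add: algebra_simps)
qed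

lemma H1_mult: "smooth h \<Longrightarrow> u \<in> H1 \<Omega> \<Longrightarrow> (\<lambda>x. h x * u x) \<in> H1 \<Omega>"
  by (rule H1I[OF smooth_mult_L2 is_weak_grad_mult]) (auto intro: H1_L2 is_weak_grad_wgrad)

section \<open>Convergence in the H^1 norm\<close>

lemma H1_norm_eq:
  assumes "is_weak_grad \<Omega> u G"
  shows "H1_norm \<Omega> u = sqrt ((LINT x|M. (cmod (u x))\<^sup>2) + (LINT x|M. (norm (G x))\<^sup>2))"
proof -
  have "is_weak_grad \<Omega> u (wgrad \<Omega> u)" 
    unfolding wgrad_def using assms by (rule someI[of "is_weak_grad \<Omega> u"])
  then have "(LINT x|M. (norm (wgrad \<Omega> u x))\<^sup>2) = (LINT x|M. (norm (G x))\<^sup>2)"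
    using assms wgrad_AE[OF assms]
    by (intro integral_cong_AE) (auto simp: is_weak_grad_def L2_def elim: eventually_mono)
  then show ?thesis by (simp add: H1_norm_def)
qed

text \<open>Norm convergence is reduced to scalar square integrals, to which the Cauchy-Schwarz
  estimates apply component by component.\<close>

lemma H1_norm_tendsto_iff:
  assumes "\<And>n. u n \<in> H1 \<Omega>" "w \<in> H1 \<Omega>"
  shows "(\<lambda>n. H1_norm \<Omega> (\<lambda>x. u n x - w x)) \<longlonglongrightarrow> 0 \<longleftrightarrow>
    (\<lambda>n. LINT x|M. (cmod (u n x - w x))\<^sup>2) \<longlonglongrightarrow> 0 \<and>
    (\<forall>i. (\<lambda>n. LINT x|M. (cmod (wgrad \<Omega> (u n) x $ i - wgrad \<Omega> w x $ i))\<^sup>2) \<longlonglongrightarrow> 0)"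
proof -
  define A where "A n = (LINT x|M. (cmod (u n x - w x))\<^sup>2)" for n
  define B where "B i n = (LINT x|M. (cmod (wgrad \<Omega> (u n) x $ i - wgrad \<Omega> w x $ i))\<^sup>2)" for i n
  have nn: "A n \<ge> 0" "B i n \<ge> 0" for i n by (auto simp: A_def B_def)
  have eq: "H1_norm \<Omega> (\<lambda>x. u n x - w x) = sqrt (A n + (B 1 n + B 2 n))" for n
  proof -
    have d: "(\<lambda>x. wgrad \<Omega> (u n) x $ i - wgrad \<Omega> w x $ i) \<in> L2 M" for i
      by (intro L2_diff wgrad_L2 assms)
    have g: "is_weak_grad \<Omega> (\<lambda>x. u n x - w x) (\<lambda>x. wgrad \<Omega> (u n) x - wgrad \<Omega> w x)"
      by (intro is_weak_grad_diff H1_L2 is_weak_grad_wgrad assms)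
    show ?thesis
      unfolding H1_norm_eq[OF g] power2_norm_complex_vec A_def B_def
      using L2_integrable[OF d] by simp
  qed
  have "(\<lambda>n. sqrt (A n + (B 1 n + B 2 n))) \<longlonglongrightarrow> 0 \<longleftrightarrow> (\<lambda>n. A n + (B 1 n + B 2 n)) \<longlonglongrightarrow> 0"
  proof
    assume "(\<lambda>n. sqrt (A n + (B 1 n + B 2 n))) \<longlonglongrightarrow> 0"
    from tendsto_power[OF this, of 2] show "(\<lambda>n. A n + (B 1 n + B 2 n)) \<longlonglongrightarrow> 0" using nn by simp
  next
    assume "(\<lambda>n. A n + (B 1 n + B 2 n)) \<longlonglongrightarrow> 0"
    from tendsto_real_sqrt[OF this] show "(\<lambda>n. sqrt (A n + (B 1 n + B 2 n))) \<longlonglongrightarrow> 0" by simp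
  qed
  also have "\<dots> \<longleftrightarrow> A \<longlonglongrightarrow> 0 \<and> B 1 \<longlonglongrightarrow> 0 \<and> B 2 \<longlonglongrightarrow> 0"
  proof
    assume *: "(\<lambda>n. A n + (B 1 n + B 2 n)) \<longlonglongrightarrow> 0"
    have "f \<longlonglongrightarrow> 0" if "\<And>n. 0 \<le> f n" "\<And>n. f n \<le> A n + (B 1 n + B 2 n)" for f
      by (rule tendsto_sandwich[OF _ _ tendsto_const *]) (use that in auto)
    then show "A \<longlonglongrightarrow> 0 \<and> B 1 \<longlonglongrightarrow> 0 \<and> B 2 \<longlonglongrightarrow> 0"
      using nn by (auto simp: add_nonneg_nonneg)
  next
    assume *: "A \<longlonglongrightarrow> 0 \<and> B 1 \<longlonglongrightarrow> 0 \<and> B 2 \<longlonglongrightarrow> 0"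
    then show "(\<lambda>n. A n + (B 1 n + B 2 n)) \<longlonglongrightarrow> 0"
      using tendsto_add[of A 0 _ "\<lambda>n. B 1 n + B 2 n" 0] tendsto_add[of "B 1" 0 _ "B 2" 0] by simp
  qed
  finally have "(\<lambda>n. sqrt (A n + (B 1 n + B 2 n))) \<longlonglongrightarrow> 0 \<longleftrightarrow> A \<longlonglongrightarrow> 0 \<and> (\<forall>i. (\<lambda>n. B i n) \<longlonglongrightarrow> 0)"
    by (simp add: forall_2)
  then show ?thesis unfolding eq A_def[abs_def] B_def .
qed

end


section \<open>Orthonormal coordinates\<close>

lemma vector2_measurable: "(\<lambda>p. vector [fst p, snd p] :: real^2) \<in> borel_measurable borel"
proof -
  have "(\<lambda>p. vector [fst p, snd p] :: real^2) = (\<lambda>p. fst p *\<^sub>R axis 1 1 + snd p *\<^sub>R axis 2 1)"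
    by (simp add: fun_eq_iff vec_eq_iff forall_2 axis_def)
  moreover have "continuous_on UNIV (\<lambda>p. fst p *\<^sub>R axis 1 1 + snd p *\<^sub>R axis 2 1 :: real^2)"
    by (intro continuous_intros)
  ultimately show ?thesis by (simp add: borel_measurable_continuous_onI)
qed

text \<open>Fubini concerns pairs, whereas the plane here is \<open>real^2\<close>; the two Lebesgue
  measures are identified by comparing boxes.\<close>

lemma distr_vector2: "distr lborel borel (\<lambda>p. vector [fst p, snd p] :: real^2) = lborel"
proof (rule lborel_eqI[symmetric])
  let ?V = "\<lambda>p. vector [fst p, snd p] :: real^2"
  have m: "?V \<in> borel_measurable borel"
    by (rule vector2_measurable)
  show "sets (distr lborel borel ?V) = sets borel" by simp
  fix l u :: "real^2" assume le: "\<And>b. b \<in> Basis \<Longrightarrow> l \<bullet> b \<le> u \<bullet> b"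
  then have le': "l $ i \<le> u $ i" for i using le[of "axis i 1"] by (auto simp: Basis_vec_def inner_axis)
  have "?V -` box l u = {l $ 1<..<u $ 1} \<times> {l $ 2<..<u $ 2}"
    by (auto simp: mem_box_cart forall_2)
  then have "emeasure (distr lborel borel ?V) (box l u) = emeasure (lborel \<Otimes>\<^sub>M lborel) ({l $ 1<..<u $ 1} \<times> {l $ 2<..<u $ 2})"
    using m by (simp add: emeasure_distr lborel_prod)
  also have "\<dots> = ennreal (u $ 1 - l $ 1) * ennreal (u $ 2 - l $ 2)"
    using le' by (subst lborel.emeasure_pair_measure_Times) auto
  also have "\<dots> = (\<Prod>b\<in>Basis. (u - l) \<bullet> b)"
    using le' by (simp add: Basis_vec_def inner_axis UNIV_2 axis_eq_axis ennreal_mult[symmetric])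
  finally show "emeasure (distr lborel borel ?V) (box l u) = (\<Prod>b\<in>Basis. (u - l) \<bullet> b)" .
qed

text \<open>The preimage of a box is its image under the inverse isometry, which has the same
  Lebesgue measure.\<close>

lemma distr_orthogonal:
  fixes f :: "real^2 \<Rightarrow> real^2"
  assumes f: "orthogonal_transformation f"
  shows "distr lborel borel f = lborel"
proof (rule lborel_eqI[symmetric])
  have m: "f \<in> borel_measurable borel"
    using f by (intro borel_measurable_continuous_onI linear_continuous_on)
      (simp add: linear_conv_bounded_linear[symmetric] orthogonal_transformation_linear)
  show "sets (distr lborel borel f) = sets borel" by simp
  fix l u :: "real^2" assume le: "\<And>b. b \<in> Basis \<Longrightarrow> l \<bullet> b \<le> u \<bullet> b"
  have g: "orthogonal_transformation (inv f)" using f by (rule orthogonal_transformation_inv)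
  have eq: "f -` box l u = inv f ` box l u"
    using orthogonal_transformation_bij[OF f] by (simp add: bij_vimage_eq_inv_image)
  have "emeasure (distr lborel borel f) (box l u) = emeasure lebesgue (inv f ` box l u)"
    using m measurable_sets[OF m, of "box l u"] unfolding eq[symmetric] by (simp add: emeasure_distr)
  also have "\<dots> = emeasure lebesgue (box l u)"
    using measure_orthogonal_image[OF g, of "box l u"] measurable_orthogonal_image[OF g, of "box l u"]
    by (simp add: emeasure_eq_measure2 del: emeasure_completion)
  finally show "emeasure (distr lborel borel f) (box l u) = (\<Prod>b\<in>Basis. (u - l) \<bullet> b)"
    using le by (simp add: emeasure_lborel_box)
qed

text \<open>It serves in two main roles: at a boundary point \<open>a\<close> runs along the chart
  and \<open>b\<close> points out of the domain; at the extreme vertex \<open>a\<close> is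
  \<open>- \<omega>\<close>, pointing away from the supporting line into the depth, and
  \<open>b\<close> is \<open>\<omega>'\<close>.\<close>

locale frame =
  fixes c a b :: "real^2"
  assumes na: "norm a = 1" and nb: "norm b = 1" and ab: "a \<bullet> b = 0"
begin

definition fr :: "real \<Rightarrow> real \<Rightarrow> real^2" where
  "fr s t = c + s *\<^sub>R a + t *\<^sub>R b"

lemma inner_ab [simp]: "a \<bullet> a = 1" "b \<bullet> b = 1" "a \<bullet> b = 0" "b \<bullet> a = 0"
  using na nb ab by (auto simp: norm_eq_1 inner_commute)

lemma fr_inner [simp]: "(fr s t - c) \<bullet> a = s" "(fr s t - c) \<bullet> b = t"
  by (auto simp: fr_def inner_add_left)

lemma orthogonal_frame: "orthogonal_transformation (\<lambda>x::real^2. x $ 1 *\<^sub>R a + x $ 2 *\<^sub>R b)"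
  unfolding orthogonal_transformation_def
proof (intro conjI allI)
  show "linear (\<lambda>x::real^2. x $ 1 *\<^sub>R a + x $ 2 *\<^sub>R b)"
    by (auto intro!: linearI simp: algebra_simps)
  show "(v $ 1 *\<^sub>R a + v $ 2 *\<^sub>R b) \<bullet> (w $ 1 *\<^sub>R a + w $ 2 *\<^sub>R b) = v \<bullet> w" for v w :: "real^2"
  proof -
    have "v \<bullet> w = v $ 1 * w $ 1 + v $ 2 * w $ 2" by (simp add: inner_vec_def sum_2)
    then show ?thesis by (simp add: inner_add_left inner_add_right)
  qed
qed

lemma fr_measurable: "(\<lambda>p. fr (fst p) (snd p)) \<in> borel_measurable borel"
  unfolding fr_def by (intro borel_measurable_continuous_onI continuous_intros)

lemma distr_fr: "distr lborel borel (\<lambda>p. fr (fst p) (snd p)) = lborel"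
proof -
  let ?R = "\<lambda>x::real^2. x $ 1 *\<^sub>R a + x $ 2 *\<^sub>R b"
  let ?V = "\<lambda>p. vector [fst p, snd p] :: real^2"
  have V: "?V \<in> borel_measurable borel"
    by (rule vector2_measurable)
  have R: "?R \<in> borel_measurable borel"
    by (intro borel_measurable_continuous_onI continuous_intros)
  have "distr lborel borel (\<lambda>p. fr (fst p) (snd p)) = distr (distr (distr lborel borel ?V) borel ?R) borel ((+) c)"
    using V R by (subst distr_distr, simp, simp, subst distr_distr)
      (auto simp: fr_def o_def add.assoc intro: measurable_compose)
  then show ?thesis unfolding distr_vector2 distr_orthogonal[OF orthogonal_frame] lborel_distr_plus .
qed

lemma nn_integral_fr:
  assumes "f \<in> borel_measurable borel"
  shows "(\<integral>\<^sup>+x. f x \<partial>lborel) = (\<integral>\<^sup>+s. (\<integral>\<^sup>+t. f (fr s t) \<partial>lborel) \<partial>lborel)"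
proof -
  have "(\<integral>\<^sup>+x. f x \<partial>lborel) = (\<integral>\<^sup>+p. f (fr (fst p) (snd p)) \<partial>(lborel \<Otimes>\<^sub>M lborel))"
    using assms fr_measurable by (subst distr_fr[symmetric]) (simp add: nn_integral_distr lborel_prod)
  also have "\<dots> = (\<integral>\<^sup>+s. (\<integral>\<^sup>+t. f (fr (fst (s, t)) (snd (s, t))) \<partial>lborel) \<partial>lborel)"
    by (rule lborel.nn_integral_fst[symmetric])
       (use measurable_compose[OF fr_measurable assms] in \<open>simp add: lborel_prod\<close>)
  finally show ?thesis by simp
qed

end


section \<open>Functions in a strip below a graph\<close>

text \<open>\<open>F t\<close> differs from \<open>F g\<close> by an integral of \<open>D\<close>
  over a length at most \<open>l\<close>, so by Cauchy-Schwarz the squared difference is at most l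
  times the integral of |D|^2. Integrating over t costs another l. The weights l and l^2 are what
  the collar estimate rests on.\<close>

lemma strip_1d:
  fixes F D :: "real \<Rightarrow> complex"
  assumes F: "\<And>t. (F has_vector_derivative D t) (at t)" and D: "continuous_on UNIV D" and l: "l > 0"
  shows "(\<integral>\<^sup>+t. ennreal ((cmod (F t))\<^sup>2) * indicator {g - l<..<g} t \<partial>lborel) \<le>
    ennreal (2 * l * (cmod (F g))\<^sup>2) + ennreal (2 * l\<^sup>2) * (\<integral>\<^sup>+t. ennreal ((cmod (D t))\<^sup>2) * indicator {g - l<..<g} t \<partial>lborel)"
proof -
  \<comment> \<open>The closed interval suits the fundamental theorem of calculus; its end points
    are a null set.\<close>
  define B where "B = (LINT t|lborel. indicator {g - l..g} t *\<^sub>R (cmod (D t))\<^sup>2)"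
  have Bi: "integrable lborel (\<lambda>t. indicator {g - l..g} t *\<^sub>R (cmod (D t))\<^sup>2)"
    by (rule borel_integrable_compact) (auto intro!: continuous_intros continuous_on_subset[OF D])
  have B0: "B \<ge> 0" unfolding B_def by (rule integral_nonneg_AE) auto
  have B: "ennreal B = (\<integral>\<^sup>+t. ennreal ((cmod (D t))\<^sup>2) * indicator {g - l<..<g} t \<partial>lborel)"
  proof -
    have "ennreal B = (\<integral>\<^sup>+t. ennreal (indicator {g - l..g} t *\<^sub>R (cmod (D t))\<^sup>2) \<partial>lborel)"
      unfolding B_def using Bi by (intro nn_integral_eq_integral[symmetric]) auto
    also have "\<dots> = (\<integral>\<^sup>+t. ennreal ((cmod (D t))\<^sup>2) * indicator {g - l<..<g} t \<partial>lborel)"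
    proof (rule nn_integral_cong_AE)
      show "AE t in lborel. ennreal (indicator {g - l..g} t *\<^sub>R (cmod (D t))\<^sup>2) = ennreal ((cmod (D t))\<^sup>2) * indicator {g - l<..<g} t"
        using AE_lborel_singleton[of g] AE_lborel_singleton[of "g - l"]
        by eventually_elim (auto simp: indicator_def)
    qed
    finally show ?thesis .
  qed
  have pt: "(cmod (F t))\<^sup>2 \<le> 2 * (cmod (F g))\<^sup>2 + 2 * l * B" if t: "t \<in> {g - l<..<g}" for t
  proof -
    have "has_bochner_integral lborel (\<lambda>x. indicator {t..g} x *\<^sub>R D x) (F g - F t)"
      using t F D by (intro has_bochner_integral_FTC_Icc)
        (auto intro: has_vector_derivative_at_within continuous_on_subset)
    then have I: "(LINT x|lborel. indicator {t..g} x *\<^sub>R D x) = F g - F t" by (rule has_bochner_integral_integral_eq)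
    have i: "integrable lborel (\<lambda>x. indicator {t..g} x *\<^sub>R (cmod (D x))\<^sup>2)"
      by (rule borel_integrable_compact) (auto intro!: continuous_intros continuous_on_subset[OF D])
    have [measurable]: "D \<in> borel_measurable borel" using D by (rule borel_measurable_continuous_onI)
    have 1: "(\<lambda>x. indicator {t..g} x *\<^sub>R D x) \<in> L2 lborel"
    proof -
      have "(\<lambda>x. (cmod (indicator {t..g} x *\<^sub>R D x))\<^sup>2) = (\<lambda>x. indicator {t..g} x *\<^sub>R (cmod (D x))\<^sup>2)"
        by (auto simp: indicator_def)
      then show ?thesis using i by (simp add: L2_def)
    qed
    have 2: "(\<lambda>x. indicator {t..g} x :: complex) \<in> L2 lborel"
    proof -
      have "integrable lborel (\<lambda>x. indicator {t..g} x *\<^sub>R (1::real))"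
        by (rule borel_integrable_compact) auto
      moreover have "(\<lambda>x. (cmod (indicator {t..g} x))\<^sup>2) = (\<lambda>x. indicator {t..g} x *\<^sub>R (1::real))"
        by (auto simp: indicator_def)
      ultimately show ?thesis by (simp add: L2_def)
    qed
    have "(\<lambda>x. (indicator {t..g} x *\<^sub>R D x) * indicator {t..g} x) = (\<lambda>x. indicator {t..g} x *\<^sub>R D x)"
      by (auto simp: indicator_def)
    then have "(cmod (F g - F t))\<^sup>2 \<le> (LINT x|lborel. (cmod (indicator {t..g} x *\<^sub>R D x))\<^sup>2) * (LINT x|lborel. (cmod (indicator {t..g} x))\<^sup>2)"
      using L2_Cauchy_Schwarz[OF 1 2] I by simp
    also have "(LINT x|lborel. (cmod (indicator {t..g} x))\<^sup>2) = (LINT x|lborel. indicator {t..g} x)"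
      by (rule arg_cong[where f="integral\<^sup>L lborel"]) (auto simp: indicator_def)
    also have "\<dots> = g - t" using t by simp
    also have "(LINT x|lborel. (cmod (indicator {t..g} x *\<^sub>R D x))\<^sup>2) \<le> B"
      unfolding B_def
    proof (rule integral_mono)
      show "integrable lborel (\<lambda>x. (cmod (indicator {t..g} x *\<^sub>R D x))\<^sup>2)" using 1 by (rule L2_integrable)
    qed (use Bi t in \<open>auto simp: indicator_def\<close>)
    then have "(LINT x|lborel. (cmod (indicator {t..g} x *\<^sub>R D x))\<^sup>2) * (g - t) \<le> B * l"
      using t B0 by (intro mult_mono) auto
    finally have "(cmod (F g - F t))\<^sup>2 \<le> B * l" .
    then show ?thesis
      using power2_norm_diff_le[of "F g" "F g - F t"] by (simp add: algebra_simps)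
  qed
  have "(\<integral>\<^sup>+t. ennreal ((cmod (F t))\<^sup>2) * indicator {g - l<..<g} t \<partial>lborel) \<le>
      (\<integral>\<^sup>+t. ennreal (2 * (cmod (F g))\<^sup>2 + 2 * l * B) * indicator {g - l<..<g} t \<partial>lborel)"
    by (rule nn_integral_mono) (use pt in \<open>auto simp: indicator_def intro: ennreal_leI\<close>)
  also have "\<dots> = ennreal (2 * (cmod (F g))\<^sup>2 + 2 * l * B) * ennreal l"
    using l by (simp add: nn_integral_cmult_indicator)
  also have "\<dots> = ennreal (2 * l * (cmod (F g))\<^sup>2 + 2 * l\<^sup>2 * B)"
    using l B0 by (subst ennreal_mult[symmetric]) (auto simp: algebra_simps power2_eq_square)
  also have "\<dots> = ennreal (2 * l * (cmod (F g))\<^sup>2) + ennreal (2 * l\<^sup>2) * ennreal B"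
    using l B0 by (simp add: ennreal_plus ennreal_mult)
  finally show ?thesis unfolding B .
qed

context frame
begin

definition strip :: "(real \<Rightarrow> real) \<Rightarrow> real \<Rightarrow> real \<Rightarrow> (real^2) set" where
  "strip \<gamma> r l = {x. \<bar>(x - c) \<bullet> a\<bar> < r \<and> \<gamma> ((x - c) \<bullet> a) - l < (x - c) \<bullet> b \<and> (x - c) \<bullet> b < \<gamma> ((x - c) \<bullet> a)}"

lemma open_strip:
  assumes "continuous_on UNIV \<gamma>" shows "open (strip \<gamma> r l)"
  unfolding strip_def
  by (intro open_Collect_conj open_Collect_less continuous_intros continuous_on_compose2[OF assms]) auto

text \<open>The one-dimensional estimate holds on each line parallel to \<open>b\<close> and is
  integrated over the chart. With extended integrals no integrability has to be checked for the
  iterated integrals.\<close>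

lemma strip_nn_integral:
  assumes f: "smooth f" and \<gamma>: "continuous_on UNIV \<gamma>" and l: "l > 0"
  shows "(\<integral>\<^sup>+x. ennreal ((cmod (f x))\<^sup>2) * indicator (strip \<gamma> r l) x \<partial>lborel) \<le>
    (\<integral>\<^sup>+s. ennreal (2 * l * (cmod (f (fr s (\<gamma> s))))\<^sup>2) * indicator {-r<..<r} s \<partial>lborel) +
    ennreal (2 * l\<^sup>2) * (\<integral>\<^sup>+x. ennreal ((cmod (dird b f x))\<^sup>2) * indicator (strip \<gamma> r l) x \<partial>lborel)"
proof -
  have P[measurable]: "strip \<gamma> r l \<in> sets borel" using open_strip[OF \<gamma>] by (rule borel_open)
  have cf: "continuous_on UNIV f" using f by (rule smooth_continuous)
  have cd: "continuous_on UNIV (dird b f)"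
    unfolding dird_def using smooth_continuous[OF smooth_pd[OF f]] by (auto intro!: continuous_intros)
  have [measurable]: "f \<in> borel_measurable borel" "dird b f \<in> borel_measurable borel" "\<gamma> \<in> borel_measurable borel"
    using cf cd \<gamma> by (auto intro: borel_measurable_continuous_onI)
  have [measurable]: "(\<lambda>p. fr (fst p) (snd p)) \<in> borel_measurable (lborel \<Otimes>\<^sub>M lborel)"
    using fr_measurable by (simp add: lborel_prod)
  have ind: "indicator (strip \<gamma> r l) (fr s t) = (indicator {-r<..<r} s * indicator {\<gamma> s - l<..<\<gamma> s} t :: ennreal)" for s t
    by (auto simp: strip_def indicator_def)
  define h where "h s = (\<integral>\<^sup>+t. ennreal ((cmod (dird b f (fr s t)))\<^sup>2) * indicator (strip \<gamma> r l) (fr s t) \<partial>lborel)" for s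
  have hm[measurable]: "h \<in> borel_measurable lborel"
  proof -
    have "(\<lambda>p. ennreal ((cmod (dird b f (fr (fst p) (snd p))))\<^sup>2) * indicator (strip \<gamma> r l) (fr (fst p) (snd p)))
        \<in> borel_measurable (lborel \<Otimes>\<^sub>M lborel)" by measurable
    from lborel.borel_measurable_nn_integral_fst[OF this] show ?thesis by (simp add: h_def[abs_def])
  qed
  have cfr: "continuous_on UNIV (\<lambda>s. f (fr s (\<gamma> s)))"
    unfolding fr_def using \<gamma> by (auto intro!: continuous_on_compose2[OF cf] continuous_intros)
  have [measurable]: "(\<lambda>s. f (fr s (\<gamma> s))) \<in> borel_measurable borel" using cfr by (rule borel_measurable_continuous_onI)
  have "(\<integral>\<^sup>+x. ennreal ((cmod (f x))\<^sup>2) * indicator (strip \<gamma> r l) x \<partial>lborel) =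
      (\<integral>\<^sup>+s. (\<integral>\<^sup>+t. ennreal ((cmod (f (fr s t)))\<^sup>2) * indicator (strip \<gamma> r l) (fr s t) \<partial>lborel) \<partial>lborel)"
    by (rule nn_integral_fr) measurable
  also have "\<dots> \<le> (\<integral>\<^sup>+s. ennreal (2 * l * (cmod (f (fr s (\<gamma> s))))\<^sup>2) * indicator {-r<..<r} s + ennreal (2 * l\<^sup>2) * h s \<partial>lborel)"
  proof (rule nn_integral_mono)
    fix s
    show "(\<integral>\<^sup>+t. ennreal ((cmod (f (fr s t)))\<^sup>2) * indicator (strip \<gamma> r l) (fr s t) \<partial>lborel) \<le>
        ennreal (2 * l * (cmod (f (fr s (\<gamma> s))))\<^sup>2) * indicator {-r<..<r} s + ennreal (2 * l\<^sup>2) * h s"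
    proof (cases "s \<in> {-r<..<r}")
      case True
      have "((\<lambda>t. f (fr s t)) has_vector_derivative dird b f (fr s t)) (at t)" for t
        unfolding fr_def by (rule has_vector_derivative_line[OF f])
      moreover have "continuous_on UNIV (\<lambda>t. dird b f (fr s t))"
        unfolding fr_def by (auto intro!: continuous_on_compose2[OF cd] continuous_intros)
      ultimately show ?thesis
        using strip_1d[of "\<lambda>t. f (fr s t)" "\<lambda>t. dird b f (fr s t)" l "\<gamma> s"] l True by (simp add: ind h_def)
    qed (simp add: ind h_def)
  qed
  also have "\<dots> = (\<integral>\<^sup>+s. ennreal (2 * l * (cmod (f (fr s (\<gamma> s))))\<^sup>2) * indicator {-r<..<r} s \<partial>lborel) +
      ennreal (2 * l\<^sup>2) * (\<integral>\<^sup>+s. h s \<partial>lborel)"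
    by (simp add: nn_integral_add nn_integral_cmult)
  also have "(\<integral>\<^sup>+s. h s \<partial>lborel) = (\<integral>\<^sup>+x. ennreal ((cmod (dird b f x))\<^sup>2) * indicator (strip \<gamma> r l) x \<partial>lborel)"
    unfolding h_def by (rule nn_integral_fr[symmetric]) measurable
  finally show ?thesis .
qed

end


section \<open>Cut-off functions of a bounded open set\<close>

text \<open>In each term of the Leibniz rule the undifferentiated factors lie in [0, 1], so only the
  factors that vary at \<open>x\<close> count, however many there are in all.\<close>

lemma norm_pd_prod_le:
  fixes g :: "'i \<Rightarrow> real^2 \<Rightarrow> real"
  assumes "finite I" "\<And>j. j \<in> I \<Longrightarrow> smooth (\<lambda>x. complex_of_real (g j x))"
    and "\<And>j. j \<in> I \<Longrightarrow> 0 \<le> g j x" "\<And>j. j \<in> I \<Longrightarrow> g j x \<le> 1"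
    and "\<And>j. j \<in> I \<Longrightarrow> cmod (pd i (\<lambda>x. complex_of_real (g j x)) x) \<le> d j"
  shows "cmod (pd i (\<lambda>x. \<Prod>j\<in>I. complex_of_real (g j x)) x) \<le> (\<Sum>j\<in>I. d j)"
  using assms
proof (induction I rule: finite_induct)
  case (insert k I)
  let ?P = "\<lambda>x. \<Prod>j\<in>I. complex_of_real (g j x)"
  have P: "smooth ?P" using insert by (intro smooth_prod) auto
  have "pd i (\<lambda>x. \<Prod>j\<in>insert k I. complex_of_real (g j x)) x = pd i (\<lambda>x. complex_of_real (g k x) * ?P x) x"
    using insert by simp
  also have "\<dots> = complex_of_real (g k x) * pd i ?P x + pd i (\<lambda>x. complex_of_real (g k x)) x * ?P x"
    using insert P by (intro smooth_pd_mult) auto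
  finally have eq: "pd i (\<lambda>x. \<Prod>j\<in>insert k I. complex_of_real (g j x)) x =
    complex_of_real (g k x) * pd i ?P x + pd i (\<lambda>x. complex_of_real (g k x)) x * ?P x" .
  have "cmod (?P x) \<le> 1"
    using insert.prems(2,3) by (auto simp: prod_norm[symmetric] intro!: prod_le_1)
  moreover have "cmod (complex_of_real (g k x)) \<le> 1" using insert.prems(2,3)[of k] by simp
  moreover have "cmod (pd i ?P x) \<le> sum d I" using insert by auto
  moreover have "cmod (pd i (\<lambda>x. complex_of_real (g k x)) x) \<le> d k" using insert by auto
  ultimately have "cmod (complex_of_real (g k x)) * cmod (pd i ?P x) \<le> 1 * sum d I"
    "cmod (pd i (\<lambda>x. complex_of_real (g k x)) x) * cmod (?P x) \<le> d k * 1"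
    using norm_ge_zero[of "pd i ?P x"] norm_ge_zero[of "pd i (\<lambda>x. complex_of_real (g k x)) x"]
    by (intro mult_mono; linarith?; simp)+
  then show ?case
    unfolding eq using insert(1,2) norm_triangle_ineq[of "complex_of_real (g k x) * pd i ?P x" "pd i (\<lambda>x. complex_of_real (g k x)) x * ?P x"]
    by (simp add: norm_mult)
qed simp

lemma bump_pd_bounded:
  obtains C where "C > 0" "\<And>i x. cmod (pd i (\<lambda>x. complex_of_real (bump x)) x) \<le> C"
    "\<And>i x. norm x > 2 \<Longrightarrow> pd i (\<lambda>x. complex_of_real (bump x)) x = 0"
proof -
  let ?b = "\<lambda>x. complex_of_real (bump x)"
  have 0: "pd i ?b x = 0" if "norm x > 2" for i x
  proof -
    have "open {x :: real^2. norm x > 2}" by (intro open_Collect_less continuous_intros)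
    then show ?thesis
      using pd_cong_open[of "{x. norm x > 2}" x ?b "\<lambda>_. 0" i] that by (auto simp: bump_eq_0)
  qed
  obtain C1 where C1: "C1 > 0" "\<And>x. x \<in> cball 0 2 \<Longrightarrow> cmod (pd 1 ?b x) \<le> C1"
    using smooth_bounded[OF smooth_pd[OF smooth_bump] bounded_cball] by metis
  obtain C2 where C2: "C2 > 0" "\<And>x. x \<in> cball 0 2 \<Longrightarrow> cmod (pd 2 ?b x) \<le> C2"
    using smooth_bounded[OF smooth_pd[OF smooth_bump] bounded_cball] by metis
  have "cmod (pd i ?b x) \<le> max C1 C2" for i x
  proof (cases "norm x > 2")
    case False
    then show ?thesis using C1(2)[of x] C2(2)[of x] exhaust_2[of i] by auto
  qed (use 0 C1 in auto)
  with 0 C1(1) show thesis by (intro that[of "max C1 C2"]) auto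
qed

text \<open>A closed interval of length 4 contains at most five integers. This makes the gradient
  bound of the cut-off uniform in the mesh and in the domain.\<close>

lemma lattice_count:
  fixes p q :: real and I :: "(int \<times> int) set"
  assumes "\<And>j. j \<in> I \<Longrightarrow> \<bar>p - of_int (fst j)\<bar> \<le> 2 \<and> \<bar>q - of_int (snd j)\<bar> \<le> 2"
  shows "card I \<le> 25"
proof -
  have c: "card {\<lceil>p - 2\<rceil>..\<lfloor>p + 2\<rfloor>} \<le> 5" for p :: real
  proof -
    have "\<lfloor>p + 2\<rfloor> - \<lceil>p - 2\<rceil> \<le> 4" by linarith
    then show ?thesis unfolding card_atLeastAtMost_int by linarith
  qed
  have "I \<subseteq> {\<lceil>p - 2\<rceil>..\<lfloor>p + 2\<rfloor>} \<times> {\<lceil>q - 2\<rceil>..\<lfloor>q + 2\<rfloor>}"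
  proof
    fix j assume "j \<in> I"
    with assms[OF this] show "j \<in> {\<lceil>p - 2\<rceil>..\<lfloor>p + 2\<rfloor>} \<times> {\<lceil>q - 2\<rceil>..\<lfloor>q + 2\<rfloor>}"
      unfolding mem_Times_iff atLeastAtMost_iff ceiling_le_iff le_floor_iff by linarith
  qed
  then have "card I \<le> card {\<lceil>p - 2\<rceil>..\<lfloor>p + 2\<rfloor>} * card {\<lceil>q - 2\<rceil>..\<lfloor>q + 2\<rfloor>}"
    by (metis card_cartesian_product card_mono finite_SigmaI finite_atLeastAtMost_int)
  also have "\<dots> \<le> 5 * 5" by (rule mult_mono[OF c c]) auto
  finally show ?thesis by simp
qed

text \<open>The cut-off is a product of factors \<open>1 - bump\<close> over the points of a lattice of mesh \<open>\<delta>\<close> close to the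
  complement of \<open>\<Omega>\<close>; at most 25 of them are not locally constant at a given point.\<close>

lemma boundary_cutoff:
  obtains C where "C > 0"
    "\<And>\<Omega> \<delta>. open \<Omega> \<Longrightarrow> bounded \<Omega> \<Longrightarrow> \<delta> > 0 \<Longrightarrow>
      \<exists>\<kappa>. (\<lambda>x. complex_of_real (\<kappa> x)) \<in> test_functions \<Omega> \<and> (\<forall>x. 0 \<le> \<kappa> x \<and> \<kappa> x \<le> 1) \<and>
        (\<forall>i. \<forall>x\<in>\<Omega>. cmod (pd i (\<lambda>x. complex_of_real (\<kappa> x)) x) \<le> C / \<delta>) \<and>
        (\<forall>x\<in>\<Omega>. (\<forall>y. y \<notin> \<Omega> \<longrightarrow> dist x y \<ge> 4 * \<delta>) \<longrightarrow>
            \<kappa> x = 1 \<and> (\<forall>i. pd i (\<lambda>x. complex_of_real (\<kappa> x)) x = 0))"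
proof -
  obtain C where C: "C > 0" "\<And>i x. cmod (pd i (\<lambda>x. complex_of_real (bump x)) x) \<le> C"
    "\<And>i x. norm x > 2 \<Longrightarrow> pd i (\<lambda>x. complex_of_real (bump x)) x = 0" using bump_pd_bounded by metis
  show thesis
  proof (rule that[of "25 * C"])
    show "25 * C > 0" using C by simp
    fix \<Omega> :: "(real^2) set" and \<delta> :: real
    assume \<Omega>: "open \<Omega>" "bounded \<Omega>" and \<delta>: "\<delta> > 0"
    obtain R where R: "R > 0" "closure \<Omega> \<subseteq> ball 0 R"
      using bounded_subset_ballD[of "closure \<Omega>" 0] \<Omega>(2) by (auto simp: bounded_closure)
    obtain \<psi> V where \<psi>: "(\<lambda>x. complex_of_real (\<psi> x)) \<in> test_functions (ball 0 R)" "\<And>x. 0 \<le> \<psi> x" "\<And>x. \<psi> x \<le> 1"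
      "open V" "closure \<Omega> \<subseteq> V" "\<And>x. x \<in> V \<Longrightarrow> \<psi> x = 1"
      using compact_cutoff[of "closure \<Omega>" "ball 0 R"] R \<Omega>(2) by (auto simp: compact_closure)
    \<comment> \<open>Rounding moves an index by at most 1/2, so \<open>N\<close> bounds every index
      to which a point of \<open>ball 0 R\<close> rounds.\<close>
    define N where "N = \<lceil>R / \<delta>\<rceil> + 1"
    define z :: "int \<times> int \<Rightarrow> real^2" where "z j = vector [\<delta> * of_int (fst j), \<delta> * of_int (snd j)]" for j
    have z12 [simp]: "z j $ 1 = \<delta> * of_int (fst j)" "z j $ 2 = \<delta> * of_int (snd j)" for j by (simp_all add: z_def)
    define I where "I = {j \<in> {-N..N} \<times> {-N..N}. \<exists>y. y \<notin> \<Omega> \<and> dist (z j) y < \<delta>}"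
    have fin: "finite I" by (simp add: I_def)
    define g where "g j x = 1 - bump ((1 / \<delta>) *\<^sub>R (x - z j))" for j x
    \<comment> \<open>The finite product is 1 far away; \<open>\<psi>\<close> makes the support
      compact, and as it is 1 near the closure of \<open>\<Omega>\<close> it does not affect
      derivatives inside.\<close>
    define \<kappa> where "\<kappa> x = (\<Prod>j\<in>I. g j x) * \<psi> x" for x
    have gs: "smooth (\<lambda>x. complex_of_real (g j x))" for j
      unfolding g_def of_real_diff of_real_1 by (intro smooth_diff smooth_const smooth_affine[OF smooth_bump])
    have g01: "0 \<le> g j x" "g j x \<le> 1" for j x by (auto simp: g_def bump_bounds)
    have gpd: "pd i (\<lambda>x. complex_of_real (g j x)) x = - (of_real (1 / \<delta>) * pd i (\<lambda>x. complex_of_real (bump x)) ((1 / \<delta>) *\<^sub>R (x - z j)))" for i j x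
    proof -
      have "pd i (\<lambda>x. complex_of_real (g j x)) x = pd i (\<lambda>x. 1 - complex_of_real (bump ((1 / \<delta>) *\<^sub>R (x - z j)))) x"
        by (simp add: g_def)
      also have "\<dots> = pd i (\<lambda>x. 1) x - pd i (\<lambda>x. complex_of_real (bump ((1 / \<delta>) *\<^sub>R (x - z j)))) x"
        by (rule smooth_pd_diff[OF smooth_const smooth_affine[OF smooth_bump]])
      also have "pd i (\<lambda>x. complex_of_real (bump ((1 / \<delta>) *\<^sub>R (x - z j)))) x = of_real (1 / \<delta>) * pd i (\<lambda>x. complex_of_real (bump x)) ((1 / \<delta>) *\<^sub>R (x - z j))"
        by (rule pd_affine[OF smooth_differentiable[OF smooth_bump]])
      finally show ?thesis by simp
    qed
    have far: "g j x = 1" "pd i (\<lambda>x. complex_of_real (g j x)) x = 0" if "dist (z j) x > 2 * \<delta>" for i j x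
    proof -
      have "norm ((1 / \<delta>) *\<^sub>R (x - z j)) > 2" using that \<delta> by (simp only: norm_rescale) (simp add: less_divide_eq)
      then show "g j x = 1" "pd i (\<lambda>x. complex_of_real (g j x)) x = 0"
        unfolding gpd by (simp_all only: C(3) g_def bump_eq_0[OF less_imp_le]) auto
    qed
    have \<kappa>s: "smooth (\<lambda>x. complex_of_real (\<kappa> x))"
      unfolding \<kappa>_def of_real_mult of_real_prod
      using \<psi>(1) by (auto intro!: smooth_mult smooth_prod gs elim: test_functionsE)
    \<comment> \<open>The nearest lattice point is within \<delta> / sqrt 2, hence within
      3\<delta>/4, of \<open>x\<close>. The remaining \<delta>/4 brings it within \<delta> of
      \<open>y\<close>, so its index lies in \<open>I\<close> and its factor is 0 at
      \<open>x\<close>.\<close>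
    have cut: "\<kappa> x = 0" if x: "x \<in> ball 0 R" and y: "y \<notin> \<Omega>" "dist x y < \<delta> / 4" for x y
    proof -
      define j where "j = (round (x $ 1 / \<delta>), round (x $ 2 / \<delta>))"
      have rd: "\<bar>x $ i - \<delta> * of_int (round (x $ i / \<delta>))\<bar> \<le> \<delta> / 2" for i
      proof -
        have "\<bar>of_int (round (x $ i / \<delta>)) - x $ i / \<delta>\<bar> \<le> 1 / 2" by (rule of_int_round_abs_le)
        then have "\<delta> * \<bar>of_int (round (x $ i / \<delta>)) - x $ i / \<delta>\<bar> \<le> \<delta> * (1 / 2)"
          using \<delta> by (intro mult_left_mono) auto
        moreover have "\<delta> * \<bar>of_int (round (x $ i / \<delta>)) - x $ i / \<delta>\<bar> = \<bar>x $ i - \<delta> * of_int (round (x $ i / \<delta>))\<bar>"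
          using \<delta> by (subst abs_of_pos[OF \<delta>, symmetric], subst abs_mult[symmetric]) (simp add: right_diff_distrib abs_minus_commute)
        ultimately show ?thesis by simp
      qed
      have "(dist x (z j))\<^sup>2 = (x $ 1 - z j $ 1)\<^sup>2 + (x $ 2 - z j $ 2)\<^sup>2"
        unfolding dist_norm power2_norm_eq_inner by (simp add: inner_vec_def sum_2 power2_eq_square)
      also have "\<dots> \<le> (\<delta> / 2)\<^sup>2 + (\<delta> / 2)\<^sup>2"
        using rd[of 1] rd[of 2] by (intro add_mono) (auto simp: j_def abs_le_square_iff[symmetric])
      also have "\<dots> \<le> (3 / 4 * \<delta>)\<^sup>2" by (simp add: power2_eq_square)
      finally have xz: "dist x (z j) \<le> 3 / 4 * \<delta>" by (rule power2_le_imp_le) (use \<delta> in simp)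
      have "dist (z j) y < \<delta>" using dist_triangle3[of "z j" y x] xz y(2) \<delta> by linarith
      moreover have "\<bar>x $ i / \<delta>\<bar> \<le> R / \<delta>" for i
        using x component_le_norm_cart[of x i] \<delta> by (simp add: divide_right_mono)
      then have "- N \<le> round (x $ i / \<delta>) \<and> round (x $ i / \<delta>) \<le> N" for i
      proof -
        assume "\<And>i. \<bar>x $ i / \<delta>\<bar> \<le> R / \<delta>"
        then have "\<bar>x $ i / \<delta>\<bar> \<le> R / \<delta>" .
        moreover have "\<bar>of_int (round (x $ i / \<delta>)) - x $ i / \<delta>\<bar> \<le> 1 / 2" by (rule of_int_round_abs_le)
        moreover have "R / \<delta> + 1 \<le> of_int N" unfolding N_def by simp
        ultimately have "real_of_int (- N) \<le> of_int (round (x $ i / \<delta>)) \<and> real_of_int (round (x $ i / \<delta>)) \<le> of_int N"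
          unfolding of_int_minus by linarith
        then show ?thesis unfolding of_int_le_iff .
      qed
      then have "j \<in> {-N..N} \<times> {-N..N}" by (simp add: j_def)
      ultimately have "j \<in> I" using y by (auto simp: I_def)
      moreover have "dist (z j) x < \<delta>" using xz \<delta> by (simp add: dist_commute)
      then have "g j x = 0" unfolding g_def by (simp only: bump_ball_eq_1)
      ultimately show ?thesis using fin by (auto simp: \<kappa>_def prod_zero_iff)
    qed
    have T: "(\<lambda>x. complex_of_real (\<kappa> x)) \<in> test_functions \<Omega>"
    proof (rule test_functionsI[OF \<kappa>s])
      let ?K = "cball 0 R \<inter> (\<Inter>y\<in>-\<Omega>. {x. \<delta> / 4 \<le> dist x y})"
      show "compact ?K" by (intro compact_Int_closed compact_cball closed_INT ballI closed_Collect_le continuous_intros)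
      show "?K \<subseteq> \<Omega>" using \<delta> by force
      fix x assume x: "x \<notin> ?K"
      show "complex_of_real (\<kappa> x) = 0"
      proof (cases "x \<in> ball 0 R")
        case True
        then obtain y where "y \<notin> \<Omega>" "dist x y < \<delta> / 4" using x by (auto simp: not_le)
        then show ?thesis using cut True by auto
      next
        case False
        then have "\<psi> x = 0" using \<psi>(1) by (elim test_functionsE) (metis of_real_eq_0_iff subsetD)
        then show ?thesis by (simp add: \<kappa>_def)
      qed
    qed
    have \<kappa>01: "0 \<le> \<kappa> x \<and> \<kappa> x \<le> 1" for x
    proof -
      have "0 \<le> (\<Prod>j\<in>I. g j x)" "(\<Prod>j\<in>I. g j x) \<le> 1" using g01 by (auto intro: prod_nonneg prod_le_1)
      then show ?thesis using \<psi>(2,3)[of x] by (auto simp: \<kappa>_def mult_le_one)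
    qed
    have pd\<kappa>: "pd i (\<lambda>x. complex_of_real (\<kappa> x)) x = pd i (\<lambda>x. \<Prod>j\<in>I. complex_of_real (g j x)) x" if "x \<in> \<Omega>" for i x
      using that \<psi>(4,5,6) closure_subset by (intro pd_cong_open[of V]) (auto simp: \<kappa>_def)
    have bound: "cmod (pd i (\<lambda>x. complex_of_real (\<kappa> x)) x) \<le> 25 * C / \<delta>" if x: "x \<in> \<Omega>" for i x
    proof -
      define J where "J = {j \<in> I. dist (z j) x \<le> 2 * \<delta>}"
      have "cmod (pd i (\<lambda>x. \<Prod>j\<in>I. complex_of_real (g j x)) x) \<le> (\<Sum>j\<in>I. if dist (z j) x \<le> 2 * \<delta> then C / \<delta> else 0)"
      proof (rule norm_pd_prod_le[OF fin gs g01])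
        fix j
        show "cmod (pd i (\<lambda>x. complex_of_real (g j x)) x) \<le> (if dist (z j) x \<le> 2 * \<delta> then C / \<delta> else 0)"
        proof (cases "dist (z j) x \<le> 2 * \<delta>")
          case True
          then show ?thesis using \<delta> C(2)[of i "(1 / \<delta>) *\<^sub>R (x - z j)"] unfolding gpd norm_minus_cancel norm_mult norm_of_real
            by (simp add: divide_right_mono del: scaleR_right_diff_distrib)
        qed (simp add: far)
      qed
      also have "\<dots> = of_nat (card J) * (C / \<delta>)" using fin by (simp add: J_def sum.If_cases Int_def)
      also have "card J \<le> 25"
      proof (rule lattice_count[of _ "x $ 1 / \<delta>" "x $ 2 / \<delta>"])
        fix j assume "j \<in> J"
        then have "\<bar>(z j - x) $ i\<bar> \<le> 2 * \<delta>" for i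
          using component_le_norm_cart[of "z j - x" i] by (auto simp: J_def dist_norm)
        from this[of 1] this[of 2] show "\<bar>x $ 1 / \<delta> - of_int (fst j)\<bar> \<le> 2 \<and> \<bar>x $ 2 / \<delta> - of_int (snd j)\<bar> \<le> 2"
          using \<delta> by (auto simp: abs_le_iff field_simps)
      qed
      then have "of_nat (card J) * (C / \<delta>) \<le> 25 * (C / \<delta>)" using C(1) \<delta> by (intro mult_right_mono) auto
      finally show ?thesis unfolding pd\<kappa>[OF x] by simp
    qed
    have one: "\<kappa> x = 1 \<and> (\<forall>i. pd i (\<lambda>x. complex_of_real (\<kappa> x)) x = 0)"
      if x: "x \<in> \<Omega>" and d: "\<forall>y. y \<notin> \<Omega> \<longrightarrow> dist x y \<ge> 4 * \<delta>" for x
    proof -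
      \<comment> \<open>Distance 4\<delta> from the complement leaves more than 3\<delta> to every
        lattice point of \<open>I\<close>, beyond the radius 2\<delta> in which its factor
        varies.\<close>
      have fz: "dist (z j) x > 2 * \<delta>" if jI: "j \<in> I" for j
      proof -
        obtain y where y: "y \<notin> \<Omega>" "dist (z j) y < \<delta>" using jI by (auto simp: I_def)
        then show ?thesis using d dist_triangle[of x y "z j"] \<delta> by (auto simp: dist_commute)
      qed
      have "cmod (pd i (\<lambda>x. \<Prod>j\<in>I. complex_of_real (g j x)) x) \<le> (\<Sum>j\<in>I. 0)" for i
        by (rule norm_pd_prod_le[OF fin gs g01]) (simp add: far fz)
      then have "pd i (\<lambda>x. complex_of_real (\<kappa> x)) x = 0" for i by (simp only: pd\<kappa>[OF x]) simp
      moreover have "\<psi> x = 1" using x \<psi>(5,6) closure_subset by blast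
      then have "\<kappa> x = 1" by (simp add: \<kappa>_def far fz)
      ultimately show ?thesis by simp
    qed
    show "\<exists>\<kappa>. (\<lambda>x. complex_of_real (\<kappa> x)) \<in> test_functions \<Omega> \<and> (\<forall>x. 0 \<le> \<kappa> x \<and> \<kappa> x \<le> 1) \<and>
        (\<forall>i. \<forall>x\<in>\<Omega>. cmod (pd i (\<lambda>x. complex_of_real (\<kappa> x)) x) \<le> 25 * C / \<delta>) \<and>
        (\<forall>x\<in>\<Omega>. (\<forall>y. y \<notin> \<Omega> \<longrightarrow> dist x y \<ge> 4 * \<delta>) \<longrightarrow>
            \<kappa> x = 1 \<and> (\<forall>i. pd i (\<lambda>x. complex_of_real (\<kappa> x)) x = 0))"
      using T \<kappa>01 bound one by (intro exI[of _ \<kappa>]) blast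
  qed
qed


section \<open>Functions with vanishing trace\<close>

lemma (in frame) fr_decomp: "y = fr ((y - c) \<bullet> a) ((y - c) \<bullet> b)"
proof -
  obtain v :: "real^2" where v: "y - c = v $ 1 *\<^sub>R a + v $ 2 *\<^sub>R b"
    using surjD[OF orthogonal_transformation_surj[OF orthogonal_frame], of "y - c"] by blast
  then have "(y - c) \<bullet> a = v $ 1" "(y - c) \<bullet> b = v $ 2" by (simp_all add: inner_add_left)
  then show ?thesis using v by (simp add: fr_def algebra_simps)
qed

context bounded_open
begin

section \<open>Integrals over collars of the boundary\<close>

definition collar :: "real \<Rightarrow> (real^2) set" where
  "collar \<epsilon> = {x \<in> \<Omega>. \<exists>y. y \<notin> \<Omega> \<and> dist x y < \<epsilon>}"

lemma open_collar: "open (collar \<epsilon>)"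
proof -
  have "collar \<epsilon> = \<Omega> \<inter> (\<Union>y\<in>-\<Omega>. ball y \<epsilon>)" by (auto simp: collar_def dist_commute)
  then show ?thesis using opn by auto
qed

lemma sets_M_open: "open S \<Longrightarrow> S \<subseteq> \<Omega> \<Longrightarrow> S \<in> sets M"
  using opn by (auto simp: sets_restrict_space borel_open intro!: image_eqI[of _ _ S])

lemma collar_sets: "collar \<epsilon> \<in> sets M"
  by (rule sets_M_open[OF open_collar]) (auto simp: collar_def)

lemma integrable_indicator_mult:
  fixes g :: "real^2 \<Rightarrow> real"
  shows "integrable M g \<Longrightarrow> S \<in> sets M \<Longrightarrow> integrable M (\<lambda>x. indicator S x * g x)"
  using integrable_mult_indicator[of S M g] by simp

text \<open>A point of the open set leaves the collar once the width is below its distance to the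
  complement, so the indicators tend to 0 pointwise.\<close>

lemma collar_integral_tendsto:
  fixes g :: "real^2 \<Rightarrow> real"
  assumes g: "integrable M g" and e: "\<epsilon> \<longlonglongrightarrow> 0"
  shows "(\<lambda>m. LINT x|M. indicator (collar (\<epsilon> m)) x * g x) \<longlonglongrightarrow> 0"
proof -
  have "(\<lambda>m. LINT x|M. indicator (collar (\<epsilon> m)) x * g x) \<longlonglongrightarrow> (LINT x|M. 0)"
  proof (rule integral_dominated_convergence[where w="\<lambda>x. \<bar>g x\<bar>"])
    show "integrable M (\<lambda>x. \<bar>g x\<bar>)" using g by (rule integrable_abs)
    show "(\<lambda>x. indicator (collar (\<epsilon> m)) x * g x) \<in> borel_measurable M" for m
      using integrable_indicator_mult[OF g collar_sets] by (rule borel_measurable_integrable)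
    show "AE x in M. norm (indicator (collar (\<epsilon> m)) x * g x) \<le> \<bar>g x\<bar>" for m
      by (auto simp: indicator_def)
    show "AE x in M. (\<lambda>m. indicator (collar (\<epsilon> m)) x * g x) \<longlonglongrightarrow> 0"
    proof (rule AE_I2)
      fix x assume "x \<in> space M"
      then have "x \<in> \<Omega>" by simp
      then obtain d where d: "d > 0" "ball x d \<subseteq> \<Omega>" using opn by (meson open_contains_ball)
      from order_tendstoD(2)[OF e d(1)]
      have "\<forall>\<^sub>F m in sequentially. indicator (collar (\<epsilon> m)) x * g x = 0"
        by eventually_elim (use d in \<open>auto simp: collar_def indicator_def subset_iff\<close>)
      then show "(\<lambda>m. indicator (collar (\<epsilon> m)) x * g x) \<longlonglongrightarrow> 0" by (rule tendsto_eventually)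
    qed
  qed auto
  then show ?thesis by simp
qed

lemma continuous_integrable:
  fixes g :: "real^2 \<Rightarrow> real"
  assumes "continuous_on UNIV g"
  shows "integrable M g"
proof -
  have "bounded (g ` closure \<Omega>)"
    using assms bdd by (intro compact_imp_bounded compact_continuous_image continuous_on_subset[OF assms])
      (auto simp: compact_closure)
  then obtain C where "\<forall>y\<in>g ` closure \<Omega>. norm y \<le> C" unfolding bounded_iff by blast
  moreover have "g \<in> borel_measurable M"
    using assms by (intro measurable_restrict_space1 measurable_completion) (simp add: borel_measurable_continuous_onI)
  ultimately show ?thesis
    using closure_subset[of \<Omega>] by (intro finite_measure.integrable_const_bound[OF finite_M, of _ C]) (auto intro!: AE_I2)
qed

text \<open>Bridge from the extended integrals of the strip estimate to real integrals over the
  domain.\<close>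

lemma nn_integral_M:
  fixes g :: "real^2 \<Rightarrow> real"
  assumes g: "continuous_on UNIV g" "\<And>x. 0 \<le> g x" and S: "open S" "S \<subseteq> \<Omega>"
  shows "(\<integral>\<^sup>+x. ennreal (g x) * indicator S x \<partial>lborel) = ennreal (LINT x|M. indicator S x * g x)"
proof -
  have i: "integrable M (\<lambda>x. indicator S x * g x)"
    by (rule integrable_indicator_mult[OF continuous_integrable[OF g(1)] sets_M_open[OF S]])
  have [measurable]: "g \<in> borel_measurable borel" "S \<in> sets borel"
    using g S by (auto intro: borel_measurable_continuous_onI borel_open)
  have "ennreal (LINT x|M. indicator S x * g x) = (\<integral>\<^sup>+x. ennreal (indicator S x * g x) \<partial>M)"
    using i g by (intro nn_integral_eq_integral[symmetric]) auto
  also have "\<dots> = (\<integral>\<^sup>+x. ennreal (indicator S x * g x) * indicator \<Omega> x \<partial>lebesgue)"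
    by (rule nn_integral_restrict_space[OF space_Int])
  also have "\<dots> = (\<integral>\<^sup>+x. ennreal (g x) * indicator S x \<partial>lebesgue)"
    using S by (intro nn_integral_cong) (auto simp: indicator_def)
  also have "\<dots> = (\<integral>\<^sup>+x. ennreal (g x) * indicator S x \<partial>lborel)"
    by (rule nn_integral_completion)
  finally show ?thesis by simp
qed

lemma power2_norm_dird_le:
  assumes "norm b = 1"
  shows "(cmod (dird b f x))\<^sup>2 \<le> 2 * ((cmod (pd 1 f x))\<^sup>2 + (cmod (pd 2 f x))\<^sup>2)"
proof -
  have le: "(cmod (of_real (b $ i) * pd i f x))\<^sup>2 \<le> (cmod (pd i f x))\<^sup>2" for i
    using component_le_norm_cart[of b i] assms
    by (intro power_mono) (auto simp: norm_mult intro!: mult_left_le_one_le)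
  show ?thesis
    unfolding dird_def
    by (rule order_trans[OF power2_norm_add_le]) (unfold distrib_left, intro add_mono mult_left_mono le; simp)
qed

text \<open>In the chart the collar sits inside a strip below the graph, of thickness proportional
  to \<delta>, and that strip sits inside a wider collar; between the two inclusions the strip
  estimate applies. The constants precede \<delta> and \<open>f\<close>, since both vary
  later.\<close>

lemma boundary_patch:
  assumes x: "x \<in> frontier \<Omega>" and chart: "lipschitz_chart \<Omega> x a b r h \<gamma>"
  obtains Q \<epsilon> K where "open Q" "x \<in> Q" "\<epsilon> > 0" "K > 0"
    "\<And>\<delta> f. 0 < \<delta> \<Longrightarrow> \<delta> < \<epsilon> \<Longrightarrow> smooth f \<Longrightarrow>
       (\<lambda>s. f (x + s *\<^sub>R a + \<gamma> s *\<^sub>R b)) \<in> L2 (lebesgue_on {-r<..<r}) \<Longrightarrow>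
       (LINT y|M. indicator (Q \<inter> collar (4 * \<delta>)) y * (cmod (f y))\<^sup>2) \<le>
         K * \<delta> * (LINT s|lebesgue_on {-r<..<r}. (cmod (f (x + s *\<^sub>R a + \<gamma> s *\<^sub>R b)))\<^sup>2) +
         K * \<delta>\<^sup>2 * (LINT y|M. indicator (collar (K * \<delta>)) y * ((cmod (pd 1 f y))\<^sup>2 + (cmod (pd 2 f y))\<^sup>2))"
proof -
  from chart obtain L where nab: "norm a = 1" "norm b = 1" "a \<bullet> b = 0" and rh: "r > 0" "h > 0"
    and L: "L-lipschitz_on UNIV \<gamma>" and \<gamma>h: "\<And>s. \<bar>s\<bar> < r \<Longrightarrow> \<bar>\<gamma> s\<bar> < h"
    and ch: "\<And>s t. \<bar>s\<bar> < r \<Longrightarrow> \<bar>t\<bar> < h \<Longrightarrow> x + s *\<^sub>R a + t *\<^sub>R b \<in> \<Omega> \<longleftrightarrow> t < \<gamma> s"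
    unfolding lipschitz_chart_def by blast
  interpret frame x a b using nab by unfold_locales
  have L0: "L \<ge> 0" using L by (rule lipschitz_on_nonneg)
  have Ld: "\<bar>\<gamma> s - \<gamma> s'\<bar> \<le> L * \<bar>s - s'\<bar>" for s s' using lipschitz_onD[OF L, of s s'] by (simp add: dist_real_def)
  have c\<gamma>: "continuous_on UNIV \<gamma>" by (rule lipschitz_on_continuous_on[OF L])
  have ch': "fr s t \<in> \<Omega> \<longleftrightarrow> t < \<gamma> s" if "\<bar>s\<bar> < r" "\<bar>t\<bar> < h" for s t
    using ch[OF that] by (simp add: fr_def)
  note decomp = fr_decomp
  \<comment> \<open>A chart does not say that its centre is on the graph. The centre lies outside
    the open set \<open>\<Omega>\<close>, so \<gamma> 0 \<le> 0; a negative value would give it a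
    neighbourhood outside \<Omega>.\<close>
  have \<gamma>0: "\<gamma> 0 = 0"
  proof -
    have "x \<notin> \<Omega>" using x opn by (simp add: frontier_def interior_open)
    then have le: "\<gamma> 0 \<le> 0" using ch'[of 0 0] rh by (simp add: fr_def)
    have "\<not> \<gamma> 0 < 0"
    proof
      assume neg: "\<gamma> 0 < 0"
      define W where "W = {y. \<bar>(y - x) \<bullet> a\<bar> < r \<and> \<bar>(y - x) \<bullet> b\<bar> < h \<and> \<gamma> ((y - x) \<bullet> a) < (y - x) \<bullet> b}"
      have "open W" unfolding W_def
        by (intro open_Collect_conj open_Collect_less continuous_intros continuous_on_compose2[OF c\<gamma>]) auto
      moreover have "x \<in> W" using neg rh by (simp add: W_def)
      moreover have "W \<inter> \<Omega> = {}"
      proof -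
        have "y \<notin> \<Omega>" if "y \<in> W" for y
          using that ch'[of "(y - x) \<bullet> a" "(y - x) \<bullet> b"] decomp[of y] by (auto simp: W_def)
        then show ?thesis by auto
      qed
      ultimately have "x \<notin> closure \<Omega>" using open_Int_closure_eq_empty by blast
      then show False using x by (simp add: frontier_def)
    qed
    with le show ?thesis by simp
  qed
  \<comment> \<open>A smaller rectangle, on which the Lipschitz bound keeps |\<gamma>| below h/2;
    moves by 4\<delta> or \<open>\<Lambda> * \<delta>\<close> then stay inside the chart.\<close>
  define \<rho> where "\<rho> = min (r / 2) (h / (2 * (L + 1)))"
  have \<rho>: "\<rho> > 0" "\<rho> \<le> r / 2" using rh L0 unfolding \<rho>_def by (simp, intro min.cobounded1)
  have L\<rho>: "L * \<rho> \<le> h / 2"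
  proof -
    have "L * \<rho> \<le> (L + 1) * (h / (2 * (L + 1)))" using \<rho> L0 by (intro mult_mono) (auto simp: \<rho>_def)
    also have "(L + 1) * (h / (2 * (L + 1))) = h / 2" using L0 by (simp add: divide_simps)
    finally show ?thesis .
  qed
  have \<gamma>half: "\<bar>\<gamma> s\<bar> \<le> h / 2" if "\<bar>s\<bar> < \<rho>" for s
  proof -
    have "\<bar>\<gamma> s\<bar> \<le> L * \<bar>s\<bar>" using Ld[of s 0] \<gamma>0 by simp
    also have "\<dots> \<le> L * \<rho>" using that L0 by (intro mult_left_mono) auto
    finally show ?thesis using L\<rho> by simp
  qed
  \<comment> \<open>A move by less than 4\<delta> changes the height by less than 4\<delta> and the
    graph by at most 4 L \<delta>.\<close>
  define \<Lambda> where "\<Lambda> = 4 * (L + 1)"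
  have \<Lambda>: "\<Lambda> \<ge> 4" using L0 by (simp add: \<Lambda>_def)
  \<comment> \<open>\<open>2 * \<Lambda>\<^sup>2\<close> comes from the strip estimate and another 2
    from bounding the directional derivative by the partial ones.\<close>
  define K where "K = 4 * \<Lambda>\<^sup>2"
  have K: "K > 0" "2 * \<Lambda> \<le> K" "\<Lambda> \<le> K" "4 * \<Lambda>\<^sup>2 \<le> K"
    using \<Lambda> mult_mono[of 4 \<Lambda> 4 \<Lambda>] mult_right_mono[of 4 \<Lambda> \<Lambda>] by (auto simp: K_def power2_eq_square)
  define Q where "Q = {y. \<bar>(y - x) \<bullet> a\<bar> < \<rho> \<and> \<bar>(y - x) \<bullet> b\<bar> < h / 2}"
  define \<epsilon> where "\<epsilon> = min (r / 8) (h / (2 * \<Lambda>))"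
  have \<epsilon>: "\<epsilon> > 0" using rh \<Lambda> by (simp add: \<epsilon>_def)
  have small: "4 * \<delta> \<le> r / 2" "4 * \<delta> \<le> h / 2" "\<Lambda> * \<delta> \<le> h / 2" if "0 < \<delta>" "\<delta> < \<epsilon>" for \<delta>
  proof -
    show "4 * \<delta> \<le> r / 2" using that by (simp add: \<epsilon>_def)
    have "\<Lambda> * \<delta> \<le> \<Lambda> * (h / (2 * \<Lambda>))" using that \<Lambda> by (intro mult_left_mono) (auto simp: \<epsilon>_def)
    then show "\<Lambda> * \<delta> \<le> h / 2" using \<Lambda> by simp
    moreover have "4 * \<delta> \<le> \<Lambda> * \<delta>" using that \<Lambda> by (intro mult_right_mono) auto
    ultimately show "4 * \<delta> \<le> h / 2" by simp
  qed
  have incl1: "Q \<inter> collar (4 * \<delta>) \<subseteq> strip \<gamma> \<rho> (\<Lambda> * \<delta>)" if \<delta>: "0 < \<delta>" "\<delta> < \<epsilon>" for \<delta>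
  proof
    fix y assume y: "y \<in> Q \<inter> collar (4 * \<delta>)"
    then obtain y' where y': "y' \<notin> \<Omega>" "dist y y' < 4 * \<delta>" and y\<Omega>: "y \<in> \<Omega>" by (auto simp: collar_def)
    define s t s' t' where "s = (y - x) \<bullet> a" and "t = (y - x) \<bullet> b" and "s' = (y' - x) \<bullet> a" and "t' = (y' - x) \<bullet> b"
    have st: "\<bar>s\<bar> < \<rho>" "\<bar>t\<bar> < h / 2" using y by (auto simp: Q_def s_def t_def)
    have "\<bar>s - s'\<bar> \<le> norm (y - y')" "\<bar>t - t'\<bar> \<le> norm (y - y')"
      using Cauchy_Schwarz_ineq2[of "y - y'" a] Cauchy_Schwarz_ineq2[of "y - y'" b]
      by (simp_all add: na nb s_def s'_def t_def t'_def inner_diff_left)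
    then have d: "\<bar>s - s'\<bar> < 4 * \<delta>" "\<bar>t - t'\<bar> < 4 * \<delta>" using y'(2) unfolding dist_norm by linarith+
    have "\<bar>s'\<bar> < r" "\<bar>t'\<bar> < h" "\<bar>s\<bar> < r" "\<bar>t\<bar> < h" using st d small[OF \<delta>] \<rho>(2) by linarith+
    then have 1: "t < \<gamma> s" "\<gamma> s' \<le> t'"
      using ch'[of s t] ch'[of s' t'] y\<Omega> y'(1) decomp[of y] decomp[of y'] by (auto simp: s_def t_def s'_def t'_def)
    have "\<gamma> s - \<gamma> s' \<le> L * (4 * \<delta>)"
      using Ld[of s s'] mult_left_mono[OF less_imp_le[OF d(1)] L0] by linarith
    then have "\<gamma> s - \<Lambda> * \<delta> < t" using 1 d by (simp add: \<Lambda>_def algebra_simps)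
    then show "y \<in> strip \<gamma> \<rho> (\<Lambda> * \<delta>)" using st 1 by (auto simp: strip_def s_def t_def)
  qed
  have incl2: "strip \<gamma> \<rho> (\<Lambda> * \<delta>) \<subseteq> collar (K * \<delta>)" if \<delta>: "0 < \<delta>" "\<delta> < \<epsilon>" for \<delta>
  proof
    fix y assume y: "y \<in> strip \<gamma> \<rho> (\<Lambda> * \<delta>)"
    define s t where "s = (y - x) \<bullet> a" and "t = (y - x) \<bullet> b"
    have st: "\<bar>s\<bar> < \<rho>" "\<gamma> s - \<Lambda> * \<delta> < t" "t < \<gamma> s" using y by (auto simp: strip_def s_def t_def)
    have yst: "y = fr s t" using decomp[of y] by (simp add: s_def t_def)
    have sr: "\<bar>s\<bar> < r" using st(1) \<rho> by linarith
    have "\<bar>t\<bar> < h" using st \<gamma>half[OF st(1)] small(3)[OF \<delta>] \<gamma>h[OF sr] by linarith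
    then have "y \<in> \<Omega>" using ch'[OF sr] st yst by simp
    moreover have "fr s (\<gamma> s) \<notin> \<Omega>" using ch'[OF sr \<gamma>h[OF sr]] by simp
    moreover have "dist y (fr s (\<gamma> s)) < K * \<delta>"
    proof -
      have "y - fr s (\<gamma> s) = (t - \<gamma> s) *\<^sub>R b" by (simp add: yst fr_def algebra_simps)
      then have "dist y (fr s (\<gamma> s)) = \<gamma> s - t" using st nb by (simp add: dist_norm)
      also have "\<dots> < \<Lambda> * \<delta>" using st by simp
      also have "\<dots> \<le> K * \<delta>" using K \<delta> by (intro mult_right_mono) auto
      finally show ?thesis .
    qed
    ultimately show "y \<in> collar (K * \<delta>)" by (auto simp: collar_def)
  qed
  show thesis
  proof (rule that[of Q \<epsilon> K])
    show "open Q" unfolding Q_def by (intro open_Collect_conj open_Collect_less continuous_intros)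
    show "x \<in> Q" using \<rho> rh by (simp add: Q_def)
    show "\<epsilon> > 0" "K > 0" using \<epsilon> K by auto
    fix \<delta> f assume \<delta>: "0 < \<delta>" "\<delta> < \<epsilon>" and f: "smooth f"
      and fL: "(\<lambda>s. f (x + s *\<^sub>R a + \<gamma> s *\<^sub>R b)) \<in> L2 (lebesgue_on {-r<..<r})"
    let ?B = "LINT s|lebesgue_on {-r<..<r}. (cmod (f (x + s *\<^sub>R a + \<gamma> s *\<^sub>R b)))\<^sup>2"
    let ?N = "\<lambda>y. (cmod (pd 1 f y))\<^sup>2 + (cmod (pd 2 f y))\<^sup>2"
    let ?G = "LINT y|M. indicator (collar (K * \<delta>)) y * ?N y"
    have cf: "continuous_on UNIV (\<lambda>y. (cmod (f y))\<^sup>2)" "continuous_on UNIV ?N"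
      using smooth_continuous[OF f] smooth_continuous[OF smooth_pd[OF f]] by (auto intro!: continuous_intros)
    have oQ: "open (Q \<inter> collar (4 * \<delta>))" using \<open>open Q\<close> open_collar by auto
    have nnB: "?B \<ge> 0" and nnG: "?G \<ge> 0" by (auto intro!: integral_nonneg_AE AE_I2)
    have "ennreal (LINT y|M. indicator (Q \<inter> collar (4 * \<delta>)) y * (cmod (f y))\<^sup>2) =
        (\<integral>\<^sup>+y. ennreal ((cmod (f y))\<^sup>2) * indicator (Q \<inter> collar (4 * \<delta>)) y \<partial>lborel)"
      by (rule nn_integral_M[symmetric]) (use cf oQ in \<open>auto simp: collar_def\<close>)
    also have "\<dots> \<le> (\<integral>\<^sup>+y. ennreal ((cmod (f y))\<^sup>2) * indicator (strip \<gamma> \<rho> (\<Lambda> * \<delta>)) y \<partial>lborel)"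
      using incl1[OF \<delta>] by (intro nn_integral_mono mult_left_mono) (auto simp: indicator_def)
    also have "\<dots> \<le> (\<integral>\<^sup>+s. ennreal (2 * (\<Lambda> * \<delta>) * (cmod (f (fr s (\<gamma> s))))\<^sup>2) * indicator {-\<rho><..<\<rho>} s \<partial>lborel) +
        ennreal (2 * (\<Lambda> * \<delta>)\<^sup>2) * (\<integral>\<^sup>+y. ennreal ((cmod (dird b f y))\<^sup>2) * indicator (strip \<gamma> \<rho> (\<Lambda> * \<delta>)) y \<partial>lborel)"
      by (rule strip_nn_integral[OF f c\<gamma>]) (use \<delta> \<Lambda> in auto)
    also have "(\<integral>\<^sup>+s. ennreal (2 * (\<Lambda> * \<delta>) * (cmod (f (fr s (\<gamma> s))))\<^sup>2) * indicator {-\<rho><..<\<rho>} s \<partial>lborel) \<le> ennreal (K * \<delta> * ?B)"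
    proof -
      have Ir: "{-r<..<r} \<inter> space lebesgue \<in> sets lebesgue" by simp
      have mf: "(\<lambda>s. f (fr s (\<gamma> s))) \<in> borel_measurable borel"
      proof (rule borel_measurable_continuous_onI)
        have "continuous_on UNIV (\<lambda>s. fr s (\<gamma> s))"
          unfolding fr_def using c\<gamma> by (intro continuous_intros)
        then show "continuous_on UNIV (\<lambda>s. f (fr s (\<gamma> s)))"
          by (rule continuous_on_compose2[OF smooth_continuous[OF f]]) simp
      qed
      have "(\<integral>\<^sup>+s. ennreal (2 * (\<Lambda> * \<delta>) * (cmod (f (fr s (\<gamma> s))))\<^sup>2) * indicator {-\<rho><..<\<rho>} s \<partial>lborel) \<le>
         (\<integral>\<^sup>+s. ennreal (K * \<delta> * (cmod (f (fr s (\<gamma> s))))\<^sup>2) * indicator {-r<..<r} s \<partial>lborel)"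
      proof (rule nn_integral_mono)
        fix s
        have "2 * (\<Lambda> * \<delta>) \<le> K * \<delta>" using mult_right_mono[OF K(2), of \<delta>] \<delta> by simp
        then have "ennreal (2 * (\<Lambda> * \<delta>) * (cmod (f (fr s (\<gamma> s))))\<^sup>2) \<le> ennreal (K * \<delta> * (cmod (f (fr s (\<gamma> s))))\<^sup>2)"
          by (intro ennreal_leI mult_right_mono) auto
        then show "ennreal (2 * (\<Lambda> * \<delta>) * (cmod (f (fr s (\<gamma> s))))\<^sup>2) * indicator {-\<rho><..<\<rho>} s \<le>
            ennreal (K * \<delta> * (cmod (f (fr s (\<gamma> s))))\<^sup>2) * indicator {-r<..<r} s"
          using \<rho> rh by (auto simp: indicator_def)
      qed
      also have "\<dots> = (\<integral>\<^sup>+s. ennreal (K * \<delta> * (cmod (f (fr s (\<gamma> s))))\<^sup>2) * indicator {-r<..<r} s \<partial>lebesgue)"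
        by (rule nn_integral_completion[symmetric])
      also have "\<dots> = (\<integral>\<^sup>+s. ennreal (K * \<delta> * (cmod (f (fr s (\<gamma> s))))\<^sup>2) \<partial>lebesgue_on {-r<..<r})"
        by (rule nn_integral_restrict_space[OF Ir, symmetric])
      also have "\<dots> = ennreal (LINT s|lebesgue_on {-r<..<r}. K * \<delta> * (cmod (f (fr s (\<gamma> s))))\<^sup>2)"
        using L2_integrable[OF fL] K \<delta> by (intro nn_integral_eq_integral) (auto simp: fr_def)
      finally show ?thesis by (simp add: fr_def)
    qed
    also have "ennreal (2 * (\<Lambda> * \<delta>)\<^sup>2) * (\<integral>\<^sup>+y. ennreal ((cmod (dird b f y))\<^sup>2) * indicator (strip \<gamma> \<rho> (\<Lambda> * \<delta>)) y \<partial>lborel)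
        \<le> ennreal (K * \<delta>\<^sup>2 * ?G)"
    proof -
      have "(\<integral>\<^sup>+y. ennreal ((cmod (dird b f y))\<^sup>2) * indicator (strip \<gamma> \<rho> (\<Lambda> * \<delta>)) y \<partial>lborel) \<le>
          (\<integral>\<^sup>+y. ennreal (2 * ?N y) * indicator (collar (K * \<delta>)) y \<partial>lborel)"
        using incl2[OF \<delta>] power2_norm_dird_le[OF nb, of f]
        by (intro nn_integral_mono mult_mono ennreal_leI) (auto simp: indicator_def)
      also have "\<dots> = ennreal (LINT y|M. indicator (collar (K * \<delta>)) y * (2 * ?N y))"
      proof (rule nn_integral_M)
        show "continuous_on UNIV (\<lambda>y. 2 * ?N y)" using cf(2) by (rule continuous_on_mult_left)
        show "collar (K * \<delta>) \<subseteq> \<Omega>" by (auto simp: collar_def)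
      qed (auto intro: open_collar)
      also have "(LINT y|M. indicator (collar (K * \<delta>)) y * (2 * ?N y)) = 2 * ?G"
        unfolding integral_mult_right_zero[symmetric] by (rule arg_cong[where f="integral\<^sup>L M"]) (simp add: fun_eq_iff)
      finally have "ennreal (2 * (\<Lambda> * \<delta>)\<^sup>2) * (\<integral>\<^sup>+y. ennreal ((cmod (dird b f y))\<^sup>2) * indicator (strip \<gamma> \<rho> (\<Lambda> * \<delta>)) y \<partial>lborel)
          \<le> ennreal (2 * (\<Lambda> * \<delta>)\<^sup>2) * ennreal (2 * ?G)" by (rule mult_left_mono) simp
      also have "\<dots> = ennreal (2 * (\<Lambda> * \<delta>)\<^sup>2 * (2 * ?G))" using nnG by (subst ennreal_mult) auto
      also have "2 * (\<Lambda> * \<delta>)\<^sup>2 * (2 * ?G) = K * \<delta>\<^sup>2 * ?G" by (simp add: K_def power_mult_distrib)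
      finally show ?thesis .
    qed
    finally have "ennreal (LINT y|M. indicator (Q \<inter> collar (4 * \<delta>)) y * (cmod (f y))\<^sup>2) \<le> ennreal (K * \<delta> * ?B) + ennreal (K * \<delta>\<^sup>2 * ?G)"
      by (auto intro: add_mono)
    also have "\<dots> = ennreal (K * \<delta> * ?B + K * \<delta>\<^sup>2 * ?G)"
      using K \<delta> nnB nnG by (intro ennreal_plus[symmetric]) auto
    finally show "(LINT y|M. indicator (Q \<inter> collar (4 * \<delta>)) y * (cmod (f y))\<^sup>2) \<le> K * \<delta> * ?B + K * \<delta>\<^sup>2 * ?G"
      using K \<delta> nnB nnG by (subst (asm) ennreal_le_iff) auto
  qed
qed

section \<open>Vanishing trace and approximation by test functions\<close>

lemma H1_norm_tendsto_smooth_iff: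
  assumes "\<And>n. smooth (u n)" "w \<in> H1 \<Omega>"
  shows "(\<lambda>n. H1_norm \<Omega> (\<lambda>x. u n x - w x)) \<longlonglongrightarrow> 0 \<longleftrightarrow>
    (\<lambda>n. LINT x|M. (cmod (u n x - w x))\<^sup>2) \<longlonglongrightarrow> 0 \<and>
    (\<forall>i. (\<lambda>n. LINT x|M. (cmod (pd i (u n) x - wgrad \<Omega> w x $ i))\<^sup>2) \<longlonglongrightarrow> 0)"
proof -
  have "(LINT x|M. (cmod (wgrad \<Omega> (u n) x $ i - wgrad \<Omega> w x $ i))\<^sup>2) = (LINT x|M. (cmod (pd i (u n) x - wgrad \<Omega> w x $ i))\<^sup>2)" for n i
  proof (rule integral_cong_AE)
    show "(\<lambda>x. (cmod (wgrad \<Omega> (u n) x $ i - wgrad \<Omega> w x $ i))\<^sup>2) \<in> borel_measurable M"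
      using L2_integrable[OF L2_diff[OF wgrad_L2[OF smooth_H1[OF assms(1)]] wgrad_L2[OF assms(2)]]] by (rule borel_measurable_integrable)
    show "(\<lambda>x. (cmod (pd i (u n) x - wgrad \<Omega> w x $ i))\<^sup>2) \<in> borel_measurable M"
      using L2_integrable[OF L2_diff[OF smooth_L2[OF smooth_pd[OF assms(1)]] wgrad_L2[OF assms(2)]]] by (rule borel_measurable_integrable)
    show "AE x in M. (cmod (wgrad \<Omega> (u n) x $ i - wgrad \<Omega> w x $ i))\<^sup>2 = (cmod (pd i (u n) x - wgrad \<Omega> w x $ i))\<^sup>2"
      using wgrad_smooth[OF assms(1)[of n]] by eventually_elim simp
  qed
  then show ?thesis using H1_norm_tendsto_iff[OF smooth_H1[OF assms(1)] assms(2)] by simp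
qed

lemma collar_meets_frontier:
  assumes "y \<in> collar \<epsilon>"
  obtains z where "z \<in> frontier \<Omega>" "dist y z < \<epsilon>"
proof -
  obtain y' where y': "y \<in> \<Omega>" "y' \<notin> \<Omega>" "dist y y' < \<epsilon>" using assms by (auto simp: collar_def)
  have "closed_segment y y' \<inter> frontier \<Omega> \<noteq> {}"
    using y' by (intro connected_Int_frontier) auto
  then obtain z where z: "z \<in> closed_segment y y'" "z \<in> frontier \<Omega>" by auto
  then have "dist y z \<le> dist y y'" using dist_in_closed_segment(1)[of z y y'] by (simp add: dist_commute)
  with y' z that show thesis by auto
qed

text \<open>The sequence converging in \<open>H\<^sup>1\<close> is cut off in a collar of width \<open>\<delta>\<close>. The gradient of the cut-off is of
  size \<open>1/\<delta>\<close>, but the square integral of the functions over the collar is of size \<open>\<delta>\<close> times that of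
  their boundary values plus \<open>o(\<delta>\<^sup>2)\<close>.\<close>

lemma trace_zero_imp_H10:
  assumes lip: "lipschitz_boundary \<Omega>" and w: "w \<in> H1 \<Omega>" and f: "\<And>n. smooth (f n)"
    and lim: "(\<lambda>n. H1_norm \<Omega> (\<lambda>x. f n x - w x)) \<longlonglongrightarrow> 0"
    and tr: "L2_boundary_tendsto \<Omega> f (\<lambda>_. 0)"
  shows "w \<in> H10 \<Omega>"
proof -
  define W where "W i x = wgrad \<Omega> w x $ i" for i x
  \<comment> \<open>The chart data are packed into one tuple, so that a single choice over the
    frontier points provides all of them.\<close>
  define B where "B c n = (case c of (x, a, b, r, h, \<gamma>) \<Rightarrow>
      LINT s|lebesgue_on {-r<..<r::real}. (cmod (f n (x + s *\<^sub>R a + \<gamma> s *\<^sub>R b)))\<^sup>2)" for c :: "(real^2) \<times> (real^2) \<times> (real^2) \<times> real \<times> real \<times> (real \<Rightarrow> real)" and n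
  have wL: "w \<in> L2 M" "W i \<in> L2 M" for i using w by (auto simp: W_def[abs_def] H1_L2 wgrad_L2)
  have fl: "(\<lambda>n. LINT x|M. (cmod (f n x - w x))\<^sup>2) \<longlonglongrightarrow> 0"
    "(\<lambda>n. LINT x|M. (cmod (pd i (f n) x - W i x))\<^sup>2) \<longlonglongrightarrow> 0" for i
    using lim H1_norm_tendsto_smooth_iff[OF f w] by (auto simp: W_def)
  define P where "P x Q \<epsilon> K c \<longleftrightarrow> open Q \<and> x \<in> Q \<and> \<epsilon> > 0 \<and> K > 0 \<and> B c \<longlonglongrightarrow> 0 \<and>
    (\<forall>\<delta> n. 0 < \<delta> \<longrightarrow> \<delta> < \<epsilon> \<longrightarrow>
       (LINT y|M. indicator (Q \<inter> collar (4 * \<delta>)) y * (cmod (f n y))\<^sup>2) \<le> K * \<delta> * B c n +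
         K * \<delta>\<^sup>2 * (LINT y|M. indicator (collar (K * \<delta>)) y * ((cmod (pd 1 (f n) y))\<^sup>2 + (cmod (pd 2 (f n) y))\<^sup>2)))"
    for x Q \<epsilon> K c
  have "\<exists>Q \<epsilon> K c. P x Q \<epsilon> K c" if x: "x \<in> frontier \<Omega>" for x
  proof -
    obtain a b r h \<gamma> where chart: "lipschitz_chart \<Omega> x a b r h \<gamma>"
      using lip x unfolding lipschitz_boundary_def by blast
    have t: "\<And>n. (\<lambda>s. f n (x + s *\<^sub>R a + \<gamma> s *\<^sub>R b)) \<in> L2 (lebesgue_on {-r<..<r})" "B (x, a, b, r, h, \<gamma>) \<longlonglongrightarrow> 0"
      using tr chart unfolding L2_boundary_tendsto_def B_def[abs_def] by (simp_all add: Let_def)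
    show ?thesis
    proof (rule boundary_patch[OF x chart])
      fix Q \<epsilon> K
      assume "open Q" "x \<in> Q" "\<epsilon> > 0" "K > 0"
        and "\<And>\<delta> f. 0 < \<delta> \<Longrightarrow> \<delta> < \<epsilon> \<Longrightarrow> smooth f \<Longrightarrow>
          (\<lambda>s. f (x + s *\<^sub>R a + \<gamma> s *\<^sub>R b)) \<in> L2 (lebesgue_on {-r<..<r}) \<Longrightarrow>
          (LINT y|M. indicator (Q \<inter> collar (4 * \<delta>)) y * (cmod (f y))\<^sup>2) \<le>
          K * \<delta> * (LINT s|lebesgue_on {-r<..<r}. (cmod (f (x + s *\<^sub>R a + \<gamma> s *\<^sub>R b)))\<^sup>2) +
          K * \<delta>\<^sup>2 * (LINT y|M. indicator (collar (K * \<delta>)) y * ((cmod (pd 1 f y))\<^sup>2 + (cmod (pd 2 f y))\<^sup>2))"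
      from this(1-4) this(5)[OF _ _ f t(1)] t(2) show ?thesis
        by (intro exI[of _ Q] exI[of _ \<epsilon>] exI[of _ K] exI[of _ "(x, a, b, r, h, \<gamma>)"]) (simp add: P_def B_def)
    qed
  qed
  then obtain Q \<epsilon> K c where QP: "\<And>x. x \<in> frontier \<Omega> \<Longrightarrow> P x (Q x) (\<epsilon> x) (K x) (c x)" by metis
  have patch: "open (Q x)" "x \<in> Q x" "\<epsilon> x > 0" "K x > 0" "B (c x) \<longlonglongrightarrow> 0" if "x \<in> frontier \<Omega>" for x
    using QP[OF that] by (simp_all add: P_def)
  have patchI: "(LINT y|M. indicator (Q x \<inter> collar (4 * \<delta>)) y * (cmod (f n y))\<^sup>2) \<le> K x * \<delta> * B (c x) n +
         K x * \<delta>\<^sup>2 * (LINT y|M. indicator (collar (K x * \<delta>)) y * ((cmod (pd 1 (f n) y))\<^sup>2 + (cmod (pd 2 (f n) y))\<^sup>2))"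
    if "x \<in> frontier \<Omega>" "0 < \<delta>" "\<delta> < \<epsilon> x" for x \<delta> n
    using QP[OF that(1)] that(2,3) by (simp add: P_def)
  have cfr: "compact (frontier \<Omega>)" using bdd by (rule compact_frontier_bounded)
  obtain T where T: "T \<subseteq> frontier \<Omega>" "finite T" "frontier \<Omega> \<subseteq> (\<Union>x\<in>T. Q x)"
    using compactE_image[OF cfr, of "frontier \<Omega>" Q] patch(1,2) by blast
  have oV: "open (\<Union>x\<in>T. Q x)" using T(1) patch(1) by blast
  obtain e where e: "e > 0" "(\<Union>x\<in>frontier \<Omega>. cball x e) \<subseteq> (\<Union>x\<in>T. Q x)"
    using compact_subset_open_imp_cball_epsilon_subset[OF cfr oV T(3)] by metis
  define d0 where "d0 = Min (insert (e / 4) (\<epsilon> ` T))"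
  have d0: "d0 > 0" "d0 \<le> e / 4" "\<And>x. x \<in> T \<Longrightarrow> d0 \<le> \<epsilon> x"
  proof -
    show "d0 > 0" using T patch(3) e(1) by (auto simp: d0_def Min_gr_iff subset_iff)
    show "d0 \<le> e / 4" unfolding d0_def by (rule Min_le) (use T in auto)
    show "d0 \<le> \<epsilon> x" if "x \<in> T" for x unfolding d0_def by (rule Min_le) (use T that in auto)
  qed
  \<comment> \<open>The shift by 2 keeps every width strictly below \<open>d0\<close>, hence
    strictly below each \<open>\<epsilon> x\<close>.\<close>
  define d where "d m = d0 / real (m + 2)" for m
  have d: "0 < d m" "d m < d0" for m using d0(1) by (auto simp: d_def field_simps add_pos_nonneg)
  have dlim: "d \<longlonglongrightarrow> 0" unfolding d_def by (rule tendsto_divide_0[OF tendsto_const filterlim_at_top_imp_at_infinity]) (intro filterlim_compose[OF filterlim_real_sequentially filterlim_add_const_nat_at_top])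
  have cov: "collar (4 * d m) \<subseteq> (\<Union>x\<in>T. Q x)" for m
  proof
    fix y assume "y \<in> collar (4 * d m)"
    then obtain z where z: "z \<in> frontier \<Omega>" "dist y z < 4 * d m" by (rule collar_meets_frontier)
    then have "y \<in> cball z e" using d(2)[of m] d0(2) by (simp add: dist_commute)
    then show "y \<in> (\<Union>x\<in>T. Q x)" using e(2) z(1) by blast
  qed
  \<comment> \<open>The approximant is chosen after the width: boundary integrals below the square
    of \<open>d m\<close>, with weight \<open>d m\<close>, survive the division by that square which
    the gradient of the cut-off brings.\<close>
  have "\<exists>n. (\<forall>x\<in>T. B (c x) n < (d m)\<^sup>2) \<and> (LINT x|M. (cmod (f n x - w x))\<^sup>2) < d m \<and>
      (\<forall>i. (LINT x|M. (cmod (pd i (f n) x - W i x))\<^sup>2) < d m)" for m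
  proof -
    have "\<forall>\<^sub>F n in sequentially. B (c x) n < (d m)\<^sup>2" if "x \<in> T" for x
      using T(1) that d(1)[of m] by (intro order_tendstoD(2)[OF patch(5)]) auto
    then have 1: "\<forall>\<^sub>F n in sequentially. \<forall>x\<in>T. B (c x) n < (d m)\<^sup>2"
      using T(2) by (simp add: eventually_ball_finite)
    have 2: "\<forall>\<^sub>F n in sequentially. (LINT x|M. (cmod (pd i (f n) x - W i x))\<^sup>2) < d m" for i
      by (rule order_tendstoD(2)[OF fl(2) d(1)])
    have 3: "\<forall>\<^sub>F n in sequentially. (LINT x|M. (cmod (f n x - w x))\<^sup>2) < d m"
      by (rule order_tendstoD(2)[OF fl(1) d(1)])
    have "\<forall>\<^sub>F n in sequentially. (\<forall>x\<in>T. B (c x) n < (d m)\<^sup>2) \<and> (LINT x|M. (cmod (f n x - w x))\<^sup>2) < d m \<and>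
      (\<forall>i. (LINT x|M. (cmod (pd i (f n) x - W i x))\<^sup>2) < d m)"
      using 1 2[of 1] 2[of 2] 3 by eventually_elim (simp add: forall_2)
    then show ?thesis by (rule eventually_happens'[OF sequentially_bot])
  qed
  then have "\<exists>N. \<forall>m. (\<forall>x\<in>T. B (c x) (N m) < (d m)\<^sup>2) \<and> (LINT x|M. (cmod (f (N m) x - w x))\<^sup>2) < d m \<and>
      (\<forall>i. (LINT x|M. (cmod (pd i (f (N m)) x - W i x))\<^sup>2) < d m)" by (intro choice allI)
  then obtain N where N: "\<And>m x. x \<in> T \<Longrightarrow> B (c x) (N m) < (d m)\<^sup>2"
    "\<And>m. (LINT x|M. (cmod (f (N m) x - w x))\<^sup>2) < d m"
    "\<And>m i. (LINT x|M. (cmod (pd i (f (N m)) x - W i x))\<^sup>2) < d m" by blast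
  define g where "g m = f (N m)" for m
  have g: "smooth (g m)" for m by (simp add: g_def f)
  define R where "R C \<delta> \<kappa> \<longleftrightarrow> (\<lambda>x. complex_of_real (\<kappa> x)) \<in> test_functions \<Omega> \<and> (\<forall>x. 0 \<le> \<kappa> x \<and> \<kappa> x \<le> 1) \<and>
        (\<forall>i. \<forall>x\<in>\<Omega>. cmod (pd i (\<lambda>x. complex_of_real (\<kappa> x)) x) \<le> C / \<delta>) \<and>
        (\<forall>x\<in>\<Omega>. (\<forall>y. y \<notin> \<Omega> \<longrightarrow> dist x y \<ge> 4 * \<delta>) \<longrightarrow>
            \<kappa> x = 1 \<and> (\<forall>i. pd i (\<lambda>x. complex_of_real (\<kappa> x)) x = 0))" for C \<delta> and \<kappa> :: "real^2 \<Rightarrow> real"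
  have "\<exists>C>0. \<forall>\<delta>>0. \<exists>\<kappa>. R C \<delta> \<kappa>"
    by (rule boundary_cutoff) (unfold R_def, use opn bdd in blast)
  then obtain C where C: "C > 0" "\<And>\<delta>. \<delta> > 0 \<Longrightarrow> \<exists>\<kappa>. R C \<delta> \<kappa>" by blast
  then have "\<And>m. \<exists>\<kappa>. R C (d m) \<kappa>" using d(1) by blast
  then obtain \<kappa> where R: "\<And>m. R C (d m) (\<kappa> m)" by metis
  have \<kappa>: "(\<lambda>x. complex_of_real (\<kappa> m x)) \<in> test_functions \<Omega>"
    "0 \<le> \<kappa> m x" "\<kappa> m x \<le> 1"
    "x \<in> \<Omega> \<Longrightarrow> cmod (pd i (\<lambda>x. complex_of_real (\<kappa> m x)) x) \<le> C / d m"
    "x \<in> \<Omega> \<Longrightarrow> \<forall>y. y \<notin> \<Omega> \<longrightarrow> dist x y \<ge> 4 * d m \<Longrightarrow>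
        \<kappa> m x = 1 \<and> (\<forall>i. pd i (\<lambda>x. complex_of_real (\<kappa> m x)) x = 0)" for m x i
    using R[of m] by (simp_all add: R_def)
  have out: "\<kappa> m x = 1" "pd i (\<lambda>x. complex_of_real (\<kappa> m x)) x = 0" if "x \<in> \<Omega>" "x \<notin> collar (4 * d m)" for m x i
    using \<kappa>(5)[OF that(1), of m] that by (auto simp: collar_def not_less)
  have \<kappa>s: "smooth (\<lambda>x. complex_of_real (\<kappa> m x))" for m using \<kappa>(1) by (auto elim: test_functionsE)
  define \<phi> where "\<phi> m x = g m x * complex_of_real (\<kappa> m x)" for m x
  have \<phi>t: "\<phi> m \<in> test_functions \<Omega>" for m
    using test_functions_mult[OF \<kappa>(1) g, of m m] by (simp add: \<phi>_def[abs_def])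
  have \<phi>s: "smooth (\<phi> m)" for m using \<phi>t by (auto elim: test_functionsE)
  \<comment> \<open>The difference is \<kappa> (a - b) - (1 - \<kappa>) b, and 1 - \<kappa> vanishes
    off the collar: beyond the error of approximation, the cut-off costs only an integral of
    \<open>b\<close> over the collar.\<close>
  have cut: "(cmod (a * complex_of_real (\<kappa> m x) - b))\<^sup>2 \<le> 2 * (cmod (a - b))\<^sup>2 + 2 * (indicator (collar (4 * d m)) x * (cmod b)\<^sup>2)"
    if "x \<in> \<Omega>" for a b m x
  proof -
    have "a * complex_of_real (\<kappa> m x) - b = complex_of_real (\<kappa> m x) * (a - b) - complex_of_real (1 - \<kappa> m x) * b"
      by (simp add: algebra_simps)
    then have "(cmod (a * complex_of_real (\<kappa> m x) - b))\<^sup>2 \<le>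
        2 * (cmod (complex_of_real (\<kappa> m x) * (a - b)))\<^sup>2 + 2 * (cmod (complex_of_real (1 - \<kappa> m x) * b))\<^sup>2"
      by (simp only: power2_norm_diff_le)
    moreover have "(cmod (complex_of_real (\<kappa> m x) * (a - b)))\<^sup>2 \<le> (cmod (a - b))\<^sup>2"
      using \<kappa>(2,3)[of m x] unfolding norm_mult norm_of_real by (intro power_mono mult_left_le_one_le) auto
    moreover have "(cmod (complex_of_real (1 - \<kappa> m x) * b))\<^sup>2 \<le> indicator (collar (4 * d m)) x * (cmod b)\<^sup>2"
    proof (cases "x \<in> collar (4 * d m)")
      case True
      have "(cmod (complex_of_real (1 - \<kappa> m x) * b))\<^sup>2 \<le> (cmod b)\<^sup>2"
        using \<kappa>(2,3)[of m x] unfolding norm_mult norm_of_real by (intro power_mono mult_left_le_one_le) auto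
      with True show ?thesis by simp
    qed (use that out in simp)
    ultimately show ?thesis by linarith
  qed
  define q where "q v m = (LINT x|M. indicator (collar (4 * d m)) x * (cmod (v x))\<^sup>2)" for v :: "real^2 \<Rightarrow> complex" and m
  have d4: "(\<lambda>m. k * d m) \<longlonglongrightarrow> 0" for k using tendsto_mult_right_zero[OF dlim] .
  have qlim: "q v \<longlonglongrightarrow> 0" if "v \<in> L2 M" for v
    unfolding q_def[abs_def] by (rule collar_integral_tendsto[OF L2_integrable[OF that] d4])
  have ind: "integrable M (\<lambda>x. indicator (collar \<epsilon>) x * (cmod (v x))\<^sup>2)" if "v \<in> L2 M" for v :: "real^2 \<Rightarrow> complex" and \<epsilon>
    by (rule integrable_indicator_mult[OF L2_integrable[OF that] collar_sets])
  have step: "(LINT x|M. (cmod (v x * complex_of_real (\<kappa> m x) - v' x))\<^sup>2) \<le> 2 * (LINT x|M. (cmod (v x - v' x))\<^sup>2) + 2 * q v' m"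
    if v: "v \<in> L2 M" "v' \<in> L2 M" for v v' m
  proof -
    have vk: "(\<lambda>x. v x * complex_of_real (\<kappa> m x)) \<in> L2 M"
      using smooth_mult_L2[OF \<kappa>s v(1), of m] by (simp add: mult.commute)
    have "(LINT x|M. (cmod (v x * complex_of_real (\<kappa> m x) - v' x))\<^sup>2) \<le>
      (LINT x|M. 2 * (cmod (v x - v' x))\<^sup>2 + 2 * (indicator (collar (4 * d m)) x * (cmod (v' x))\<^sup>2))"
      using L2_integrable[OF L2_diff[OF vk v(2)]] L2_integrable[OF L2_diff[OF v]] ind[OF v(2)] cut
      by (intro integral_mono) auto
    also have "\<dots> = 2 * (LINT x|M. (cmod (v x - v' x))\<^sup>2) + 2 * q v' m"
      using L2_integrable[OF L2_diff[OF v]] ind[OF v(2)] by (simp add: q_def)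
    finally show ?thesis .
  qed
  define s where "s x m = (LINT y|M. indicator (collar (K x * d m)) y * ((cmod (W 1 y))\<^sup>2 + (cmod (W 2 y))\<^sup>2))" for x m
  have slim: "s x \<longlonglongrightarrow> 0" for x
    unfolding s_def[abs_def] using L2_integrable[OF wL(2)] by (intro collar_integral_tendsto d4) auto
  \<comment> \<open>The gradients of the approximants are compared with that of the limit, a single
    function whose integral over shrinking collars tends to 0.\<close>
  have G: "(LINT y|M. indicator (collar (K x * d m)) y * ((cmod (pd 1 (g m) y))\<^sup>2 + (cmod (pd 2 (g m) y))\<^sup>2)) \<le> 4 * d m + 2 * s x m" for x m
  proof -
    have p: "pd i (g m) \<in> L2 M" for i by (rule smooth_L2[OF smooth_pd[OF g]])
    have pt: "indicator (collar (K x * d m)) y * ((cmod (pd 1 (g m) y))\<^sup>2 + (cmod (pd 2 (g m) y))\<^sup>2) \<le>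
       (2 * (cmod (pd 1 (g m) y - W 1 y))\<^sup>2 + 2 * (cmod (pd 2 (g m) y - W 2 y))\<^sup>2) +
       2 * (indicator (collar (K x * d m)) y * ((cmod (W 1 y))\<^sup>2 + (cmod (W 2 y))\<^sup>2))" for y
      using power2_norm_add_le[of "pd 1 (g m) y - W 1 y" "W 1 y"] power2_norm_add_le[of "pd 2 (g m) y - W 2 y" "W 2 y"]
      by (auto simp: indicator_def)
    have iW: "integrable M (\<lambda>y. indicator (collar (K x * d m)) y * ((cmod (W 1 y))\<^sup>2 + (cmod (W 2 y))\<^sup>2))"
      using L2_integrable[OF wL(2)] by (intro integrable_indicator_mult collar_sets) auto
    have ip: "integrable M (\<lambda>y. indicator (collar (K x * d m)) y * ((cmod (pd 1 (g m) y))\<^sup>2 + (cmod (pd 2 (g m) y))\<^sup>2))"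
      using L2_integrable[OF p] by (intro integrable_indicator_mult collar_sets) auto
    have id: "integrable M (\<lambda>y. (cmod (pd i (g m) y - W i y))\<^sup>2)" for i
      by (rule L2_integrable[OF L2_diff[OF p wL(2)]])
    have "(LINT y|M. indicator (collar (K x * d m)) y * ((cmod (pd 1 (g m) y))\<^sup>2 + (cmod (pd 2 (g m) y))\<^sup>2)) \<le>
      (LINT y|M. (2 * (cmod (pd 1 (g m) y - W 1 y))\<^sup>2 + 2 * (cmod (pd 2 (g m) y - W 2 y))\<^sup>2) +
         2 * (indicator (collar (K x * d m)) y * ((cmod (W 1 y))\<^sup>2 + (cmod (W 2 y))\<^sup>2)))"
      using iW id by (intro integral_mono ip pt) auto
    also have "\<dots> = (2 * (LINT y|M. (cmod (pd 1 (g m) y - W 1 y))\<^sup>2) + 2 * (LINT y|M. (cmod (pd 2 (g m) y - W 2 y))\<^sup>2)) + 2 * s x m"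
      using iW id[of 1] id[of 2] unfolding s_def
      by (subst Bochner_Integration.integral_add, simp, simp, subst Bochner_Integration.integral_add) auto
    also have "\<dots> \<le> 4 * d m + 2 * s x m" using N(3)[of 1 m] N(3)[of 2 m] by (simp add: g_def)
    finally show ?thesis .
  qed
  \<comment> \<open>The square of \<open>d m\<close> cancels the squared gradient bound of the
    cut-off; the other factor tends to 0.\<close>
  have gq: "q (g m) m \<le> (\<Sum>x\<in>T. (d m)\<^sup>2 * (K x * (5 * d m + 2 * s x m)))" for m
  proof -
    have gi: "integrable M (\<lambda>y. indicator (Q x \<inter> collar (4 * d m)) y * (cmod (g m y))\<^sup>2)" if "x \<in> T" for x
    proof -
      have "open (Q x \<inter> collar (4 * d m))" using patch(1)[of x] T(1) that open_collar by auto
      then show ?thesis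
        by (intro integrable_indicator_mult L2_integrable[OF smooth_L2[OF g]] sets_M_open) (auto simp: collar_def)
    qed
    have "q (g m) m \<le> (LINT y|M. (\<Sum>x\<in>T. indicator (Q x \<inter> collar (4 * d m)) y * (cmod (g m y))\<^sup>2))"
      unfolding q_def
    proof (rule integral_mono)
      show "integrable M (\<lambda>y. indicator (collar (4 * d m)) y * (cmod (g m y))\<^sup>2)" by (rule ind[OF smooth_L2[OF g]])
      show "integrable M (\<lambda>y. (\<Sum>x\<in>T. indicator (Q x \<inter> collar (4 * d m)) y * (cmod (g m y))\<^sup>2))"
        using gi by (rule Bochner_Integration.integrable_sum)
      fix y
      show "indicator (collar (4 * d m)) y * (cmod (g m y))\<^sup>2 \<le> (\<Sum>x\<in>T. indicator (Q x \<inter> collar (4 * d m)) y * (cmod (g m y))\<^sup>2)"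
      proof (cases "y \<in> collar (4 * d m)")
        case True
        then obtain x where x: "x \<in> T" "y \<in> Q x" using cov[of m] by blast
        have "indicator (Q x \<inter> collar (4 * d m)) y * (cmod (g m y))\<^sup>2 \<le> (\<Sum>x\<in>T. indicator (Q x \<inter> collar (4 * d m)) y * (cmod (g m y))\<^sup>2)"
          using x(1) T(2) by (intro member_le_sum) auto
        then show ?thesis using True x by simp
      qed (simp add: sum_nonneg)
    qed
    also have "\<dots> = (\<Sum>x\<in>T. (LINT y|M. indicator (Q x \<inter> collar (4 * d m)) y * (cmod (g m y))\<^sup>2))"
      by (rule Bochner_Integration.integral_sum[OF gi])
    also have "\<dots> \<le> (\<Sum>x\<in>T. (d m)\<^sup>2 * (K x * (5 * d m + 2 * s x m)))"
    proof (rule sum_mono)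
      fix x assume x: "x \<in> T"
      then have xf: "x \<in> frontier \<Omega>" using T(1) by auto
      have K0: "K x > 0" using patch(4)[OF xf] .
      have "(LINT y|M. indicator (Q x \<inter> collar (4 * d m)) y * (cmod (g m y))\<^sup>2) \<le> K x * d m * B (c x) (N m) +
         K x * (d m)\<^sup>2 * (LINT y|M. indicator (collar (K x * d m)) y * ((cmod (pd 1 (g m) y))\<^sup>2 + (cmod (pd 2 (g m) y))\<^sup>2))"
        unfolding g_def by (rule patchI[OF xf d(1) order_less_le_trans[OF d(2) d0(3)[OF x]]])
      also have "\<dots> \<le> K x * d m * (d m)\<^sup>2 + K x * (d m)\<^sup>2 * (4 * d m + 2 * s x m)"
        using K0 d(1)[of m] N(1)[OF x, of m] G[of x m] by (intro add_mono mult_left_mono) auto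
      also have "\<dots> = (d m)\<^sup>2 * (K x * (5 * d m + 2 * s x m))" by (simp add: algebra_simps)
      finally show "(LINT y|M. indicator (Q x \<inter> collar (4 * d m)) y * (cmod (g m y))\<^sup>2) \<le> (d m)\<^sup>2 * (K x * (5 * d m + 2 * s x m))" .
    qed
    finally show ?thesis .
  qed
  have \<phi>0: "(LINT x|M. (cmod (\<phi> m x - w x))\<^sup>2) \<le> 2 * d m + 2 * q w m" for m
    using step[OF smooth_L2[OF g] wL(1), of m m] N(2)[of m] by (simp add: \<phi>_def g_def)
  have \<phi>1: "(LINT x|M. (cmod (pd i (\<phi> m) x - W i x))\<^sup>2) \<le>
      2 * C\<^sup>2 * (\<Sum>x\<in>T. K x * (5 * d m + 2 * s x m)) + 4 * d m + 4 * q (W i) m" for i m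
  proof -
    let ?P = "\<lambda>x. pd i (\<lambda>x. complex_of_real (\<kappa> m x)) x"
    let ?V = "\<lambda>x. pd i (g m) x * complex_of_real (\<kappa> m x) - W i x"
    have eq: "pd i (\<phi> m) x = g m x * ?P x + pd i (g m) x * complex_of_real (\<kappa> m x)" for x
      unfolding \<phi>_def[abs_def] by (rule smooth_pd_mult[OF g \<kappa>s])
    have pg: "pd i (g m) \<in> L2 M" by (rule smooth_L2[OF smooth_pd[OF g]])
    have "(\<lambda>x. complex_of_real (\<kappa> m x) * pd i (g m) x) \<in> L2 M" by (rule smooth_mult_L2[OF \<kappa>s pg])
    then have VL: "?V \<in> L2 M" using L2_diff[OF _ wL(2)] by (simp add: mult.commute)
    have pt: "(cmod (pd i (\<phi> m) x - W i x))\<^sup>2 \<le>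
        2 * ((C / d m)\<^sup>2 * (indicator (collar (4 * d m)) x * (cmod (g m x))\<^sup>2)) + 2 * (cmod (?V x))\<^sup>2" if x: "x \<in> space M" for x
    proof -
      have "(cmod (pd i (\<phi> m) x - W i x))\<^sup>2 \<le> 2 * (cmod (g m x * ?P x))\<^sup>2 + 2 * (cmod (?V x))\<^sup>2"
        using power2_norm_add_le[of "g m x * ?P x" "?V x"] by (simp add: eq algebra_simps)
      moreover have "(cmod (g m x * ?P x))\<^sup>2 \<le> (C / d m)\<^sup>2 * (indicator (collar (4 * d m)) x * (cmod (g m x))\<^sup>2)"
      proof (cases "x \<in> collar (4 * d m)")
        case True
        have "(cmod (?P x))\<^sup>2 \<le> (C / d m)\<^sup>2" using x \<kappa>(4) by (intro power_mono) auto
        then have "(cmod (?P x))\<^sup>2 * (cmod (g m x))\<^sup>2 \<le> (C / d m)\<^sup>2 * (cmod (g m x))\<^sup>2" by (rule mult_right_mono) simp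
        then show ?thesis using True by (simp add: norm_mult power_mult_distrib mult.commute)
      qed (use x out in simp)
      ultimately show ?thesis by linarith
    qed
    have "(LINT x|M. (cmod (pd i (\<phi> m) x - W i x))\<^sup>2) \<le>
      (LINT x|M. 2 * ((C / d m)\<^sup>2 * (indicator (collar (4 * d m)) x * (cmod (g m x))\<^sup>2)) + 2 * (cmod (?V x))\<^sup>2)"
      using L2_integrable[OF VL] ind[OF smooth_L2[OF g]] L2_integrable[OF L2_diff[OF smooth_L2[OF smooth_pd[OF \<phi>s]] wL(2)]] pt
      by (intro integral_mono) auto
    also have "\<dots> = 2 * ((C / d m)\<^sup>2 * q (g m) m) + 2 * (LINT x|M. (cmod (?V x))\<^sup>2)"
      using L2_integrable[OF VL] ind[OF smooth_L2[OF g]] by (simp add: q_def)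
    also have "\<dots> \<le> 2 * ((C / d m)\<^sup>2 * (\<Sum>x\<in>T. (d m)\<^sup>2 * (K x * (5 * d m + 2 * s x m)))) + 2 * (2 * d m + 2 * q (W i) m)"
      using step[OF pg wL(2), of m i] N(3)[of i m] gq[of m] by (intro add_mono mult_left_mono) (auto simp: g_def)
    also have "(C / d m)\<^sup>2 * (\<Sum>x\<in>T. (d m)\<^sup>2 * (K x * (5 * d m + 2 * s x m))) = C\<^sup>2 * (\<Sum>x\<in>T. K x * (5 * d m + 2 * s x m))"
      using d(1)[of m] by (simp add: sum_distrib_left[symmetric] power_divide)
    finally show ?thesis by simp
  qed
  have lim0: "(\<lambda>m. LINT x|M. (cmod (\<phi> m x - w x))\<^sup>2) \<longlonglongrightarrow> 0"
  proof (rule tendsto_sandwich[OF _ _ tendsto_const])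
    show "(\<lambda>m. 2 * d m + 2 * q w m) \<longlonglongrightarrow> 0"
      using tendsto_add[OF tendsto_mult_right_zero[OF dlim] tendsto_mult_right_zero[OF qlim[OF wL(1)]], of 2 2] by simp
  qed (use \<phi>0 in auto)
  have lim1: "(\<lambda>m. LINT x|M. (cmod (pd i (\<phi> m) x - W i x))\<^sup>2) \<longlonglongrightarrow> 0" for i
  proof (rule tendsto_sandwich[OF _ _ tendsto_const])
    have "(\<lambda>m. 2 * C\<^sup>2 * (\<Sum>x\<in>T. K x * (5 * d m + 2 * s x m)) + 4 * d m + 4 * q (W i) m) \<longlonglongrightarrow>
        2 * C\<^sup>2 * (\<Sum>x\<in>T. K x * (5 * 0 + 2 * 0)) + 4 * 0 + 4 * 0"
      by (intro tendsto_intros dlim slim qlim wL)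
    then show "(\<lambda>m. 2 * C\<^sup>2 * (\<Sum>x\<in>T. K x * (5 * d m + 2 * s x m)) + 4 * d m + 4 * q (W i) m) \<longlonglongrightarrow> 0" by simp
  qed (use \<phi>1 in auto)
  have "(\<lambda>m. H1_norm \<Omega> (\<lambda>x. \<phi> m x - w x)) \<longlonglongrightarrow> 0"
    using H1_norm_tendsto_smooth_iff[OF \<phi>s w] lim0 lim1 by (simp add: W_def)
  then show ?thesis using w \<phi>t by (auto simp: H10_def)
qed

end


section \<open>First-order functionals\<close>

context bounded_open
begin

text \<open>Both kinds of source and, for a fixed first argument, the energy form are of this shape.\<close>

definition functional :: "(real^2 \<Rightarrow> complex) \<Rightarrow> (2 \<Rightarrow> real^2 \<Rightarrow> complex) \<Rightarrow> functional" where
  "functional c e \<phi> = (LINT x|M. c x * \<phi> x + (e 1 x * wgrad \<Omega> \<phi> x $ 1 + e 2 x * wgrad \<Omega> \<phi> x $ 2))"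

lemma functional_integrable:
  assumes "c \<in> L2 M" "\<forall>i. e i \<in> L2 M" "\<phi> \<in> H1 \<Omega>"
  shows "integrable M (\<lambda>x. c x * \<phi> x)" "integrable M (\<lambda>x. e i x * wgrad \<Omega> \<phi> x $ i)"
  using L2_mult_integrable[OF assms(1) H1_L2[OF assms(3)]]
    L2_mult_integrable[OF spec[OF assms(2)] wgrad_L2[OF assms(3)]] by auto

lemma functional_expand:
  assumes "c \<in> L2 M" "\<forall>i. e i \<in> L2 M" "\<phi> \<in> H1 \<Omega>"
  shows "functional c e \<phi> = (LINT x|M. c x * \<phi> x) + ((LINT x|M. e 1 x * wgrad \<Omega> \<phi> x $ 1) + (LINT x|M. e 2 x * wgrad \<Omega> \<phi> x $ 2))"
  unfolding functional_def using functional_integrable[OF assms] by simp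

lemma functional_AE:
  assumes "c \<in> L2 M" "\<forall>i. e i \<in> L2 M" "\<phi> \<in> H1 \<Omega>" and G: "is_weak_grad \<Omega> \<phi> G"
  shows "functional c e \<phi> = (LINT x|M. c x * \<phi> x + (e 1 x * G x $ 1 + e 2 x * G x $ 2))"
  unfolding functional_def
proof (rule integral_cong_AE)
  have m: "c \<in> borel_measurable M" "e i \<in> borel_measurable M" "\<phi> \<in> borel_measurable M"
    "(\<lambda>x. G x $ i) \<in> borel_measurable M" "(\<lambda>x. wgrad \<Omega> \<phi> x $ i) \<in> borel_measurable M" for i
    by (intro L2_measurable assms(1) spec[OF assms(2)] H1_L2[OF assms(3)] wgrad_L2[OF assms(3)] is_weak_gradD(1)[OF G])+
  show "(\<lambda>x. c x * \<phi> x + (e 1 x * wgrad \<Omega> \<phi> x $ 1 + e 2 x * wgrad \<Omega> \<phi> x $ 2)) \<in> borel_measurable M"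
    "(\<lambda>x. c x * \<phi> x + (e 1 x * G x $ 1 + e 2 x * G x $ 2)) \<in> borel_measurable M"
    by (intro borel_measurable_add borel_measurable_times m)+
  show "AE x in M. c x * \<phi> x + (e 1 x * wgrad \<Omega> \<phi> x $ 1 + e 2 x * wgrad \<Omega> \<phi> x $ 2) =
      c x * \<phi> x + (e 1 x * G x $ 1 + e 2 x * G x $ 2)"
    using wgrad_AE[OF G] by eventually_elim simp
qed

lemma functional_diff:
  assumes "c \<in> L2 M" "\<forall>i. e i \<in> L2 M" "\<phi> \<in> H1 \<Omega>" "\<psi> \<in> H1 \<Omega>"
  shows "functional c e (\<lambda>x. \<phi> x - \<psi> x) = functional c e \<phi> - functional c e \<psi>"
proof -
  have G: "is_weak_grad \<Omega> (\<lambda>x. \<phi> x - \<psi> x) (\<lambda>x. wgrad \<Omega> \<phi> x - wgrad \<Omega> \<psi> x)"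
    by (intro is_weak_grad_diff H1_L2 is_weak_grad_wgrad assms)
  note i = functional_integrable[OF assms(1,2,3)] functional_integrable[OF assms(1,2,4)]
  have "functional c e (\<lambda>x. \<phi> x - \<psi> x) =
     (LINT x|M. (c x * \<phi> x + (e 1 x * wgrad \<Omega> \<phi> x $ 1 + e 2 x * wgrad \<Omega> \<phi> x $ 2)) -
        (c x * \<psi> x + (e 1 x * wgrad \<Omega> \<psi> x $ 1 + e 2 x * wgrad \<Omega> \<psi> x $ 2)))"
    unfolding functional_AE[OF assms(1,2) H1_diff[OF assms(3,4)] G] by (simp add: algebra_simps)
  also have "\<dots> = functional c e \<phi> - functional c e \<psi>"
    unfolding functional_def by (intro Bochner_Integration.integral_diff Bochner_Integration.integrable_add i)
  finally show ?thesis .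
qed

text \<open>With the multiplier absorbed into the coefficients, the value at
  \<open>h * \<phi>\<close> is again continuous in \<open>\<phi>\<close> for the H^1 norm.\<close>

lemma functional_mult:
  assumes "c \<in> L2 M" "\<forall>i. e i \<in> L2 M" "\<phi> \<in> H1 \<Omega>" "smooth h"
  shows "functional c e (\<lambda>x. h x * \<phi> x) =
    functional (\<lambda>x. h x * c x + (pd 1 h x * e 1 x + pd 2 h x * e 2 x)) (\<lambda>i x. h x * e i x) \<phi>"
proof -
  have G: "is_weak_grad \<Omega> (\<lambda>x. h x * \<phi> x) (\<lambda>x. \<chi> i. h x * wgrad \<Omega> \<phi> x $ i + pd i h x * \<phi> x)"
    by (intro is_weak_grad_mult H1_L2 is_weak_grad_wgrad assms)
  show ?thesis
    unfolding functional_AE[OF assms(1,2) H1_mult[OF assms(4,3)] G]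
    unfolding functional_def
    by (rule arg_cong[where f="integral\<^sup>L M"]) (simp add: fun_eq_iff algebra_simps)
qed

lemma functional_tendsto:
  assumes "c \<in> L2 M" "\<forall>i. e i \<in> L2 M" "\<And>n. f n \<in> H1 \<Omega>" "w \<in> H1 \<Omega>"
    and "(\<lambda>n. H1_norm \<Omega> (\<lambda>x. f n x - w x)) \<longlonglongrightarrow> 0"
  shows "(\<lambda>n. functional c e (f n)) \<longlonglongrightarrow> functional c e w"
proof -
  have l: "(\<lambda>n. LINT x|M. (cmod (f n x - w x))\<^sup>2) \<longlonglongrightarrow> 0"
    "\<And>i. (\<lambda>n. LINT x|M. (cmod (wgrad \<Omega> (f n) x $ i - wgrad \<Omega> w x $ i))\<^sup>2) \<longlonglongrightarrow> 0"
    using assms(5) H1_norm_tendsto_iff[OF assms(3,4)] by auto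
  have 0: "(\<lambda>n. LINT x|M. c x * f n x) \<longlonglongrightarrow> (LINT x|M. c x * w x)"
    using L2_tendsto_integral_mult[OF H1_L2[OF assms(3)] H1_L2[OF assms(4)] assms(1) l(1)] by (simp add: mult.commute)
  have 1: "(\<lambda>n. LINT x|M. e i x * wgrad \<Omega> (f n) x $ i) \<longlonglongrightarrow> (LINT x|M. e i x * wgrad \<Omega> w x $ i)" for i
    using L2_tendsto_integral_mult[OF wgrad_L2[OF assms(3)] wgrad_L2[OF assms(4)] spec[OF assms(2)] l(2), of i i] by (simp add: mult.commute)
  show ?thesis
    unfolding functional_expand[OF assms(1,2,3)] functional_expand[OF assms(1,2,4)] by (intro tendsto_add 0 1)
qed

lemma functional_local:
  assumes "c \<in> L2 M" "\<forall>i. e i \<in> L2 M"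
    and "\<And>x. x \<in> \<Omega> \<Longrightarrow> x \<notin> D \<Longrightarrow> c x = 0" "\<And>i x. x \<in> \<Omega> \<Longrightarrow> x \<notin> D \<Longrightarrow> e i x = 0"
    and "smooth \<phi>" "open V" "D \<subseteq> V" "\<And>x. x \<in> V \<Longrightarrow> \<phi> x = 0"
  shows "functional c e \<phi> = 0"
proof -
  have 0: "pd i \<phi> x = 0" if "x \<in> D" for i x
    using pd_cong_open[OF assms(6), of x \<phi> "\<lambda>_. 0" i] assms(7,8) that by auto
  have "functional c e \<phi> = (LINT x|M. c x * \<phi> x + (e 1 x * cgrad \<phi> x $ 1 + e 2 x * cgrad \<phi> x $ 2))"
    by (rule functional_AE[OF assms(1,2) smooth_H1 is_weak_grad_smooth]) (rule assms(5))+
  also have "\<dots> = (LINT x|M. 0)"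
  proof (rule Bochner_Integration.integral_cong)
    fix x assume "x \<in> space M"
    then show "c x * \<phi> x + (e 1 x * cgrad \<phi> x $ 1 + e 2 x * cgrad \<phi> x $ 2) = 0"
      using assms(3,4,7,8) 0 by (cases "x \<in> D") auto
  qed simp
  finally show ?thesis by simp
qed

end

locale source_functional = bounded_open +
  fixes D :: "(real^2) set" and c :: "real^2 \<Rightarrow> complex" and e :: "2 \<Rightarrow> real^2 \<Rightarrow> complex"
  assumes cL: "c \<in> L2 M" and eL: "\<forall>i. e i \<in> L2 M"
    and c0: "\<And>x. x \<in> \<Omega> \<Longrightarrow> x \<notin> D \<Longrightarrow> c x = 0" and e0: "\<And>i x. x \<in> \<Omega> \<Longrightarrow> x \<notin> D \<Longrightarrow> e i x = 0"
    and closure_D: "closure D \<subseteq> \<Omega>"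
begin

abbreviation "F \<equiv> functional c e"

lemma F_local: "smooth \<phi> \<Longrightarrow> open V \<Longrightarrow> closure D \<subseteq> V \<Longrightarrow> (\<And>x. x \<in> V \<Longrightarrow> \<phi> x = 0) \<Longrightarrow> F \<phi> = 0"
  by (rule functional_local[OF cL eL c0 e0]) (use closure_subset in auto)

lemma compact_closure_D: "compact (closure D)"
  using bounded_subset[OF bdd closure_D] by (simp add: compact_eq_bounded_closed)

lemma support_subset: "support \<Omega> F \<subseteq> closure D"
proof
  fix x assume x: "x \<in> support \<Omega> F"
  show "x \<in> closure D"
  proof (rule ccontr)
    assume nx: "x \<notin> closure D"
    have oU: "open (\<Omega> - closure D)" using opn by (intro open_Diff) auto
    moreover have "x \<in> \<Omega> - closure D" using x nx by (auto simp: support_def)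
    ultimately obtain \<phi> where \<phi>: "\<phi> \<in> test_functions (\<Omega> - closure D)" "F \<phi> \<noteq> 0"
      using x unfolding support_def by blast
    obtain K where K: "smooth \<phi>" "compact K" "K \<subseteq> \<Omega> - closure D" "\<And>x. x \<notin> K \<Longrightarrow> \<phi> x = 0"
      using test_functionsE[OF \<phi>(1)] by metis
    have "F \<phi> = 0"
      by (rule F_local[OF K(1), of "- K"]) (use K in \<open>auto simp: compact_imp_closed open_Compl\<close>)
    with \<phi>(2) show False by simp
  qed
qed

text \<open>Existence gives meaning to the choice inside \<open>ext_functional\<close>.\<close>

lemma ex_cutoff: "\<exists>\<psi>. cutoff \<Omega> F \<psi>"
proof -
  obtain \<psi> V where "(\<lambda>x. complex_of_real (\<psi> x)) \<in> test_functions \<Omega>" "open V" "closure D \<subseteq> V" "\<And>x. x \<in> V \<Longrightarrow> \<psi> x = 1"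
    using compact_cutoff[OF compact_closure_D opn closure_D] by metis
  then have "cutoff \<Omega> F (\<lambda>x. complex_of_real (\<psi> x))"
    unfolding cutoff_def using support_subset by (metis of_real_1 order_trans)
  then show ?thesis by blast
qed

text \<open>The support may be smaller than the closure of \<open>D\<close>, so locality of the
  coefficients is not enough. Off \<open>U\<close> every point of that closure has a neighbourhood
  on whose test functions \<open>F\<close> vanishes; finitely many bumps in such neighbourhoods are
  removed from \<open>\<phi>\<close>, and what is left vanishes near the closure of
  \<open>D\<close>.\<close>

lemma F_zero_off_support:
  assumes \<phi>: "smooth \<phi>" and U: "open U" "support \<Omega> F \<subseteq> U" "\<And>x. x \<in> U \<Longrightarrow> \<phi> x = 0"
  shows "F \<phi> = 0"
proof -
  have "compact (closure D - U)" using compact_diff[OF compact_closure_D U(1)] .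
  moreover have "\<exists>r V. r > 0 \<and> cball z (2 * r) \<subseteq> V \<and> (\<forall>\<phi>\<in>test_functions V. F \<phi> = 0)" if z: "z \<in> closure D - U" for z
  proof -
    have "z \<in> \<Omega>" "z \<notin> support \<Omega> F" using z closure_D U(2) by auto
    then obtain V where V: "open V" "z \<in> V" "\<forall>\<phi>\<in>test_functions V. F \<phi> = 0" unfolding support_def by blast
    then obtain r where "r > 0" "cball z r \<subseteq> V" by (meson open_contains_cball)
    then show ?thesis using V by (intro exI[of _ "r / 2"] exI[of _ V]) auto
  qed
  then obtain r V where rV: "\<And>z. z \<in> closure D - U \<Longrightarrow> r z > 0 \<and> cball z (2 * r z) \<subseteq> V z \<and> (\<forall>\<phi>\<in>test_functions (V z). F \<phi> = 0)"
    by metis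
  ultimately obtain T where T: "T \<subseteq> closure D - U" "finite T" "closure D - U \<subseteq> (\<Union>z\<in>T. ball z (r z))"
    using compactE_image[of "closure D - U" "closure D - U" "\<lambda>z. ball z (r z)"] by (metis (no_types, lifting) UN_iff centre_in_ball open_ball subsetI)
  define \<eta> where "\<eta> z x = complex_of_real (bump ((1 / r z) *\<^sub>R (x - z)))" for z x
  have \<eta>: "\<eta> z \<in> test_functions (V z)" if "z \<in> T" for z
    unfolding \<eta>_def[abs_def] using rV[of z] T(1) that by (intro bump_test_function) auto
  have \<eta>s: "smooth (\<eta> z)" if "z \<in> T" for z using \<eta>[OF that] by (rule test_functionsE)
  \<comment> \<open>Passing from \<open>S\<close> to \<open>insert z S\<close> subtracts
    \<open>p S x * \<eta> z x\<close>, a test function on a set where \<open>F\<close>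
    vanishes.\<close>
  define p where "p S x = \<phi> x * (\<Prod>z\<in>S. 1 - \<eta> z x)" for S x
  have ps: "smooth (p S)" if "S \<subseteq> T" for S
    unfolding p_def[abs_def] using that by (intro smooth_mult \<phi> smooth_prod smooth_diff smooth_const \<eta>s) auto
  have "F (p S) = F \<phi>" if "finite S" "S \<subseteq> T" for S
    using that
  proof (induction S rule: finite_induct)
    case empty
    then show ?case by (simp add: p_def[abs_def])
  next
    case (insert z S)
    have eq: "p (insert z S) = (\<lambda>x. p S x - p S x * \<eta> z x)"
      using insert(1,2) by (auto simp: p_def fun_eq_iff algebra_simps)
    have z: "z \<in> T" using insert by auto
    have t: "(\<lambda>x. p S x * \<eta> z x) \<in> test_functions (V z)"
      by (rule test_functions_mult[OF \<eta>[OF z] ps]) (use insert in auto)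
    then have "F (\<lambda>x. p S x * \<eta> z x) = 0" using rV[of z] z T(1) by blast
    moreover have "smooth (\<lambda>x. p S x * \<eta> z x)" using t by (rule test_functionsE)
    ultimately show ?case
      unfolding eq using insert functional_diff[OF cL eL smooth_H1[OF ps] smooth_H1, of S "\<lambda>x. p S x * \<eta> z x"] by simp
  qed
  from this[OF T(2)] have "F \<phi> = F (p T)" by simp
  also have "F (p T) = 0"
  proof (rule F_local[OF ps])
    show "open (U \<union> (\<Union>z\<in>T. ball z (r z)))" using U(1) by auto
    show "closure D \<subseteq> U \<union> (\<Union>z\<in>T. ball z (r z))" using T(3) by auto
    fix x assume x: "x \<in> U \<union> (\<Union>z\<in>T. ball z (r z))"
    show "p T x = 0"
    proof (cases "x \<in> U")
      case False
      then obtain z where "z \<in> T" "dist z x < r z" using x by auto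
      then have "z \<in> T" "1 - \<eta> z x = 0" by (simp_all only: \<eta>_def bump_ball_eq_1) simp
      then have "(\<Prod>z\<in>T. 1 - \<eta> z x) = 0" using T(2) by (meson prod_zero)
      then show ?thesis by (simp add: p_def)
    qed (simp add: p_def U(3))
  qed auto
  finally show ?thesis .
qed

text \<open>\<open>1 - \<psi>\<close> vanishes near the support, so \<open>F\<close> kills its
  product with each smooth approximant. With this factor moved into the coefficients, the identity
  persists in the H^1 limit.\<close>

lemma F_cutoff:
  assumes \<psi>: "cutoff \<Omega> F \<psi>" and w: "w \<in> H1 \<Omega>" and f: "\<And>n. smooth (f n)"
    and lim: "(\<lambda>n. H1_norm \<Omega> (\<lambda>x. f n x - w x)) \<longlonglongrightarrow> 0"
  shows "F (\<lambda>x. \<psi> x * w x) = F w"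
proof -
  have s: "smooth \<psi>" using \<psi> by (auto simp: cutoff_def elim: test_functionsE)
  have s1: "smooth (\<lambda>x. 1 - \<psi> x)" by (rule smooth_diff[OF smooth_const s])
  obtain U where U: "open U" "support \<Omega> F \<subseteq> U" "\<And>x. x \<in> U \<Longrightarrow> \<psi> x = 1" using \<psi> by (auto simp: cutoff_def)
  let ?c = "\<lambda>x. (1 - \<psi> x) * c x + (pd 1 (\<lambda>x. 1 - \<psi> x) x * e 1 x + pd 2 (\<lambda>x. 1 - \<psi> x) x * e 2 x)"
  let ?e = "\<lambda>i x. (1 - \<psi> x) * e i x"
  have eL': "e i \<in> L2 M" for i using eL by simp
  have L: "?c \<in> L2 M" "\<forall>i. ?e i \<in> L2 M"
    by (intro L2_add smooth_mult_L2 smooth_pd s1 cL eL' allI)+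
  have "functional ?c ?e (f n) = 0" for n
  proof -
    have "functional ?c ?e (f n) = F (\<lambda>x. (1 - \<psi> x) * f n x)"
      by (rule functional_mult[OF cL eL smooth_H1[OF f] s1, symmetric])
    also have "\<dots> = 0" by (rule F_zero_off_support[OF smooth_mult[OF s1 f] U(1,2)]) (simp add: U(3))
    finally show ?thesis .
  qed
  then have "functional ?c ?e w = 0"
    using functional_tendsto[OF L(1) L(2) smooth_H1[OF f] w lim] by (simp add: LIMSEQ_const_iff)
  then have "F (\<lambda>x. (1 - \<psi> x) * w x) = 0" using functional_mult[OF cL eL w s1] by simp
  moreover have "F (\<lambda>x. (1 - \<psi> x) * w x) = F w - F (\<lambda>x. \<psi> x * w x)"
    unfolding functional_diff[OF cL eL w H1_mult[OF s w], symmetric] by (simp add: left_diff_distrib)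
  ultimately show ?thesis by simp
qed

end


section \<open>The indicator function\<close>

context bounded_open
begin

lemma energy_form_eq:
  assumes "u \<in> H1 \<Omega>" "\<phi> \<in> H1 \<Omega>"
  shows "energy_form \<Omega> k u \<phi> = functional (\<lambda>x. - of_real (k\<^sup>2) * u x) (\<lambda>i x. wgrad \<Omega> u x $ i) \<phi>"
proof -
  have 1: "(\<lambda>x. - of_real (k\<^sup>2) * u x) \<in> L2 M" by (rule smooth_mult_L2[OF smooth_const H1_L2[OF assms(1)]])
  have i: "integrable M (\<lambda>x. wgrad \<Omega> u x $ i * wgrad \<Omega> \<phi> x $ i)" for i
    by (intro L2_mult_integrable wgrad_L2 assms)
  show ?thesis
    unfolding functional_expand[OF 1 allI[OF wgrad_L2[OF assms(1)]] assms(2)] energy_form_def bdot_def sum_2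
    using i[of 1] i[of 2] by (simp add: mult.assoc)
qed

lemma energy_form_L2:
  "u \<in> H1 \<Omega> \<Longrightarrow> (\<lambda>x. - of_real (k\<^sup>2) * u x) \<in> L2 M"
  "u \<in> H1 \<Omega> \<Longrightarrow> \<forall>i. (\<lambda>x. wgrad \<Omega> u x $ i) \<in> L2 M"
  by (rule smooth_mult_L2[OF smooth_const H1_L2]) (auto intro: wgrad_L2)

lemma energy_form_diff:
  "u \<in> H1 \<Omega> \<Longrightarrow> \<phi> \<in> H1 \<Omega> \<Longrightarrow> \<psi> \<in> H1 \<Omega> \<Longrightarrow>
    energy_form \<Omega> k u (\<lambda>x. \<phi> x - \<psi> x) = energy_form \<Omega> k u \<phi> - energy_form \<Omega> k u \<psi>"
  by (simp only: energy_form_eq H1_diff functional_diff[OF energy_form_L2])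

lemma energy_form_commute: "energy_form \<Omega> k u v = energy_form \<Omega> k v u"
  by (simp add: energy_form_def bdot_def mult.commute)

text \<open>For test functions this is integration by parts and the classical equation; density and
  continuity give all of H^1_0.\<close>

lemma energy_form_solution:
  assumes v: "smooth v" "\<And>x. pd 1 (pd 1 v) x + pd 2 (pd 2 v) x + of_real (k\<^sup>2) * v x = 0"
    and \<phi>: "\<phi> \<in> H10 \<Omega>"
  shows "energy_form \<Omega> k v \<phi> = 0"
proof -
  have vH: "v \<in> H1 \<Omega>" using v(1) by (rule smooth_H1)
  obtain f where f: "\<And>n. f n \<in> test_functions \<Omega>" and lim: "(\<lambda>n. H1_norm \<Omega> (\<lambda>x. f n x - \<phi> x)) \<longlonglongrightarrow> 0"
    and \<phi>H: "\<phi> \<in> H1 \<Omega>" using \<phi> by (auto simp: H10_def)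
  have fs: "smooth (f n)" for n using f by (rule test_functionsE)
  have "energy_form \<Omega> k v (f n) = 0" for n
  proof -
    \<comment> \<open>\<open>functional_AE\<close> replaces the weak gradient of the argument only;
      exchanging the arguments, and later back, makes both gradients classical.\<close>
    have "energy_form \<Omega> k v (f n) = energy_form \<Omega> k (f n) v" by (rule energy_form_commute)
    also have "\<dots> = functional (\<lambda>x. - of_real (k\<^sup>2) * f n x) (\<lambda>i x. wgrad \<Omega> (f n) x $ i) v"
      by (rule energy_form_eq[OF smooth_H1[OF fs] vH])
    also have "\<dots> = (LINT x|M. - of_real (k\<^sup>2) * f n x * v x + (wgrad \<Omega> (f n) x $ 1 * cgrad v x $ 1 + wgrad \<Omega> (f n) x $ 2 * cgrad v x $ 2))"
      by (rule functional_AE[OF energy_form_L2 vH is_weak_grad_smooth[OF v(1)]]) (rule smooth_H1[OF fs])+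
    also have "\<dots> = (LINT x|M. (- of_real (k\<^sup>2) * v x) * f n x + (pd 1 v x * wgrad \<Omega> (f n) x $ 1 + pd 2 v x * wgrad \<Omega> (f n) x $ 2))"
      by (rule arg_cong[where f="integral\<^sup>L M"]) (simp add: fun_eq_iff mult.commute)
    also have "\<dots> = functional (\<lambda>x. - of_real (k\<^sup>2) * v x) (\<lambda>i. pd i v) (f n)" by (simp add: functional_def)
    also have "\<dots> = (LINT x|M. (- of_real (k\<^sup>2) * v x) * f n x + (pd 1 v x * cgrad (f n) x $ 1 + pd 2 v x * cgrad (f n) x $ 2))"
      by (rule functional_AE[OF energy_form_L2(1)[OF vH] allI[OF smooth_L2[OF smooth_pd[OF v(1)]]] smooth_H1[OF fs] is_weak_grad_smooth[OF fs]])
    also have "\<dots> = (LINT x|M. (- of_real (k\<^sup>2) * v x) * f n x) + ((LINT x|M. pd 1 v x * pd 1 (f n) x) + (LINT x|M. pd 2 v x * pd 2 (f n) x))"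
    proof -
      have "integrable M (\<lambda>x. (- of_real (k\<^sup>2) * v x) * f n x)" "\<And>i. integrable M (\<lambda>x. pd i v x * pd i (f n) x)"
        by (intro L2_mult_integrable energy_form_L2(1)[OF vH] smooth_L2 smooth_pd v fs)+
      then show ?thesis by simp
    qed
    also have "\<dots> = (LINT x|M. (- of_real (k\<^sup>2) * v x) * f n x) + (- (LINT x|M. pd 1 (pd 1 v) x * f n x) + - (LINT x|M. pd 2 (pd 2 v) x * f n x))"
      by (simp only: integration_by_parts[OF smooth_pd[OF v(1)] f])
    also have "\<dots> = - (LINT x|M. (pd 1 (pd 1 v) x + pd 2 (pd 2 v) x + of_real (k\<^sup>2) * v x) * f n x)"
    proof -
      have "integrable M (\<lambda>x. of_real (k\<^sup>2) * v x * f n x)" "\<And>i. integrable M (\<lambda>x. pd i (pd i v) x * f n x)"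
        by (intro L2_mult_integrable smooth_mult_L2[OF smooth_const] smooth_L2 smooth_pd v fs)+
      then show ?thesis by (simp add: distrib_right)
    qed
    finally show ?thesis by (simp only: v(2)) simp
  qed
  moreover have "(\<lambda>n. energy_form \<Omega> k v (f n)) \<longlonglongrightarrow> energy_form \<Omega> k v \<phi>"
    unfolding energy_form_eq[OF vH smooth_H1[OF fs]] energy_form_eq[OF vH \<phi>H]
    by (rule functional_tendsto[OF energy_form_L2[OF vH] smooth_H1[OF fs] \<phi>H lim])
  ultimately show ?thesis by (simp add: LIMSEQ_const_iff)
qed

text \<open>Subtracting the approximating sequences cancels \<open>g\<close> on the boundary, which
  reduces the claim to trace zero.\<close>

lemma same_trace_H10:
  assumes lip: "lipschitz_boundary \<Omega>" and 1: "is_trace \<Omega> w g" and 2: "is_trace \<Omega> w' g"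
  shows "(\<lambda>x. w x - w' x) \<in> H10 \<Omega>"
proof -
  obtain f where w: "w \<in> H1 \<Omega>" and f: "\<And>n. smooth (f n)" "(\<lambda>n. H1_norm \<Omega> (\<lambda>x. f n x - w x)) \<longlonglongrightarrow> 0"
    "L2_boundary_tendsto \<Omega> f g" using 1 by (auto simp: is_trace_def)
  obtain f' where w': "w' \<in> H1 \<Omega>" and f': "\<And>n. smooth (f' n)" "(\<lambda>n. H1_norm \<Omega> (\<lambda>x. f' n x - w' x)) \<longlonglongrightarrow> 0"
    "L2_boundary_tendsto \<Omega> f' g" using 2 by (auto simp: is_trace_def)
  have squeeze: "(\<lambda>n. LINT x|m. (cmod (p n x - p' n x))\<^sup>2) \<longlonglongrightarrow> 0"
    if p: "\<And>n. p n \<in> L2 m" "\<And>n. p' n \<in> L2 m" "(\<lambda>n. LINT x|m. (cmod (p n x))\<^sup>2) \<longlonglongrightarrow> 0"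
      "(\<lambda>n. LINT x|m. (cmod (p' n x))\<^sup>2) \<longlonglongrightarrow> 0" for m :: "'b measure" and p p'
  proof (rule tendsto_sandwich[OF _ _ tendsto_const])
    show "(\<lambda>n. 2 * (LINT x|m. (cmod (p n x))\<^sup>2) + 2 * (LINT x|m. (cmod (p' n x))\<^sup>2)) \<longlonglongrightarrow> 0"
      using tendsto_add[OF tendsto_mult_right_zero[OF p(3)] tendsto_mult_right_zero[OF p(4)], of 2 2] by simp
    have "(LINT x|m. (cmod (p n x - p' n x))\<^sup>2) \<le> (LINT x|m. 2 * (cmod (p n x))\<^sup>2 + 2 * (cmod (p' n x))\<^sup>2)" for n
      using L2_integrable[OF L2_diff[OF p(1) p(2)]] L2_integrable[OF p(1)] L2_integrable[OF p(2)]
      by (intro integral_mono) (auto intro: power2_norm_diff_le)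
    also have "(LINT x|m. 2 * (cmod (p n x))\<^sup>2 + 2 * (cmod (p' n x))\<^sup>2) =
        2 * (LINT x|m. (cmod (p n x))\<^sup>2) + 2 * (LINT x|m. (cmod (p' n x))\<^sup>2)" for n
      using L2_integrable[OF p(1)] L2_integrable[OF p(2)] by simp
    finally show "\<forall>\<^sub>F n in sequentially. (LINT x|m. (cmod (p n x - p' n x))\<^sup>2) \<le>
        2 * (LINT x|m. (cmod (p n x))\<^sup>2) + 2 * (LINT x|m. (cmod (p' n x))\<^sup>2)" by simp
  qed auto
  have dH: "(\<lambda>x. w x - w' x) \<in> H1 \<Omega>" by (rule H1_diff[OF w w'])
  have ds: "smooth (\<lambda>x. f n x - f' n x)" for n by (rule smooth_diff[OF f(1) f'(1)])
  note l = H1_norm_tendsto_smooth_iff[OF f(1) w, THEN iffD1, OF f(2)] H1_norm_tendsto_smooth_iff[OF f'(1) w', THEN iffD1, OF f'(2)]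
  have l0: "(\<lambda>n. LINT x|M. (cmod ((f n x - f' n x) - (w x - w' x)))\<^sup>2) \<longlonglongrightarrow> 0"
  proof -
    have "(\<lambda>n. LINT x|M. (cmod ((f n x - w x) - (f' n x - w' x)))\<^sup>2) \<longlonglongrightarrow> 0"
    proof (rule squeeze)
      show "(\<lambda>x. f n x - w x) \<in> L2 M" "(\<lambda>x. f' n x - w' x) \<in> L2 M" for n
        by (intro L2_diff smooth_L2 H1_L2 f f' w w')+
    qed (use l in blast)+
    moreover have "(f n x - w x) - (f' n x - w' x) = (f n x - f' n x) - (w x - w' x)" for n x by simp
    ultimately show ?thesis by simp
  qed
  have l1: "(\<lambda>n. LINT x|M. (cmod (pd i (\<lambda>x. f n x - f' n x) x - wgrad \<Omega> (\<lambda>x. w x - w' x) x $ i))\<^sup>2) \<longlonglongrightarrow> 0" for i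
  proof -
    have "(\<lambda>n. LINT x|M. (cmod ((pd i (f n) x - wgrad \<Omega> w x $ i) - (pd i (f' n) x - wgrad \<Omega> w' x $ i)))\<^sup>2) \<longlonglongrightarrow> 0"
    proof (rule squeeze)
      show "(\<lambda>x. pd i (f n) x - wgrad \<Omega> w x $ i) \<in> L2 M" "(\<lambda>x. pd i (f' n) x - wgrad \<Omega> w' x $ i) \<in> L2 M" for n
        by (intro L2_diff smooth_L2 smooth_pd wgrad_L2 f f' w w')+
    qed (use l in blast)+
    moreover have "(LINT x|M. (cmod (pd i (\<lambda>x. f n x - f' n x) x - wgrad \<Omega> (\<lambda>x. w x - w' x) x $ i))\<^sup>2) =
        (LINT x|M. (cmod ((pd i (f n) x - wgrad \<Omega> w x $ i) - (pd i (f' n) x - wgrad \<Omega> w' x $ i)))\<^sup>2)" for n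
    proof (rule integral_cong_AE)
      show "(\<lambda>x. (cmod (pd i (\<lambda>x. f n x - f' n x) x - wgrad \<Omega> (\<lambda>x. w x - w' x) x $ i))\<^sup>2) \<in> borel_measurable M"
        by (rule borel_measurable_integrable[OF L2_integrable[OF L2_diff[OF smooth_L2[OF smooth_pd[OF ds]] wgrad_L2[OF dH]]]])
      show "(\<lambda>x. (cmod ((pd i (f n) x - wgrad \<Omega> w x $ i) - (pd i (f' n) x - wgrad \<Omega> w' x $ i)))\<^sup>2) \<in> borel_measurable M"
        by (rule borel_measurable_integrable[OF L2_integrable]) (intro L2_diff smooth_L2 smooth_pd wgrad_L2 f f' w w')
      show "AE x in M. (cmod (pd i (\<lambda>x. f n x - f' n x) x - wgrad \<Omega> (\<lambda>x. w x - w' x) x $ i))\<^sup>2 =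
        (cmod ((pd i (f n) x - wgrad \<Omega> w x $ i) - (pd i (f' n) x - wgrad \<Omega> w' x $ i)))\<^sup>2"
        using wgrad_diff[OF w w'] by eventually_elim (simp only: smooth_pd_diff[OF f(1) f'(1)] vector_minus_component, simp add: algebra_simps)
    qed
    ultimately show ?thesis by simp
  qed
  have lim: "(\<lambda>n. H1_norm \<Omega> (\<lambda>x. (f n x - f' n x) - (w x - w' x))) \<longlonglongrightarrow> 0"
    using H1_norm_tendsto_smooth_iff[OF ds dH] l0 l1 by auto
  have tr: "L2_boundary_tendsto \<Omega> (\<lambda>n x. f n x - f' n x) (\<lambda>_. 0)"
    unfolding L2_boundary_tendsto_def Let_def
  proof (intro allI impI)
    fix x a b r h \<gamma> assume chart: "lipschitz_chart \<Omega> x a b r h \<gamma>"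
    let ?m = "lebesgue_on {-r<..<r}" and ?P = "\<lambda>s. x + s *\<^sub>R a + \<gamma> s *\<^sub>R b"
    have a: "\<And>n. (\<lambda>s. f n (?P s) - g (?P s)) \<in> L2 ?m" "(\<lambda>n. LINT s|?m. (cmod (f n (?P s) - g (?P s)))\<^sup>2) \<longlonglongrightarrow> 0"
      using f(3) chart unfolding L2_boundary_tendsto_def Let_def by blast+
    have b: "\<And>n. (\<lambda>s. f' n (?P s) - g (?P s)) \<in> L2 ?m" "(\<lambda>n. LINT s|?m. (cmod (f' n (?P s) - g (?P s)))\<^sup>2) \<longlonglongrightarrow> 0"
      using f'(3) chart unfolding L2_boundary_tendsto_def Let_def by blast+
    have "(\<lambda>s. (f n (?P s) - g (?P s)) - (f' n (?P s) - g (?P s))) \<in> L2 ?m" for n by (rule L2_diff[OF a(1) b(1)])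
    moreover have "(\<lambda>n. LINT s|?m. (cmod ((f n (?P s) - g (?P s)) - (f' n (?P s) - g (?P s))))\<^sup>2) \<longlonglongrightarrow> 0"
      by (rule squeeze[OF a(1) b(1) a(2) b(2)])
    ultimately show "(\<forall>n. (\<lambda>s. f n (?P s) - f' n (?P s) - 0) \<in> L2 ?m) \<and>
        (\<lambda>n. LINT s|?m. (cmod (f n (?P s) - f' n (?P s) - 0))\<^sup>2) \<longlonglongrightarrow> 0" by simp
  qed
  show ?thesis by (rule trace_zero_imp_H10[OF lip dH ds lim tr])
qed

lemma is_trace_smooth:
  assumes "smooth v" shows "is_trace \<Omega> v v"
proof -
  have "is_weak_grad \<Omega> (\<lambda>x. 0) (\<lambda>x. 0)"
    using is_weak_grad_diff[OF smooth_L2 smooth_L2 is_weak_grad_smooth is_weak_grad_smooth, OF assms assms assms assms] by simp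
  then have "H1_norm \<Omega> (\<lambda>x. v x - v x) = 0" by (simp add: H1_norm_eq)
  moreover have "L2_boundary_tendsto \<Omega> (\<lambda>n. v) v"
    by (simp add: L2_boundary_tendsto_def L2_def)
  ultimately show ?thesis
    unfolding is_trace_def using assms smooth_H1 by (auto intro!: exI[of _ "\<lambda>n. v"])
qed

end

context source_functional
begin

text \<open>Both pairings contain a lifting fixed by choice. The lifting of \<open>v\<close> may be
  exchanged for \<open>v\<close> by the equation of \<open>u\<close>, that of \<open>f\<close> for
  \<open>u\<close> by the equation of \<open>v\<close>; the energy terms then cancel by
  symmetry.\<close>

lemma neumann_difference:
  assumes lip: "lipschitz_boundary \<Omega>" and u: "weak_solution \<Omega> k F u" and tr: "is_trace \<Omega> u f"
    and v: "smooth v" "\<And>x. pd 1 (pd 1 v) x + pd 2 (pd 2 v) x + of_real (k\<^sup>2) * v x = 0"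
  shows "neumann \<Omega> k F u v - neumann \<Omega> k (\<lambda>_. 0) v f = F v"
proof -
  define w where "w = (SOME w. is_trace \<Omega> w v)"
  define w' where "w' = (SOME w. is_trace \<Omega> w f)"
  define \<psi> where "\<psi> = (SOME \<psi>. cutoff \<Omega> F \<psi>)"
  have w: "is_trace \<Omega> w v" unfolding w_def using is_trace_smooth[OF v(1)] by (rule someI[of "\<lambda>w. is_trace \<Omega> w v"])
  have w': "is_trace \<Omega> w' f" unfolding w'_def using tr by (rule someI[of "\<lambda>w. is_trace \<Omega> w f"])
  have \<psi>: "cutoff \<Omega> F \<psi>" unfolding \<psi>_def using ex_cutoff by (rule someI_ex)
  have H: "w \<in> H1 \<Omega>" "w' \<in> H1 \<Omega>" "u \<in> H1 \<Omega>" "v \<in> H1 \<Omega>"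
    using w w' u smooth_H1[OF v(1)] by (auto simp: is_trace_def weak_solution_def)
  obtain p where p: "\<And>n. smooth (p n)" "(\<lambda>n. H1_norm \<Omega> (\<lambda>x. p n x - w x)) \<longlonglongrightarrow> 0"
    using w by (auto simp: is_trace_def)
  have 1: "ext_functional \<Omega> F w = F w"
    unfolding ext_functional_def Let_def \<psi>_def[symmetric] by (rule F_cutoff[OF \<psi> H(1) p])
  have "energy_form \<Omega> k u (\<lambda>x. w x - v x) = - F (\<lambda>x. w x - v x)"
    using u same_trace_H10[OF lip w is_trace_smooth[OF v(1)]] by (simp add: weak_solution_def)
  then have 2: "energy_form \<Omega> k u w - energy_form \<Omega> k u v = - (F w - F v)"
    using H by (simp add: energy_form_diff functional_diff[OF cL eL])
  have "energy_form \<Omega> k v (\<lambda>x. w' x - u x) = 0"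
    by (rule energy_form_solution[OF v same_trace_H10[OF lip w' tr]])
  then have 3: "energy_form \<Omega> k v w' = energy_form \<Omega> k v u" using H by (simp add: energy_form_diff)
  have "neumann \<Omega> k F u v = energy_form \<Omega> k u w + F w"
    unfolding neumann_def Let_def w_def[symmetric] 1 ..
  also have "\<dots> = energy_form \<Omega> k u v + F v" using 2 by (simp add: algebra_simps)
  finally have A: "neumann \<Omega> k F u v = energy_form \<Omega> k u v + F v" .
  \<comment> \<open>For the zero functional the extension is 0 whatever cut-off is chosen.\<close>
  have B: "neumann \<Omega> k (\<lambda>_. 0) v f = energy_form \<Omega> k u v"
    unfolding neumann_def Let_def w'_def[symmetric] ext_functional_def 3 by (simp add: energy_form_commute)
  show ?thesis unfolding A B by simp
qed

end


section \<open>The polygon near the extreme vertex\<close>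

lemma pathstart_polygonal_path [simp]: "pathstart (polygonal_path (x # xs)) = x"
  by (cases "x # xs" rule: polygonal_path.cases) auto

lemma pathfinish_polygonal_path: "xs \<noteq> [] \<Longrightarrow> pathfinish (polygonal_path xs) = last xs"
  by (induction xs rule: polygonal_path.induct) auto

lemma path_image_polygonal_path:
  "length xs \<ge> 2 \<Longrightarrow> path_image (polygonal_path xs) = (\<Union>(a, b)\<in>set (zip xs (tl xs)). closed_segment a b)"
  by (induction xs rule: polygonal_path.induct) (auto simp: path_image_join)

definition segment_count :: "real^2 \<Rightarrow> (real^2) list \<Rightarrow> nat" where
  "segment_count p xs = length (filter (\<lambda>(a, b). p \<in> closed_segment a b) (zip xs (tl xs)))"

lemma segment_count_eq_0:
  "length xs \<ge> 2 \<Longrightarrow> p \<notin> path_image (polygonal_path xs) \<Longrightarrow> segment_count p xs = 0"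
  by (auto simp: path_image_polygonal_path segment_count_def filter_empty_conv)

lemma segment_count_Cons:
  "segment_count p (a # b # xs) = (if p \<in> closed_segment a b then 1 else 0) + segment_count p (b # xs)"
  by (simp add: segment_count_def)

text \<open>The sharper bound at the ends carries the induction: the first edge meets the rest only
  at their joint, which is an end of the rest, where at most one edge of the rest passes.\<close>

lemma segment_count_arc:
  assumes "arc (polygonal_path xs)" "length xs \<ge> 2"
  shows "segment_count p xs \<le> 2 \<and> (p = hd xs \<or> p = last xs \<longrightarrow> segment_count p xs \<le> 1)"
  using assms
proof (induction xs rule: polygonal_path.induct)
  case (3 a b)
  then show ?case by (simp add: segment_count_def)
next
  case (4 a b c xs)
  let ?g = "polygonal_path (b # c # xs)"
  have ab: "a \<noteq> b" and g: "arc ?g" and int: "closed_segment a b \<inter> path_image ?g \<subseteq> {b}"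
    using 4(2) by (simp_all add: arc_join_eq arc_distinct_ends)
     (metis arc_distinct_ends pathstart_linepath pathfinish_linepath)
  have IH: "segment_count p (b # c # xs) \<le> 2" "p = b \<or> p = last (b # c # xs) \<Longrightarrow> segment_count p (b # c # xs) \<le> 1"
    using 4(1) g by auto
  have 0: "p \<notin> path_image ?g \<Longrightarrow> segment_count p (b # c # xs) = 0" by (rule segment_count_eq_0) auto
  have nb: "last (b # c # xs) \<noteq> b"
    using arc_distinct_ends[OF g] by (simp add: pathfinish_polygonal_path)
  have last: "last (b # c # xs) \<in> path_image ?g"
    using pathfinish_in_path_image[of ?g] by (simp add: pathfinish_polygonal_path)
  have sc: "segment_count p (a # b # c # xs) = (if p \<in> closed_segment a b then 1 else 0) + segment_count p (b # c # xs)"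
    by (rule segment_count_Cons)
  show ?case
  proof (cases "p \<in> closed_segment a b")
    case True
    then have "p = b \<or> p \<notin> path_image ?g" using int by auto
    then have le1: "segment_count p (b # c # xs) \<le> 1" using IH(2) 0 by auto
    moreover have "segment_count p (b # c # xs) = 0" if "p = a \<or> p = last (b # c # xs)"
      using that ab nb last int True 0 by auto
    ultimately show ?thesis using True sc by auto
  next
    case False
    then have "p \<noteq> a" by auto
    then show ?thesis using False IH sc by auto
  qed
qed auto

text \<open>The loop is opened into its first edge and an arc. They meet only in the ends of the
  arc, where the arc contributes at most one edge.\<close>

lemma segment_count_closed:
  assumes "simple_path (polygonal_path (ps @ [hd ps]))" "length ps \<ge> 3"
  shows "segment_count p (ps @ [hd ps]) \<le> 2"
proof -
  obtain a b c qs where ps: "ps = a # b # c # qs"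
    using assms(2) by (auto simp: numeral_3_eq_3 Suc_le_length_iff)
  let ?xs = "b # c # qs @ [a]"
  let ?g = "polygonal_path ?xs"
  have fin: "pathfinish ?g = a" by (simp add: pathfinish_polygonal_path)
  have "simple_path (linepath a b +++ ?g)" using assms(1) by (simp add: ps)
  then have g: "arc ?g" and int: "closed_segment a b \<inter> path_image ?g \<subseteq> {a, b}"
    using fin by (simp_all add: simple_path_join_loop_eq)
  have IH: "segment_count p ?xs \<le> 2" "p = b \<or> p = a \<Longrightarrow> segment_count p ?xs \<le> 1"
    using segment_count_arc[OF g, of p] by auto
  have 0: "p \<notin> path_image ?g \<Longrightarrow> segment_count p ?xs = 0" by (rule segment_count_eq_0) auto
  have "p \<in> closed_segment a b \<Longrightarrow> segment_count p ?xs \<le> 1" using int IH(2) 0 by fastforce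
  then show ?thesis using IH(1) by (auto simp: ps segment_count_Cons[of p a])
qed

text \<open>The frontier of the inside of a closed set always lies in that set. The converse
  inclusion is the Jordan-Brouwer theorem: a bounded component of the complement has the whole curve
  as its frontier, and it lies in \<open>D\<close>.\<close>

lemma open_polygon_topology:
  assumes "open_polygon ps D"
  shows "open D" "bounded D" "D \<noteq> {}" "frontier D = (\<Union>(a, b)\<in>set (zip (ps @ [hd ps]) (tl (ps @ [hd ps]))). closed_segment a b)"
proof -
  let ?g = "polygonal_path (ps @ [hd ps])"
  define S where "S = path_image ?g"
  have len: "length ps \<ge> 3" and sp: "simple_path ?g" and D: "D = inside S"
    using assms by (auto simp: open_polygon_def S_def)
  have ps: "ps \<noteq> []" using len by auto
  have loop: "pathfinish ?g = pathstart ?g"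
    using ps by (cases ps) (auto simp: pathfinish_polygonal_path)
  have S: "compact S" "closed S" "bounded S"
    using sp by (auto simp: S_def simple_path_imp_path compact_path_image closed_path_image bounded_path_image)
  show "open D" unfolding D by (rule open_inside[OF S(2)])
  show "bounded D" unfolding D by (rule bounded_inside[OF S(3)])
  have "S homeomorphic sphere (0::complex) 1"
    unfolding S_def by (rule homeomorphic_simple_path_image_circle[OF sp loop]) simp
  moreover have "sphere (0::complex) 1 homeomorphic sphere (0::real^2) 1"
    by (rule homeomorphic_spheres_gen) auto
  ultimately have hom: "S homeomorphic sphere (0::real^2) 1" by (rule homeomorphic_trans)
  have "\<not> connected (- S)" by (rule Jordan_Brouwer_separation[OF hom]) simp
  then obtain T where T: "T \<in> components (- S)" "bounded T"
    using cobounded_has_bounded_component[of "- S"] S(3) by auto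
  have fT: "frontier T = S" by (rule Jordan_Brouwer_frontier[OF hom T(1)]) simp
  have "T \<subseteq> D"
  proof
    fix x assume x: "x \<in> T"
    have "connected_component_set (- S) x = T" using T(1) x by (metis components_iff connected_component_eq)
    moreover have "x \<notin> S" using T(1) x in_components_subset by fastforce
    ultimately show "x \<in> D" using T(2) by (simp add: D inside_def)
  qed
  have "S \<subseteq> closure D" using fT closure_mono[OF \<open>T \<subseteq> D\<close>] by (auto simp: frontier_def)
  moreover have "S \<inter> D = {}" unfolding D using inside_no_overlap by blast
  ultimately have "S \<subseteq> frontier D" using \<open>open D\<close> by (auto simp: frontier_def interior_open)
  moreover have "frontier D \<subseteq> S" unfolding D by (rule frontier_inside_subset[OF S(2)])
  moreover have "S = (\<Union>(a, b)\<in>set (zip (ps @ [hd ps]) (tl (ps @ [hd ps]))). closed_segment a b)"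
    unfolding S_def by (rule path_image_polygonal_path) (use len in auto)
  ultimately show "frontier D = (\<Union>(a, b)\<in>set (zip (ps @ [hd ps]) (tl (ps @ [hd ps]))). closed_segment a b)" by blast
  show "D \<noteq> {}" using T(1) \<open>T \<subseteq> D\<close> in_components_nonempty by blast
qed

lemma pair_superset:
  fixes C :: "real set"
  assumes "finite C" "card C \<le> 2"
  obtains c1 c2 where "c1 < c2" "C \<subseteq> {c1, c2}"
proof -
  consider "card C = 0" | "card C = 1" | "card C = 2" using assms(2) by linarith
  then show thesis
  proof cases
    case 1
    then show ?thesis using assms(1) that[of 0 1] by auto
  next
    case 2
    then obtain c where "C = {c}" by (rule card_1_singletonE)
    then show ?thesis using that[of c "c + 1"] by auto
  next
    case 3
    then obtain c d where "C = {c, d}" "c \<noteq> d" by (meson card_2_iff)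
    then show ?thesis using that[of c d] that[of d c] by (cases "c < d") auto
  qed
qed

text \<open>The second clause is not strict, since it also has to allow for points of \<open>D\<close> on the two rays; they form a
  null set.\<close>

definition corner :: "(real^2) set \<Rightarrow> real^2 \<Rightarrow> real^2 \<Rightarrow> real^2 \<Rightarrow> real \<Rightarrow> real \<Rightarrow> bool" where
  "corner D p \<omega> \<omega>' c1 c2 \<longleftrightarrow> (\<forall>\<epsilon>>0. \<exists>\<delta>>0.
     (\<forall>x. 0 < (p - x) \<bullet> \<omega> \<and> (p - x) \<bullet> \<omega> < \<delta> \<and>
          c1 * ((p - x) \<bullet> \<omega>) < (x - p) \<bullet> \<omega>' \<and> (x - p) \<bullet> \<omega>' < c2 * ((p - x) \<bullet> \<omega>) \<longrightarrow>
        x \<in> D \<and> x \<in> ball p \<epsilon>) \<and>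
     (\<forall>x\<in>D. (p - x) \<bullet> \<omega> < \<delta> \<longrightarrow>
        c1 * ((p - x) \<bullet> \<omega>) \<le> (x - p) \<bullet> \<omega>' \<and> (x - p) \<bullet> \<omega>' \<le> c2 * ((p - x) \<bullet> \<omega>)))"

text \<open>Near \<open>p\<close> the frontier lies on at most two rays, which cut the half-disc
  below the supporting line into three convex pieces, each inside \<open>D\<close> or disjoint from
  it. The outer pieces reach the supporting line away from \<open>p\<close>, where the closure of
  \<open>D\<close> has no points, so only the middle piece can belong to \<open>D\<close>.\<close>

lemma polygon_corner:
  assumes poly: "open_polygon ps D" and reg: "regular_direction D \<omega>"
    and \<omega>': "norm \<omega>' = 1" "\<omega> \<bullet> \<omega>' = 0"
  obtains p c1 c2 where "p \<in> set ps" "p \<bullet> \<omega> = support_fun D \<omega>" "c1 < c2"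
    "\<And>x. x \<in> D \<Longrightarrow> 0 < (p - x) \<bullet> \<omega>"
    "corner D p \<omega> \<omega>' c1 c2"
proof -
  define h where "h = support_fun D \<omega>"
  note top = open_polygon_topology[OF poly]
  have \<omega>: "norm \<omega> = 1" using reg by (simp add: regular_direction_def)
  obtain p where p: "p \<in> frontier D" "p \<bullet> \<omega> = h" and uniq: "\<And>x. x \<in> frontier D \<Longrightarrow> x \<bullet> \<omega> = h \<Longrightarrow> x = p"
    using reg unfolding regular_direction_def h_def by blast
  \<comment> \<open>Depth below the supporting line.\<close>
  define y where "y x = (p - x) \<bullet> \<omega>" for x
  define z where "z x = (x - p) \<bullet> \<omega>'" for x
  have yh: "y x = h - x \<bullet> \<omega>" for x by (simp add: y_def inner_diff_left p(2))
  have in1 [simp]: "\<omega> \<bullet> \<omega> = 1" "\<omega>' \<bullet> \<omega>' = 1" "\<omega> \<bullet> \<omega>' = 0" "\<omega>' \<bullet> \<omega> = 0"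
    using \<omega> \<omega>' by (auto simp: norm_eq_1 inner_commute)
  interpret fr: frame p \<omega> \<omega>' using \<omega> \<omega>' by unfold_locales
  have y_move: "y (x + s *\<^sub>R \<omega>') = y x" "z (x + s *\<^sub>R \<omega>') = z x + s" "y (x + s *\<^sub>R \<omega>) = y x - s" "z (x + s *\<^sub>R \<omega>) = z x" for x s
    by (simp_all add: y_def z_def inner_diff_left inner_add_left)
  have yp: "y p = 0" "z p = 0" by (simp_all add: y_def z_def)
  have cont: "continuous_on UNIV y" "continuous_on UNIV z"
    unfolding y_def[abs_def] z_def[abs_def] by (intro continuous_intros)+
  have bdd: "bdd_above ((\<lambda>x. x \<bullet> \<omega>) ` D)"
  proof -
    have "bounded ((\<lambda>x. x \<bullet> \<omega>) ` D)" by (rule bounded_linear_image[OF top(2) bounded_linear_inner_left])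
    then show ?thesis by (rule bounded_imp_bdd_above)
  qed
  have Dy: "y x > 0" if x: "x \<in> D" for x
  proof -
    obtain e where e: "e > 0" "ball x e \<subseteq> D" using top(1) x by (meson open_contains_ball)
    then have "x + (e / 2) *\<^sub>R \<omega> \<in> D" using \<omega> by (auto simp: dist_norm subset_iff)
    then have "(x + (e / 2) *\<^sub>R \<omega>) \<bullet> \<omega> \<le> h" unfolding h_def support_fun_def using bdd by (rule cSUP_upper)
    then show ?thesis using e by (simp add: yh inner_add_left)
  qed
  have cly: "y x \<ge> 0" if "x \<in> closure D" for x
  proof -
    have "closed {x. y x \<ge> 0}" by (intro closed_Collect_le continuous_intros cont)
    moreover have "D \<subseteq> {x. y x \<ge> 0}" using Dy by (auto intro: less_imp_le)
    ultimately have "closure D \<subseteq> {x. y x \<ge> 0}" by (rule closure_minimal[rotated])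
    then show ?thesis using that by auto
  qed
  have fry: "y x > 0" if "x \<in> frontier D" "x \<noteq> p" for x
    using cly[of x] uniq[of x] that by (auto simp: frontier_def yh less_le)
  define xs where "xs = ps @ [hd ps]"
  define Z where "Z = zip xs (tl xs)"
  have S: "frontier D = (\<Union>(a, b)\<in>set Z. closed_segment a b)" using top(4) by (simp add: Z_def xs_def)
  define L where "L = filter (\<lambda>(a, b). p \<in> closed_segment a b) Z"
  have L2: "length L \<le> 2"
    using segment_count_closed[of ps p] poly by (simp add: open_polygon_def segment_count_def L_def Z_def xs_def)
  \<comment> \<open>\<open>y\<close> is affine, and positive at all frontier points other than
    \<open>p\<close>; an edge with \<open>p\<close> strictly inside would give y p > 0.\<close>
  have seg_end: "p = a \<or> p = b" if "(a, b) \<in> set L" for a b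
  proof (rule ccontr)
    assume n: "\<not> (p = a \<or> p = b)"
    have "p \<in> closed_segment a b" "(a, b) \<in> set Z" using that by (auto simp: L_def)
    then have "a \<in> frontier D" "b \<in> frontier D" and pseg: "p \<in> closed_segment a b" by (auto simp: S)
    then have "y a > 0" "y b > 0" using fry n by auto
    obtain u where u: "0 \<le> u" "u \<le> 1" "p = (1 - u) *\<^sub>R a + u *\<^sub>R b" using pseg by (auto simp: in_segment)
    have "y p = (1 - u) * y a + u * y b"
    proof -
      have "p \<bullet> \<omega> = (1 - u) * (a \<bullet> \<omega>) + u * (b \<bullet> \<omega>)" by (subst u(3)) (simp add: inner_add_left)
      then show ?thesis by (simp add: yh algebra_simps)
    qed
    moreover have "(1 - u) * y a + u * y b > 0"
      using u \<open>y a > 0\<close> \<open>y b > 0\<close> by (cases "u = 0") (auto intro: add_nonneg_pos)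
    ultimately show False using yp by simp
  qed
  have pps: "p \<in> set ps"
  proof -
    obtain a b where ab: "(a, b) \<in> set Z" "p \<in> closed_segment a b" using p(1) S by auto
    then have "p = a \<or> p = b" using seg_end[of a b] by (auto simp: L_def)
    moreover have "a \<in> set xs" "b \<in> set xs"
      using ab(1) set_zip_leftD[of a b xs "tl xs"] set_zip_rightD[of a b xs "tl xs"] by (auto simp: Z_def xs_def dest: list.set_sel(2)[rotated])
    moreover have "set xs \<subseteq> set ps" using poly by (auto simp: xs_def open_polygon_def intro: hd_in_set)
    ultimately show ?thesis by auto
  qed
  \<comment> \<open>Taken at the far end of the edge, whichever component of the pair is
    \<open>p\<close>.\<close>
  define slope where "slope ab = (let e = (if fst ab = p then snd ab else fst ab) in z e / y e)" for ab
  have "card (slope ` set L) \<le> 2"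
    using card_image_le[of "set L" slope] card_length[of L] L2 by simp
  (* If there is only one slope at p, a dummy second ray is added: it is only used below that frontier points
     near p lie on one of the two rays, not that every point of the rays is a frontier point. *)
  then obtain c1 c2 where c: "c1 < c2" "slope ` set L \<subseteq> {c1, c2}" using pair_superset[of "slope ` set L"] by auto
  have on_ray: "x = p \<or> (y x > 0 \<and> (z x = c1 * y x \<or> z x = c2 * y x))" if abL: "(a, b) \<in> set L" and xab: "x \<in> closed_segment a b" for a b x
  proof -
    define e where "e = (if a = p then b else a)"
    have sl: "slope (a, b) = z e / y e" by (simp add: slope_def e_def Let_def)
    have "x \<in> closed_segment p e"
      using seg_end[OF abL] xab by (auto simp: e_def closed_segment_commute)
    then obtain u where u: "0 \<le> u" "x = (1 - u) *\<^sub>R p + u *\<^sub>R e" by (auto simp: in_segment)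
    then have xp: "x - p = u *\<^sub>R (e - p)" by (simp add: algebra_simps)
    have yx: "y x = u * y e"
    proof -
      have "p - x = u *\<^sub>R (p - e)" using xp by (simp add: algebra_simps)
      then show ?thesis by (simp add: y_def)
    qed
    have zx: "z x = u * z e" using xp by (simp add: z_def)
    show ?thesis
    proof (cases "x = p")
      case False
      then have "u \<noteq> 0" "e \<noteq> p" using xp by auto
      have "e \<in> frontier D" using abL by (auto simp: S L_def e_def)
      then have ye: "y e > 0" using fry \<open>e \<noteq> p\<close> by simp
      have "z e / y e = c1 \<or> z e / y e = c2" using c(2) abL sl by force
      then have "z e = c1 * y e \<or> z e = c2 * y e" using ye by (auto simp: field_simps)
      then show ?thesis using yx zx ye u(1) \<open>u \<noteq> 0\<close> by auto
    qed simp
  qed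
  \<comment> \<open>The finitely many edges that miss \<open>p\<close> form a closed set, so a disc
    around \<open>p\<close> avoids them.\<close>
  define R where "R = (\<Union>(a, b)\<in>{ab \<in> set Z. p \<notin> closed_segment (fst ab) (snd ab)}. closed_segment a b)"
  have "closed R" unfolding R_def by (intro closed_UN) auto
  moreover have "p \<notin> R" by (auto simp: R_def)
  ultimately obtain \<epsilon>0 where \<epsilon>0: "\<epsilon>0 > 0" "ball p \<epsilon>0 \<inter> R = {}"
    by (metis open_Compl open_contains_ball ComplI disjoint_eq_subset_Compl)
  have near: "x = p \<or> (y x > 0 \<and> (z x = c1 * y x \<or> z x = c2 * y x))" if xf: "x \<in> frontier D" and xb: "x \<in> ball p \<epsilon>0" for x
  proof -
    obtain a b where ab: "(a, b) \<in> set Z" "x \<in> closed_segment a b" using xf S by auto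
    have "p \<in> closed_segment a b"
    proof (rule ccontr)
      assume "p \<notin> closed_segment a b"
      then have "x \<in> R" using ab by (auto simp: R_def)
      then show False using xb \<epsilon>0(2) by auto
    qed
    then show ?thesis using on_ray[of a b x] ab by (auto simp: L_def)
  qed
  define G where "G A = ball p \<epsilon>0 \<inter> {x. y x > 0} \<inter> A" for A
  have lin_conv: "convex {x. r * y x < s * z x}" for r s
  proof -
    have "{x. r * y x < s * z x} = {x. (- (r *\<^sub>R \<omega>) - s *\<^sub>R \<omega>') \<bullet> x < - ((r *\<^sub>R \<omega> + s *\<^sub>R \<omega>') \<bullet> p)}"
      by (auto simp: y_def z_def inner_diff_left inner_add_left inner_diff_right inner_commute algebra_simps)
    then show ?thesis by (simp only: convex_halfspace_lt)
  qed
  have ypos_conv: "convex {x. y x > 0}"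
    using lin_conv[of "-1" 0] by simp
  have dich: "G A \<subseteq> D \<or> G A \<inter> D = {}" if A: "convex A" "\<And>x. x \<in> A \<Longrightarrow> y x > 0 \<Longrightarrow> z x \<noteq> c1 * y x \<and> z x \<noteq> c2 * y x" for A
  proof (rule ccontr)
    assume n: "\<not> ?thesis"
    have "connected (G A)" unfolding G_def by (intro convex_connected convex_Int convex_ball ypos_conv A(1))
    then have "G A \<inter> frontier D \<noteq> {}" using n by (intro connected_Int_frontier) auto
    then obtain x where "x \<in> G A" "x \<in> frontier D" by auto
    then show False using near[of x] A(2)[of x] yp by (auto simp: G_def)
  qed
  have cy: "c1 * y x < c2 * y x" if "y x > 0" for x using c(1) that by (rule mult_strict_right_mono)
  let ?A1 = "{x. z x < c1 * y x}" and ?A2 = "{x. c1 * y x < z x} \<inter> {x. z x < c2 * y x}" and ?A3 = "{x. c2 * y x < z x}"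
  have conv: "convex ?A1" "convex ?A2" "convex ?A3"
    using lin_conv[of "-c1" "-1"] lin_conv[of c1 1] lin_conv[of "-c2" "-1"] lin_conv[of c2 1] by (auto intro: convex_Int)
  \<comment> \<open>If the piece lay in \<open>D\<close>, its points close to \<open>q\<close>, on
    the supporting line at distance \<epsilon>0 / 2 from \<open>p\<close>, would make
    \<open>q\<close> a second frontier point on that line.\<close>
  have notD: "G A \<inter> D = {}" if A: "G A \<subseteq> D \<or> G A \<inter> D = {}" and s: "\<bar>s\<bar> = \<epsilon>0 / 2"
    and lim: "\<And>x. z x = s \<Longrightarrow> 0 < y x \<Longrightarrow> y x < \<eta> \<Longrightarrow> x \<in> A" and \<eta>: "\<eta> > 0" for A s \<eta>
  proof (rule ccontr)
    assume "G A \<inter> D \<noteq> {}"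
    then have GD: "G A \<subseteq> D" using A by blast
    define q where "q = p + s *\<^sub>R \<omega>'"
    have yq: "y q = 0" "z q = s" by (simp_all add: q_def y_move yp)
    have qp: "q \<noteq> p" using yq(2) yp(2) s \<epsilon>0(1) by auto
    have "q \<in> closure D"
      unfolding closure_approachable
    proof (intro allI impI)
      fix e :: real assume e: "e > 0"
      define t where "t = min (min (e / 2) (\<epsilon>0 / 4)) (\<eta> / 2)"
      have t: "t > 0" "t < e" "t \<le> \<epsilon>0 / 4" "t < \<eta>" using e \<epsilon>0 \<eta> by (auto simp: t_def)
      define x where "x = q + (- t) *\<^sub>R \<omega>"
      have yx: "y x = t" "z x = s" unfolding x_def y_move yq by simp_all
      have dx: "dist x q = t" using t \<omega> by (simp add: x_def dist_norm)
      have dq: "dist q p = \<epsilon>0 / 2" using s \<omega>' by (simp add: q_def dist_norm)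
      have "dist x p \<le> t + \<epsilon>0 / 2" using dist_triangle[of x p q] dx dq by linarith
      then have "x \<in> ball p \<epsilon>0" using t \<epsilon>0(1) by (simp add: dist_commute)
      then have "x \<in> G A" using lim[of x] yx t by (auto simp: G_def)
      then show "\<exists>x\<in>D. dist x q < e" using GD dx t by blast
    qed
    moreover have "q \<notin> D" using Dy[of q] yq by auto
    ultimately have "q \<in> frontier D" using top(1) by (simp add: frontier_def interior_open)
    then show False using fry[OF _ qp] yq by simp
  qed
  have G1: "G ?A1 \<inter> D = {}"
  \<comment> \<open>At offset -\<epsilon>0 / 2, depths below this bound keep |c1 y| under
    \<epsilon>0 / 2, so the point is beyond the first ray.\<close>
  proof (rule notD[where s="- \<epsilon>0 / 2" and \<eta>="\<epsilon>0 / (2 * (\<bar>c1\<bar> + 1))"])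
    show "G ?A1 \<subseteq> D \<or> G ?A1 \<inter> D = {}" using cy by (intro dich conv) fastforce+
    fix x assume x: "z x = - \<epsilon>0 / 2" "0 < y x" "y x < \<epsilon>0 / (2 * (\<bar>c1\<bar> + 1))"
    have "- (c1 * y x) \<le> \<bar>c1\<bar> * y x" using x(2) mult_right_mono[of "- c1" "\<bar>c1\<bar>" "y x"] by simp
    also have "\<dots> \<le> (\<bar>c1\<bar> + 1) * y x" using x(2) by (simp add: algebra_simps)
    also have "\<dots> < \<epsilon>0 / 2" using x(3) by (simp add: field_simps)
    finally show "x \<in> ?A1" using x(1) by simp
  qed (use \<epsilon>0 in \<open>auto intro!: divide_pos_pos\<close>)
  have G3: "G ?A3 \<inter> D = {}"
  proof (rule notD[where s="\<epsilon>0 / 2" and \<eta>="\<epsilon>0 / (2 * (\<bar>c2\<bar> + 1))"])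
    show "G ?A3 \<subseteq> D \<or> G ?A3 \<inter> D = {}" using cy by (intro dich conv) fastforce+
    fix x assume x: "z x = \<epsilon>0 / 2" "0 < y x" "y x < \<epsilon>0 / (2 * (\<bar>c2\<bar> + 1))"
    have "c2 * y x \<le> \<bar>c2\<bar> * y x" using x(2) by (intro mult_right_mono) auto
    also have "\<dots> \<le> (\<bar>c2\<bar> + 1) * y x" using x(2) by (simp add: algebra_simps)
    also have "\<dots> < \<epsilon>0 / 2" using x(3) by (simp add: field_simps)
    finally show "x \<in> ?A3" using x(1) by simp
  qed (use \<epsilon>0 in \<open>auto intro!: divide_pos_pos\<close>)
  have inner: "c1 * y x \<le> z x \<and> z x \<le> c2 * y x" if "x \<in> D" "x \<in> ball p \<epsilon>0" for x
  proof -
    have "x \<notin> G ?A1" "x \<notin> G ?A3" using G1 G3 that(1) by auto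
    then show ?thesis using that(2) Dy[OF that(1)] by (auto simp: G_def)
  qed
  \<comment> \<open>Otherwise \<open>D\<close> near \<open>p\<close> would lie on the two rays,
    although it is open and accumulates at \<open>p\<close>.\<close>
  have G2: "G ?A2 \<subseteq> D"
  proof (rule ccontr)
    assume "\<not> G ?A2 \<subseteq> D"
    then have G2: "G ?A2 \<inter> D = {}" using dich[of ?A2] conv by auto
    have "p \<in> closure D" using p(1) by (simp add: frontier_def)
    then obtain x where x: "x \<in> D" "x \<in> ball p \<epsilon>0" using \<epsilon>0(1) by (auto simp: closure_approachable dist_commute)
    have "open (D \<inter> ball p \<epsilon>0)" using top(1) by auto
    then obtain e where e: "e > 0" "ball x e \<subseteq> D \<inter> ball p \<epsilon>0" using x by (meson IntI open_contains_ball)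
    have yx: "y x > 0" using Dy x by auto
    \<comment> \<open>Less than the gap between the rays at this depth: from a point on one ray the
      shift leads strictly between the rays or beyond the second one.\<close>
    define t where "t = min (e / 2) ((c2 - c1) * y x / 2)"
    have t: "t > 0" "t < e" "t < (c2 - c1) * y x" using e c yx by (auto simp: t_def min_less_iff_disj)
    define x' where "x' = x + t *\<^sub>R \<omega>'"
    have x': "x' \<in> D" "x' \<in> ball p \<epsilon>0" using e(2) t \<omega>' by (auto simp: x'_def dist_norm subset_iff)
    have yx': "y x' = y x" "z x' = z x + t" unfolding x'_def y_move by simp_all
    have nx: "\<not> (c1 * y x < z x \<and> z x < c2 * y x)" using G2 x yx by (auto simp: G_def)
    have nx': "\<not> (c1 * y x < z x + t \<and> z x + t < c2 * y x)" using G2 x' yx yx' by (auto simp: G_def)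
    show False using nx nx' inner[OF x] inner[OF x'] t unfolding yx' by (auto simp: algebra_simps)
  qed
  show thesis
  proof (rule that[OF pps _ c(1)])
    show "p \<bullet> \<omega> = support_fun D \<omega>" using p(2) by (simp add: h_def)
    show "0 < (p - x) \<bullet> \<omega>" if "x \<in> D" for x using Dy[OF that] by (simp add: y_def)
    show "corner D p \<omega> \<omega>' c1 c2"
      unfolding corner_def
    proof (intro allI impI)
    fix \<epsilon> :: real assume "\<epsilon> > 0"
    define \<epsilon>1 where "\<epsilon>1 = min \<epsilon> \<epsilon>0"
    have \<epsilon>1: "\<epsilon>1 > 0" "\<epsilon>1 \<le> \<epsilon>" "\<epsilon>1 \<le> \<epsilon>0" using \<open>\<epsilon> > 0\<close> \<epsilon>0 by (auto simp: \<epsilon>1_def)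
    \<comment> \<open>Compactness turns the uniqueness of the contact point into a uniform gap:
      small depth forces closeness to \<open>p\<close>.\<close>
    have "\<exists>d>0. \<forall>x\<in>closure D - ball p \<epsilon>1. d \<le> y x"
    proof (cases "closure D - ball p \<epsilon>1 = {}")
      case False
      have "compact (closure D - ball p \<epsilon>1)"
        using top(2) by (intro compact_diff) (auto simp: compact_closure)
      then obtain x0 where x0: "x0 \<in> closure D - ball p \<epsilon>1" "\<And>x. x \<in> closure D - ball p \<epsilon>1 \<Longrightarrow> y x0 \<le> y x"
        using continuous_attains_inf[OF _ False continuous_on_subset[OF cont(1)]] by blast
      have "x0 \<noteq> p" using x0(1) \<epsilon>1(1) by auto
      then have "y x0 > 0" using x0(1) Dy fry closure_Un_frontier[of D] by auto
      then show ?thesis using x0(2) by blast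
    qed (auto intro: exI[of _ 1])
    then obtain d where d: "d > 0" "\<And>x. x \<in> closure D \<Longrightarrow> x \<notin> ball p \<epsilon>1 \<Longrightarrow> d \<le> y x" by auto
    define cc where "cc = max \<bar>c1\<bar> \<bar>c2\<bar>"
    have cc: "cc \<ge> 0" "\<bar>c1\<bar> \<le> cc" "\<bar>c2\<bar> \<le> cc" by (auto simp: cc_def)
    \<comment> \<open>Between the rays the distance to \<open>p\<close> is at most 1 + cc times the
      depth, so this truncation stays inside the ball.\<close>
    define \<delta> where "\<delta> = min d (\<epsilon>1 / (1 + cc))"
    have \<delta>: "\<delta> > 0" "\<delta> \<le> d" "\<delta> \<le> \<epsilon>1 / (1 + cc)" using d \<epsilon>1 cc by (auto simp: \<delta>_def intro!: divide_pos_pos)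
    have tri: "x \<in> D \<and> x \<in> ball p \<epsilon>" if x: "0 < y x" "y x < \<delta>" "c1 * y x < z x" "z x < c2 * y x" for x
    proof -
      have "\<bar>z x\<bar> \<le> cc * y x"
      proof -
        have "- (cc * y x) \<le> c1 * y x" using mult_right_mono[of "- cc" c1 "y x"] cc x(1) by simp
        moreover have "c2 * y x \<le> cc * y x" using mult_right_mono[of c2 cc "y x"] cc x(1) by simp
        ultimately show ?thesis using x by linarith
      qed
      moreover have "x - p = - y x *\<^sub>R \<omega> + z x *\<^sub>R \<omega>'"
      proof -
        obtain v :: "real^2" where v: "x - p = v $ 1 *\<^sub>R \<omega> + v $ 2 *\<^sub>R \<omega>'"
          using surjD[OF orthogonal_transformation_surj[OF fr.orthogonal_frame], of "x - p"] by blast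
        have "y x = - ((x - p) \<bullet> \<omega>)" by (simp add: y_def inner_diff_left)
        then have "y x = - v $ 1" "z x = v $ 2" unfolding z_def v by (simp_all add: inner_add_left)
        then show ?thesis using v by simp
      qed
      then have "norm (x - p) \<le> norm (- y x *\<^sub>R \<omega>) + norm (z x *\<^sub>R \<omega>')" by (metis norm_triangle_ineq)
      then have "norm (x - p) \<le> y x + \<bar>z x\<bar>" using \<omega> \<omega>' x(1) by simp
      ultimately have "norm (x - p) \<le> (1 + cc) * y x" by (simp add: algebra_simps)
      also have "\<dots> < (1 + cc) * (\<epsilon>1 / (1 + cc))" using x(2) \<delta>(3) cc by (intro mult_strict_left_mono) auto
      also have "\<dots> = \<epsilon>1" using cc by simp
      finally have "x \<in> ball p \<epsilon>1" by (simp add: dist_norm norm_minus_commute)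
      then show ?thesis using G2 x \<epsilon>1 by (auto simp: G_def subset_iff)
    qed
    have "c1 * y x \<le> z x \<and> z x \<le> c2 * y x" if x: "x \<in> D" "y x < \<delta>" for x
    proof -
      have "x \<in> ball p \<epsilon>1" using d(2)[of x] x \<delta>(2) closure_subset by fastforce
      then show ?thesis using inner[OF x(1)] \<epsilon>1 by auto
    qed
    with tri \<delta>(1) show "\<exists>\<delta>>0.
       (\<forall>x. 0 < (p - x) \<bullet> \<omega> \<and> (p - x) \<bullet> \<omega> < \<delta> \<and> c1 * ((p - x) \<bullet> \<omega>) < (x - p) \<bullet> \<omega>' \<and> (x - p) \<bullet> \<omega>' < c2 * ((p - x) \<bullet> \<omega>) \<longrightarrow>
            x \<in> D \<and> x \<in> ball p \<epsilon>) \<and>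
       (\<forall>x\<in>D. (p - x) \<bullet> \<omega> < \<delta> \<longrightarrow> c1 * ((p - x) \<bullet> \<omega>) \<le> (x - p) \<bullet> \<omega>' \<and> (x - p) \<bullet> \<omega>' \<le> c2 * ((p - x) \<bullet> \<omega>))"
      unfolding y_def z_def by (intro exI[of _ \<delta>]) blast
    qed
  qed
qed


section \<open>Asymptotics of the integral over the corner\<close>

lemma integral_FTC_open:
  fixes f F :: "real \<Rightarrow> 'a :: euclidean_space"
  assumes "a \<le> b" "\<And>x. (F has_vector_derivative f x) (at x)" "continuous_on UNIV f"
  shows "(LINT t|lborel. indicator {a<..<b} t *\<^sub>R f t) = F b - F a"
proof -
  have [measurable]: "f \<in> borel_measurable borel" using assms(3) by (rule borel_measurable_continuous_onI)
  have "has_bochner_integral lborel (\<lambda>x. indicator {a..b} x *\<^sub>R f x) (F b - F a)"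
    using assms by (intro has_bochner_integral_FTC_Icc)
      (auto intro: has_vector_derivative_at_within continuous_on_subset)
  then have "(LINT t|lborel. indicator {a..b} t *\<^sub>R f t) = F b - F a" by (rule has_bochner_integral_integral_eq)
  moreover have "(LINT t|lborel. indicator {a<..<b} t *\<^sub>R f t) = (LINT t|lborel. indicator {a..b} t *\<^sub>R f t)"
  proof (rule integral_cong_AE)
    show "AE t in lborel. indicator {a<..<b} t *\<^sub>R f t = indicator {a..b} t *\<^sub>R f t"
      using AE_lborel_singleton[of a] AE_lborel_singleton[of b] by eventually_elim (auto simp: indicator_def)
  qed measurable
  ultimately show ?thesis by simp
qed

lemma exp_linear_vector_derivative:
  fixes a b :: complex
  assumes "a \<noteq> 0"
  shows "((\<lambda>t. exp (b + a * of_real t) / a) has_vector_derivative exp (b + a * of_real t)) (at t)"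
proof -
  have "((\<lambda>z. exp (b + a * z) / a) has_field_derivative exp (b + a * of_real t)) (at (of_real t))"
    using assms by (auto intro!: derivative_eq_intros)
  from has_vector_derivative_real_field[OF this] show ?thesis .
qed

section \<open>Integrals of exponentials over a triangle\<close>

context frame
begin

lemma integral_fr:
  fixes f :: "real^2 \<Rightarrow> 'a :: {banach, second_countable_topology}"
  assumes f: "integrable lborel f"
  shows "(LINT x|lborel. f x) = (LINT s|lborel. (LINT t|lborel. f (fr s t)))"
proof -
  have m: "f \<in> borel_measurable borel" using borel_measurable_integrable[OF f] by simp
  have fm: "(\<lambda>p. fr (fst p) (snd p)) \<in> measurable lborel borel" using fr_measurable by simp
  have "integrable (distr lborel borel (\<lambda>p. fr (fst p) (snd p))) f" unfolding distr_fr by (rule f)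
  then have i: "integrable (lborel \<Otimes>\<^sub>M lborel) (\<lambda>p. f (fr (fst p) (snd p)))"
    unfolding lborel_prod using integrable_distr_eq[OF fm m] by simp
  have "(LINT x|lborel. f x) = (LINT p|(lborel \<Otimes>\<^sub>M lborel). f (fr (fst p) (snd p)))"
    unfolding lborel_prod by (subst distr_fr[symmetric]) (rule integral_distr[OF fm m])
  also have "\<dots> = (LINT s|lborel. (LINT t|lborel. f (fr (fst (s, t)) (snd (s, t)))))"
    by (rule lborel_pair.integral_fst'[symmetric]) (rule i)
  finally show ?thesis by simp
qed

text \<open>Truncated at depth \<delta>: for c1 < c2 and \<delta> > 0 an open triangle with apex
  \<open>c\<close>.\<close>

definition sector :: "real \<Rightarrow> real \<Rightarrow> real \<Rightarrow> (real^2) set" where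
  "sector c1 c2 \<delta> = {x. 0 < (x - c) \<bullet> a \<and> (x - c) \<bullet> a < \<delta> \<and> c1 * ((x - c) \<bullet> a) < (x - c) \<bullet> b \<and> (x - c) \<bullet> b < c2 * ((x - c) \<bullet> a)}"

lemma open_sector: "open (sector c1 c2 \<delta>)"
  unfolding sector_def by (intro open_Collect_conj open_Collect_less continuous_intros)

lemma indicator_sector:
  "indicator (sector c1 c2 \<delta>) (fr s t) = (indicator {0<..<\<delta>} s * indicator {c1 * s<..<c2 * s} t :: real)"
  by (auto simp: sector_def indicator_def)

lemma sector_integrable:
  fixes g :: "real^2 \<Rightarrow> 'a :: {banach, second_countable_topology}"
  assumes "sector c1 c2 \<delta> \<subseteq> ball c R" "continuous_on UNIV g"
  shows "integrable lborel (\<lambda>x. indicator (sector c1 c2 \<delta>) x *\<^sub>R g x)"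
proof -
  have [measurable]: "g \<in> borel_measurable borel" "sector c1 c2 \<delta> \<in> sets borel"
    using assms(2) open_sector by (auto intro: borel_measurable_continuous_onI borel_open)
  have "integrable lborel (\<lambda>x. indicator (cball c R) x *\<^sub>R g x)"
    by (rule borel_integrable_compact) (auto intro: continuous_on_subset[OF assms(2)])
  then show ?thesis
    by (rule Bochner_Integration.integrable_bound) (use assms(1) in \<open>auto simp: indicator_def subset_iff intro!: AE_I2\<close>)
qed

text \<open>Integration first across, then in depth. The limits at depth 0 combine to the first term
  because \<open>A c2 - A c1 = w * of_real (c2 - c1)\<close>; this is the contribution of the apex.
  The rest comes from the side at depth \<delta> and is exponentially small.\<close>

lemma sector_integral_exp:
  assumes T: "sector c1 c2 \<delta> \<subseteq> ball c R" and c: "c1 < c2" and \<delta>: "\<delta> > 0" and \<tau>: "\<tau> > 0" and s: "s > 0"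
  shows "(LINT x|lborel. indicator (sector c1 c2 \<delta>) x *\<^sub>R exp (- of_real (\<tau> * ((x - c) \<bullet> a)) + \<i> * of_real (s * ((x - c) \<bullet> b)))) =
    of_real (c2 - c1) / ((\<i> * of_real (s * c1) - of_real \<tau>) * (\<i> * of_real (s * c2) - of_real \<tau>)) +
    (exp ((\<i> * of_real (s * c2) - of_real \<tau>) * of_real \<delta>) / (\<i> * of_real (s * c2) - of_real \<tau>) -
     exp ((\<i> * of_real (s * c1) - of_real \<tau>) * of_real \<delta>) / (\<i> * of_real (s * c1) - of_real \<tau>)) / (\<i> * of_real s)"
proof -
  define E where "E x = exp (- of_real (\<tau> * ((x - c) \<bullet> a)) + \<i> * of_real (s * ((x - c) \<bullet> b)))" for x
  define w where "w = \<i> * complex_of_real s"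
  define A where "A c = \<i> * of_real (s * c) - of_real \<tau>" for c :: real
  have w0: "w \<noteq> 0" using s by (simp add: w_def)
  have "Re (A c) = - \<tau>" for c by (simp add: A_def)
  then have A0: "A c \<noteq> 0" for c using \<tau> by (metis neg_equal_0_iff_equal order_less_irrefl zero_complex.sel(1))
  have cE: "continuous_on UNIV E" unfolding E_def by (intro continuous_intros)
  \<comment> \<open>The summand 0 fits the shape \<open>exp (b + a * of_real t)\<close> of the
    antiderivative used below.\<close>
  have inner: "(LINT z|lborel. indicator (sector c1 c2 \<delta>) (fr y z) *\<^sub>R E (fr y z)) =
      indicator {0<..<\<delta>} y *\<^sub>R ((exp (0 + A c2 * of_real y) - exp (0 + A c1 * of_real y)) / w)" for y
  proof (cases "y \<in> {0<..<\<delta>}")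
    case True
    have "(LINT z|lborel. indicator (sector c1 c2 \<delta>) (fr y z) *\<^sub>R E (fr y z)) =
      (LINT z|lborel. indicator {c1 * y<..<c2 * y} z *\<^sub>R exp (- of_real (\<tau> * y) + w * of_real z))"
      using True by (simp add: indicator_sector E_def w_def mult.assoc)
    also have "\<dots> = exp (- of_real (\<tau> * y) + w * of_real (c2 * y)) / w - exp (- of_real (\<tau> * y) + w * of_real (c1 * y)) / w"
      using True c by (intro integral_FTC_open exp_linear_vector_derivative w0 continuous_intros) (auto intro: mult_right_mono)
    also have "- of_real (\<tau> * y) + w * of_real (c2 * y) = 0 + A c2 * of_real y" by (simp add: w_def A_def algebra_simps)
    also have "- of_real (\<tau> * y) + w * of_real (c1 * y) = 0 + A c1 * of_real y" by (simp add: w_def A_def algebra_simps)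
    finally show ?thesis using True by (simp add: diff_divide_distrib)
  qed (simp add: indicator_sector)
  have "(LINT x|lborel. indicator (sector c1 c2 \<delta>) x *\<^sub>R E x) =
      (LINT y|lborel. (LINT z|lborel. indicator (sector c1 c2 \<delta>) (fr y z) *\<^sub>R E (fr y z)))"
    by (rule integral_fr[OF sector_integrable[OF T cE]])
  also have "\<dots> = (LINT y|lborel. indicator {0<..<\<delta>} y *\<^sub>R ((exp (0 + A c2 * of_real y) - exp (0 + A c1 * of_real y)) / w))"
    by (simp only: inner)
  also have "\<dots> = (exp (0 + A c2 * of_real \<delta>) / A c2 - exp (0 + A c1 * of_real \<delta>) / A c1) / w -
      (exp (0 + A c2 * of_real 0) / A c2 - exp (0 + A c1 * of_real 0) / A c1) / w"
  proof (rule integral_FTC_open)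
    show "((\<lambda>y. (exp (0 + A c2 * of_real y) / A c2 - exp (0 + A c1 * of_real y) / A c1) / w) has_vector_derivative
        (exp (0 + A c2 * of_real y) - exp (0 + A c1 * of_real y)) / w) (at y)" for y
      unfolding divide_inverse[of _ w]
      by (intro has_vector_derivative_mult_left has_vector_derivative_diff exp_linear_vector_derivative A0)
    show "continuous_on UNIV (\<lambda>y. (exp (0 + A c2 * of_real y) - exp (0 + A c1 * of_real y)) / w)"
      using w0 by (intro continuous_intros) auto
  qed (use \<delta> in auto)
  also have "\<dots> = (1 / A c1 - 1 / A c2) / w + (exp (A c2 * of_real \<delta>) / A c2 - exp (A c1 * of_real \<delta>) / A c1) / w"
    by (simp add: diff_divide_distrib)
  also have "(1 / A c1 - 1 / A c2) / w = of_real (c2 - c1) / (A c1 * A c2)"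
  proof -
    have "A c2 - A c1 = w * of_real (c2 - c1)" by (simp add: A_def w_def algebra_simps)
    then show ?thesis using A0[of c1] A0[of c2] w0 by (simp add: diff_frac_eq)
  qed
  finally show ?thesis by (simp add: E_def A_def w_def)
qed

text \<open>The slice at depth y has width (c2 - c1) y, and y exp (-\<tau> y) integrates to at most
  1/\<tau>^2. Taking moduli thus loses only a constant against the apex term of the oscillatory
  integral.\<close>

lemma sector_integral_decay:
  assumes T: "sector c1 c2 \<delta> \<subseteq> ball c R" and c: "c1 < c2" and \<delta>: "\<delta> > 0" and \<tau>: "\<tau> > 0"
  shows "(LINT x|lborel. indicator (sector c1 c2 \<delta>) x * exp (- (\<tau> * ((x - c) \<bullet> a)))) \<le> (c2 - c1) / \<tau>\<^sup>2"
proof -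
  define E where "E x = exp (- (\<tau> * ((x - c) \<bullet> a)))" for x
  have cE: "continuous_on UNIV E" unfolding E_def by (intro continuous_intros)
  have inner: "(LINT z|lborel. indicator (sector c1 c2 \<delta>) (fr y z) *\<^sub>R E (fr y z)) =
      indicator {0<..<\<delta>} y *\<^sub>R ((c2 - c1) * (y * exp (- (\<tau> * y))))" for y
  proof (cases "y \<in> {0<..<\<delta>}")
    case True
    have "(LINT z|lborel. indicator (sector c1 c2 \<delta>) (fr y z) *\<^sub>R E (fr y z)) =
      (LINT z|lborel. indicator {c1 * y<..<c2 * y} z *\<^sub>R exp (- (\<tau> * y)))"
      using True by (simp add: indicator_sector E_def)
    also have "\<dots> = (c2 * y) * exp (- (\<tau> * y)) - (c1 * y) * exp (- (\<tau> * y))"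
    proof (rule integral_FTC_open)
      show "((\<lambda>z. z * exp (- (\<tau> * y))) has_vector_derivative exp (- (\<tau> * y))) (at z)" for z
        by (auto intro!: derivative_eq_intros simp: has_real_derivative_iff_has_vector_derivative[symmetric])
    qed (use True c in \<open>auto intro: mult_right_mono\<close>)
    finally show ?thesis using True by (simp add: algebra_simps)
  qed (simp add: indicator_sector)
  have "(LINT x|lborel. indicator (sector c1 c2 \<delta>) x *\<^sub>R E x) =
      (LINT y|lborel. (LINT z|lborel. indicator (sector c1 c2 \<delta>) (fr y z) *\<^sub>R E (fr y z)))"
    by (rule integral_fr[OF sector_integrable[OF T cE]])
  also have "\<dots> = (LINT y|lborel. indicator {0<..<\<delta>} y *\<^sub>R ((c2 - c1) * (y * exp (- (\<tau> * y)))))"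
    by (simp only: inner)
  also have "\<dots> = (c2 - c1) * (- (\<delta> / \<tau> + 1 / \<tau>\<^sup>2) * exp (- (\<tau> * \<delta>))) - (c2 - c1) * (- (0 / \<tau> + 1 / \<tau>\<^sup>2) * exp (- (\<tau> * 0)))"
  proof (rule integral_FTC_open)
    show "((\<lambda>y. (c2 - c1) * (- (y / \<tau> + 1 / \<tau>\<^sup>2) * exp (- (\<tau> * y)))) has_vector_derivative (c2 - c1) * (y * exp (- (\<tau> * y)))) (at y)" for y
      unfolding has_real_derivative_iff_has_vector_derivative[symmetric]
      using \<tau> by (auto intro!: derivative_eq_intros simp: field_simps power2_eq_square)
  qed (use \<delta> in \<open>auto intro!: continuous_intros\<close>)
  also have "\<dots> = (c2 - c1) * (1 / \<tau>\<^sup>2 - (\<delta> / \<tau> + 1 / \<tau>\<^sup>2) * exp (- (\<tau> * \<delta>)))" by (simp add: algebra_simps)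
  also have "\<dots> \<le> (c2 - c1) * (1 / \<tau>\<^sup>2)" using c \<delta> \<tau> by (intro mult_left_mono) auto
  finally show ?thesis by (simp add: E_def)
qed

end

text \<open>Only the lower bound is delicate: a constant upper bound is good enough once the
  logarithm is divided by \<tau>. \<open>D\<close> is split into the triangle and the points of
  depth at least \<delta>, and on the triangle the source into its value at \<open>p\<close> and the
  deviation from it.\<close>

lemma corner_integral_bounds:
  fixes \<rho> \<rho>' :: "real^2 \<Rightarrow> complex"
  assumes D: "open D" "bounded D" and \<rho>: "\<rho> \<in> L2 (lebesgue_on D)"
    and \<omega>: "norm \<omega> = 1" "norm \<omega>' = 1" "\<omega> \<bullet> \<omega>' = 0" and c: "c1 < c2"
    and pos: "\<And>x. x \<in> D \<Longrightarrow> 0 < (p - x) \<bullet> \<omega>"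
    and corner: "corner D p \<omega> \<omega>' c1 c2"
    and \<eta>: "\<eta> > 0" and \<alpha>: "\<alpha> > 0" and holder: "holder_on (cball p \<eta>) \<alpha> \<rho>'"
    and eq: "AE x in lebesgue. x \<in> ball p \<eta> \<inter> closure D \<longrightarrow> \<rho> x = \<rho>' x" and nz: "\<rho>' p \<noteq> 0"
  obtains A B where "A > 0" "B > 0"
    "\<forall>\<^sub>F \<tau> in at_top.
      A / \<tau>\<^sup>2 \<le> cmod (LINT x|lebesgue_on D. \<rho> x * exp (- of_real (\<tau> * ((p - x) \<bullet> \<omega>)) + \<i> * of_real (sqrt (\<tau>\<^sup>2 + k\<^sup>2) * ((x - p) \<bullet> \<omega>')))) \<and>
      cmod (LINT x|lebesgue_on D. \<rho> x * exp (- of_real (\<tau> * ((p - x) \<bullet> \<omega>)) + \<i> * of_real (sqrt (\<tau>\<^sup>2 + k\<^sup>2) * ((x - p) \<bullet> \<omega>')))) \<le> B"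
proof -
  \<comment> \<open>With first axis \<open>- \<omega>\<close> the first coordinate is the depth
    below the supporting line.\<close>
  interpret fr: frame p "- \<omega>" \<omega>' using \<omega> by unfold_locales auto
  have ya: "(x - p) \<bullet> (- \<omega>) = (p - x) \<bullet> \<omega>" for x by (simp add: inner_diff_left)
  define y where "y x = (p - x) \<bullet> \<omega>" for x
  define z where "z x = (x - p) \<bullet> \<omega>'" for x
  define S where "S \<tau> = sqrt (\<tau>\<^sup>2 + k\<^sup>2)" for \<tau>
  define E where "E \<tau> x = exp (- of_real (\<tau> * y x) + \<i> * of_real (S \<tau> * z x))" for \<tau> x
  have yc: "continuous_on UNIV y" and zc: "continuous_on UNIV z"
    unfolding y_def[abs_def] z_def[abs_def] by (intro continuous_intros)+
  have Ec: "continuous_on UNIV (E \<tau>)" for \<tau> unfolding E_def by (intro continuous_intros yc zc)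
  have Em[measurable]: "E \<tau> \<in> borel_measurable lebesgue" for \<tau>
    using Ec by (intro measurable_completion) (simp add: borel_measurable_continuous_onI)
  have Enorm: "cmod (E \<tau> x) = exp (- (\<tau> * y x))" for \<tau> x by (simp add: E_def)
  have Ds: "D \<inter> space lebesgue \<in> sets lebesgue" using D(1) by (simp add: borel_open)
  have Ds'[measurable]: "D \<in> sets lebesgue" using Ds by simp
  define g where "g x = indicator D x *\<^sub>R \<rho> x" for x
  have gi: "integrable lebesgue g"
  proof -
    have fin: "finite_measure (lebesgue_on D)"
      using bounded_set_imp_lmeasurable[OF D(2)] Ds' by (intro finite_measure_lebesgue_on) auto
    have "(\<lambda>x. 1 :: complex) \<in> L2 (lebesgue_on D)"
      using finite_measure.integrable_const[OF fin, of "1::real"] by (simp add: L2_def)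
    from L2_mult_integrable[OF \<rho> this] have "integrable (lebesgue_on D) \<rho>" by simp
    then show ?thesis unfolding g_def using integrable_restrict_space[OF Ds, of \<rho>] by simp
  qed
  have gm[measurable]: "g \<in> borel_measurable lebesgue" using gi by (rule borel_measurable_integrable)
  define B where "B = (LINT x|lebesgue. cmod (g x))"
  have B0: "B \<ge> 0" unfolding B_def by (intro integral_nonneg_AE) auto
  have IE: "(LINT x|lebesgue_on D. \<rho> x * E \<tau> x) = (LINT x|lebesgue. g x * E \<tau> x)" for \<tau>
    by (simp add: integral_restrict_space[OF Ds] g_def)
  have bound_int: "integrable lebesgue (\<lambda>x. (indicator U x *\<^sub>R g x) * E \<tau> x)"
    "cmod (LINT x|lebesgue. (indicator U x *\<^sub>R g x) * E \<tau> x) \<le> exp (- (\<tau> * d)) * B"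
    if U: "U \<in> sets lebesgue" "\<And>x. x \<in> U \<Longrightarrow> x \<in> D \<Longrightarrow> d \<le> y x" and \<tau>: "\<tau> > 0" for U \<tau> d
  proof -
    have le: "norm ((indicator U x *\<^sub>R g x) * E \<tau> x) \<le> exp (- (\<tau> * d)) * cmod (g x)" for x
    proof (cases "x \<in> U \<and> x \<in> D")
      case True
      have "exp (- (\<tau> * y x)) \<le> exp (- (\<tau> * d))" using U(2) True \<tau> by simp
      then have "cmod (g x) * exp (- (\<tau> * y x)) \<le> cmod (g x) * exp (- (\<tau> * d))" by (rule mult_left_mono) simp
      then show ?thesis using True by (simp add: norm_mult Enorm mult.commute)
    qed (auto simp: g_def indicator_def)
    have i: "integrable lebesgue (\<lambda>x. exp (- (\<tau> * d)) * cmod (g x))" using gi by (intro integrable_mult_right integrable_norm)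
    have m: "(\<lambda>x. (indicator U x *\<^sub>R g x) * E \<tau> x) \<in> borel_measurable lebesgue" using U(1) by measurable
    show 1: "integrable lebesgue (\<lambda>x. (indicator U x *\<^sub>R g x) * E \<tau> x)"
      by (rule Bochner_Integration.integrable_bound[OF i m]) (use le in \<open>auto intro: order_trans[OF _ abs_ge_self]\<close>)
    have "cmod (LINT x|lebesgue. (indicator U x *\<^sub>R g x) * E \<tau> x) \<le> (LINT x|lebesgue. norm ((indicator U x *\<^sub>R g x) * E \<tau> x))"
      by (rule integral_norm_bound)
    also have "\<dots> \<le> (LINT x|lebesgue. exp (- (\<tau> * d)) * cmod (g x))"
      using integrable_norm[OF 1] i le by (intro integral_mono) auto
    finally show "cmod (LINT x|lebesgue. (indicator U x *\<^sub>R g x) * E \<tau> x) \<le> exp (- (\<tau> * d)) * B" by (simp add: B_def)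
  qed
  \<comment> \<open>For \<tau> \<ge> |k| the frequency \<open>S \<tau>\<close> is at most 2 \<tau>,
    so the denominator of the apex term has modulus at most
    \<open>K * \<tau>\<^sup>2\<close>.\<close>
  define K where "K = (1 + 2 * \<bar>c1\<bar>) * (1 + 2 * \<bar>c2\<bar>)"
  have K: "K > 0" unfolding K_def by (intro mult_pos_pos) auto
  define r where "r = \<rho>' p"
  have r: "cmod r > 0" using nz by (simp add: r_def)
  \<comment> \<open>Chosen so that the deviation of the source costs at most half of the lower bound
    for the apex term.\<close>
  define \<kappa> where "\<kappa> = cmod r / (2 * K)"
  have \<kappa>: "\<kappa> > 0" using r K by (simp add: \<kappa>_def)
  obtain \<epsilon> where \<epsilon>: "\<epsilon> > 0" "\<epsilon> \<le> \<eta>" "\<And>x. x \<in> ball p \<epsilon> \<Longrightarrow> cmod (\<rho>' x - r) \<le> \<kappa>"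
  proof -
    obtain C where C: "\<And>x x'. x \<in> cball p \<eta> \<Longrightarrow> x' \<in> cball p \<eta> \<Longrightarrow> cmod (\<rho>' x - \<rho>' x') \<le> C * dist x x' powr \<alpha>"
      using holder unfolding holder_on_def by blast
    define C' where "C' = \<bar>C\<bar> + 1"
    have C': "C' > 0" "C \<le> C'" by (auto simp: C'_def)
    \<comment> \<open>The second entry solves C' e^\<alpha> = \<kappa>; passing from
      \<open>C\<close> to \<open>C'\<close> ensures a positive constant.\<close>
    define e where "e = min \<eta> ((\<kappa> / C') powr (1 / \<alpha>))"
    have e: "e > 0" "e \<le> \<eta>" using \<eta> \<kappa> C' by (auto simp: e_def)
    have "cmod (\<rho>' x - r) \<le> \<kappa>" if x: "x \<in> ball p e" for x
    proof -
      have "cmod (\<rho>' x - r) \<le> C * dist x p powr \<alpha>" unfolding r_def using x e \<eta> by (intro C) auto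
      also have "\<dots> \<le> C' * dist x p powr \<alpha>" using C' by (intro mult_right_mono) auto
      also have "dist x p powr \<alpha> \<le> ((\<kappa> / C') powr (1 / \<alpha>)) powr \<alpha>"
        using x \<alpha> by (intro powr_mono2) (auto simp: e_def dist_commute)
      also have "\<dots> = \<kappa> / C'" using \<alpha> \<kappa> C' by (simp add: powr_powr)
      finally show ?thesis using C' by simp
    qed
    with e show thesis by (rule that)
  qed
  obtain \<delta> where \<delta>: "\<delta> > 0"
    "\<And>x. 0 < y x \<Longrightarrow> y x < \<delta> \<Longrightarrow> c1 * y x < z x \<Longrightarrow> z x < c2 * y x \<Longrightarrow> x \<in> D \<and> x \<in> ball p \<epsilon>"
    "\<And>x. x \<in> D \<Longrightarrow> y x < \<delta> \<Longrightarrow> c1 * y x \<le> z x \<and> z x \<le> c2 * y x"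
    using corner[unfolded corner_def, THEN spec, THEN mp, OF \<epsilon>(1)] unfolding y_def z_def by blast
  define T where "T = fr.sector c1 c2 \<delta>"
  have Tdef: "x \<in> T \<longleftrightarrow> 0 < y x \<and> y x < \<delta> \<and> c1 * y x < z x \<and> z x < c2 * y x" for x
    by (simp only: T_def fr.sector_def ya y_def z_def mem_Collect_eq)
  have TD: "T \<subseteq> D" "T \<subseteq> ball p \<epsilon>" using \<delta>(2) Tdef by auto
  have oT: "open T" unfolding T_def by (rule fr.open_sector)
  have Tb[measurable]: "T \<in> sets borel" using oT by (rule borel_open)
  have Tl[measurable]: "T \<in> sets lebesgue" using oT by (simp add: borel_open)
  define U where "U = {x. \<delta> \<le> y x}"
  have "closed U" unfolding U_def by (intro closed_Collect_le continuous_intros yc)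
  then have Ul[measurable]: "U \<in> sets lebesgue" by (simp add: borel_closed)
  \<comment> \<open>\<open>corner\<close> places points of \<open>D\<close> between the rays only in
    the weak sense; those on the rays form a null set.\<close>
  have ray: "negligible {x. z x = d * y x}" for d
  proof -
    have ne: "\<omega>' + d *\<^sub>R \<omega> \<noteq> 0"
    proof
      assume "\<omega>' + d *\<^sub>R \<omega> = 0"
      then have "(\<omega>' + d *\<^sub>R \<omega>) \<bullet> \<omega>' = 0" by simp
      then show False using \<omega> by (simp add: inner_add_left norm_eq_1)
    qed
    have "{x. z x = d * y x} = {x. (\<omega>' + d *\<^sub>R \<omega>) \<bullet> x = (\<omega>' + d *\<^sub>R \<omega>) \<bullet> p}"
      by (auto simp: y_def z_def inner_diff_left inner_add_left inner_commute algebra_simps)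
    then show ?thesis using ne by (simp add: negligible_hyperplane)
  qed
  have rayAE: "AE x in lebesgue. z x \<noteq> d * y x" for d
  proof -
    have "{x. z x = d * y x} \<in> null_sets lebesgue" using ray negligible_iff_null_sets by blast
    from AE_not_in[OF this] show ?thesis by simp
  qed
  have splitAE: "AE x in lebesgue. g x * E \<tau> x = (indicator T x *\<^sub>R g x) * E \<tau> x + (indicator U x *\<^sub>R g x) * E \<tau> x" for \<tau>
    using rayAE[of c1] rayAE[of c2]
  proof eventually_elim
    fix x assume n: "z x \<noteq> c1 * y x" "z x \<noteq> c2 * y x"
    show "g x * E \<tau> x = (indicator T x *\<^sub>R g x) * E \<tau> x + (indicator U x *\<^sub>R g x) * E \<tau> x"
    proof (cases "x \<in> D")
      case True
      have "x \<in> T \<longleftrightarrow> x \<notin> U" using \<delta>(3)[OF True] n pos[OF True] unfolding Tdef U_def y_def[symmetric] by auto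
      then show ?thesis by (auto simp: indicator_def)
    qed (simp add: g_def)
  qed
  have rhoT: "AE x in lebesgue. x \<in> T \<longrightarrow> cmod (g x - r) \<le> \<kappa>"
    using eq
  proof eventually_elim
    fix x assume x: "x \<in> ball p \<eta> \<inter> closure D \<longrightarrow> \<rho> x = \<rho>' x"
    show "x \<in> T \<longrightarrow> cmod (g x - r) \<le> \<kappa>"
    proof
      assume "x \<in> T"
      then have "x \<in> D" "x \<in> ball p \<epsilon>" using TD by auto
      moreover from this have "x \<in> ball p \<eta> \<inter> closure D" using \<epsilon>(2) closure_subset by fastforce
      ultimately show "cmod (g x - r) \<le> \<kappa>" using x \<epsilon>(3)[of x] by (simp add: g_def)
    qed
  qed
  have yz: "(x - p) \<bullet> (- \<omega>) = y x" "(x - p) \<bullet> \<omega>' = z x" for x by (simp_all only: ya y_def z_def)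
  have main: "cmod (LINT x|lebesgue. g x * E \<tau> x) \<ge>
      cmod r * (c2 - c1) / (2 * K) / \<tau>\<^sup>2 - exp (- (\<tau> * \<delta>)) * (2 * cmod r + B)" if \<tau>: "\<tau> \<ge> 1" "\<tau> \<ge> \<bar>k\<bar>" for \<tau>
  proof -
    have t0: "\<tau> > 0" using \<tau> by simp
    have S: "\<tau> \<le> S \<tau>" "S \<tau> \<le> 2 * \<tau>"
    proof -
      show "\<tau> \<le> S \<tau>" unfolding S_def using t0 by (intro real_le_rsqrt) simp
      have "k\<^sup>2 \<le> \<tau>\<^sup>2" using \<tau>(2) t0 by (simp add: abs_le_square_iff[symmetric])
      then have "\<tau>\<^sup>2 + k\<^sup>2 \<le> 4 * \<tau>\<^sup>2" using zero_le_power2[of \<tau>] by linarith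
      then have "\<tau>\<^sup>2 + k\<^sup>2 \<le> (2 * \<tau>)\<^sup>2" by (simp add: power_mult_distrib)
      then show "S \<tau> \<le> 2 * \<tau>" unfolding S_def using t0 by (intro real_le_lsqrt) auto
    qed
    have S0: "S \<tau> > 0" "S \<tau> \<ge> 1" using S \<tau> by linarith+
    define J where "J = (LINT x|lebesgue. indicator T x *\<^sub>R E \<tau> x)"
    have iTE: "integrable lborel (\<lambda>x. indicator T x *\<^sub>R E \<tau> x)"
      unfolding T_def by (rule fr.sector_integrable[OF TD(2)[unfolded T_def] Ec])
    have iTE': "integrable lebesgue (\<lambda>x. indicator T x *\<^sub>R E \<tau> x)" using iTE by (rule integrable_completion[THEN iffD2, rotated]) (use borel_measurable_integrable[OF iTE] in simp)
    define A where "A d = \<i> * of_real (S \<tau> * d) - complex_of_real \<tau>" for d :: real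
    have Alow: "cmod (A d) \<ge> \<tau>" for d using abs_Re_le_cmod[of "A d"] t0 by (simp add: A_def)
    have Aup: "cmod (A d) \<le> \<tau> * (1 + 2 * \<bar>d\<bar>)" for d
    proof -
      have "cmod (A d) \<le> cmod (\<i> * of_real (S \<tau> * d)) + cmod (complex_of_real \<tau>)" unfolding A_def by (rule norm_triangle_ineq4)
      also have "\<dots> = S \<tau> * \<bar>d\<bar> + \<tau>" using S0 t0 by (simp add: norm_mult abs_mult)
      also have "\<dots> \<le> 2 * \<tau> * \<bar>d\<bar> + \<tau>" using S by (intro add_mono mult_right_mono) auto
      finally show ?thesis by (simp add: algebra_simps)
    qed
    have Jeq: "J = of_real (c2 - c1) / (A c1 * A c2) + (exp (A c2 * of_real \<delta>) / A c2 - exp (A c1 * of_real \<delta>) / A c1) / (\<i> * of_real (S \<tau>))"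
    proof -
      have "J = (LINT x|lborel. indicator T x *\<^sub>R E \<tau> x)"
        unfolding J_def using borel_measurable_integrable[OF iTE] by (intro integral_completion) simp
      also have "\<dots> = of_real (c2 - c1) / (A c1 * A c2) + (exp (A c2 * of_real \<delta>) / A c2 - exp (A c1 * of_real \<delta>) / A c1) / (\<i> * of_real (S \<tau>))"
        using fr.sector_integral_exp[OF TD(2)[unfolded T_def] c \<delta>(1) t0 S0(1)]
        unfolding T_def E_def A_def yz .
      finally show ?thesis .
    qed
    have eA: "cmod (exp (A d * of_real \<delta>) / A d) \<le> exp (- (\<tau> * \<delta>))" for d
    proof -
      have "cmod (exp (A d * of_real \<delta>)) = exp (- (\<tau> * \<delta>))" by (simp add: A_def)
      moreover have "1 \<le> cmod (A d)" using Alow[of d] \<tau> by linarith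
      ultimately show ?thesis by (simp add: norm_divide divide_le_eq mult_le_cancel_left1)
    qed
    have Jlow: "cmod J \<ge> (c2 - c1) / K / \<tau>\<^sup>2 - 2 * exp (- (\<tau> * \<delta>))"
    proof -
      have "(c2 - c1) / K / \<tau>\<^sup>2 \<le> cmod (of_real (c2 - c1) / (A c1 * A c2))"
      proof -
        have "cmod (A c1) * cmod (A c2) \<le> (\<tau> * (1 + 2 * \<bar>c1\<bar>)) * (\<tau> * (1 + 2 * \<bar>c2\<bar>))"
          using t0 by (intro mult_mono Aup) auto
        also have "\<dots> = K * \<tau>\<^sup>2" by (simp add: K_def power2_eq_square)
        finally have "cmod (A c1) * cmod (A c2) \<le> K * \<tau>\<^sup>2" .
        moreover have "0 < cmod (A c1) * cmod (A c2)" using Alow[of c1] Alow[of c2] t0 by (intro mult_pos_pos) linarith+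
        ultimately have "(c2 - c1) / (K * \<tau>\<^sup>2) \<le> (c2 - c1) / (cmod (A c1) * cmod (A c2))"
          using c by (intro divide_left_mono) auto
        then show ?thesis using c by (simp add: norm_divide norm_mult del: of_real_diff)
      qed
      moreover have "cmod ((exp (A c2 * of_real \<delta>) / A c2 - exp (A c1 * of_real \<delta>) / A c1) / (\<i> * of_real (S \<tau>))) \<le> 2 * exp (- (\<tau> * \<delta>))"
      proof -
        have "cmod (exp (A c2 * of_real \<delta>) / A c2 - exp (A c1 * of_real \<delta>) / A c1) \<le> 2 * exp (- (\<tau> * \<delta>))"
          using norm_triangle_ineq4[of "exp (A c2 * of_real \<delta>) / A c2" "exp (A c1 * of_real \<delta>) / A c1"] eA[of c1] eA[of c2] by linarith
        moreover have "2 * exp (- (\<tau> * \<delta>)) \<le> 2 * exp (- (\<tau> * \<delta>)) * S \<tau>" using S0 by simp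
        ultimately have "cmod (exp (A c2 * of_real \<delta>) / A c2 - exp (A c1 * of_real \<delta>) / A c1) \<le> 2 * exp (- (\<tau> * \<delta>)) * S \<tau>" by linarith
        then show ?thesis using S0(1) unfolding norm_divide[of _ "\<i> * of_real (S \<tau>)"] by (simp add: norm_mult divide_le_eq)
      qed
      ultimately show ?thesis
        unfolding Jeq using norm_diff_ineq[of "of_real (c2 - c1) / (A c1 * A c2)" "(exp (A c2 * of_real \<delta>) / A c2 - exp (A c1 * of_real \<delta>) / A c1) / (\<i> * of_real (S \<tau>))"]
        by linarith
    qed
    have iT: "integrable lebesgue (\<lambda>x. (indicator T x *\<^sub>R g x) * E \<tau> x)"
      by (rule bound_int(1)[of _ 0]) (use Tl Tdef t0 in auto)
    have U1: "integrable lebesgue (\<lambda>x. (indicator U x *\<^sub>R g x) * E \<tau> x)"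
      "cmod (LINT x|lebesgue. (indicator U x *\<^sub>R g x) * E \<tau> x) \<le> exp (- (\<tau> * \<delta>)) * B"
    proof -
      have Uy: "\<delta> \<le> y x" if "x \<in> U" "x \<in> D" for x using that by (simp add: U_def)
      show "integrable lebesgue (\<lambda>x. (indicator U x *\<^sub>R g x) * E \<tau> x)" by (rule bound_int(1)[OF Ul Uy t0])
      show "cmod (LINT x|lebesgue. (indicator U x *\<^sub>R g x) * E \<tau> x) \<le> exp (- (\<tau> * \<delta>)) * B" by (rule bound_int(2)[OF Ul Uy t0])
    qed
    have split: "(LINT x|lebesgue. g x * E \<tau> x) =
        (LINT x|lebesgue. (indicator T x *\<^sub>R g x) * E \<tau> x) + (LINT x|lebesgue. (indicator U x *\<^sub>R g x) * E \<tau> x)"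
    proof -
      have "(LINT x|lebesgue. g x * E \<tau> x) = (LINT x|lebesgue. (indicator T x *\<^sub>R g x) * E \<tau> x + (indicator U x *\<^sub>R g x) * E \<tau> x)"
        by (rule integral_cong_AE[OF _ _ splitAE]) measurable
      then show ?thesis using iT U1(1) by simp
    qed
    define H where "H = (LINT x|lebesgue. (indicator T x *\<^sub>R (g x - r)) * E \<tau> x)"
    have iH: "integrable lebesgue (\<lambda>x. (indicator T x *\<^sub>R (g x - r)) * E \<tau> x)"
    proof -
      have "integrable lebesgue (\<lambda>x. (indicator T x *\<^sub>R g x) * E \<tau> x - r * (indicator T x *\<^sub>R E \<tau> x))"
        by (intro Bochner_Integration.integrable_diff iT integrable_mult_right iTE')
      then show ?thesis by (simp add: algebra_simps scaleR_conv_of_real)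
    qed
    have TH: "(LINT x|lebesgue. (indicator T x *\<^sub>R g x) * E \<tau> x) = r * J + H"
    proof -
      have "(LINT x|lebesgue. (indicator T x *\<^sub>R g x) * E \<tau> x) =
         (LINT x|lebesgue. r * (indicator T x *\<^sub>R E \<tau> x) + (indicator T x *\<^sub>R (g x - r)) * E \<tau> x)"
        by (rule arg_cong[where f="integral\<^sup>L lebesgue"]) (simp add: fun_eq_iff algebra_simps scaleR_conv_of_real)
      also have "\<dots> = (LINT x|lebesgue. r * (indicator T x *\<^sub>R E \<tau> x)) + H"
        unfolding H_def by (rule Bochner_Integration.integral_add[OF integrable_mult_right[OF iTE'] iH])
      also have "(LINT x|lebesgue. r * (indicator T x *\<^sub>R E \<tau> x)) = r * J"
        unfolding J_def by (rule integral_mult_right_zero)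
      finally show ?thesis .
    qed
    have Hup: "cmod H \<le> \<kappa> * ((c2 - c1) / \<tau>\<^sup>2)"
    proof -
      have iX: "integrable lborel (\<lambda>x. indicator T x * exp (- (\<tau> * y x)))"
      proof -
        have "continuous_on UNIV (\<lambda>x. exp (- (\<tau> * y x)))" by (intro continuous_intros yc)
        from fr.sector_integrable[OF TD(2)[unfolded T_def] this] show ?thesis by (simp add: T_def)
      qed
      have iX': "integrable lebesgue (\<lambda>x. indicator T x * exp (- (\<tau> * y x)))"
        using iX by (rule integrable_completion[THEN iffD2, rotated]) (use borel_measurable_integrable[OF iX] in simp)
      have "cmod H \<le> (LINT x|lebesgue. norm ((indicator T x *\<^sub>R (g x - r)) * E \<tau> x))"
        unfolding H_def by (rule integral_norm_bound)
      also have "\<dots> \<le> (LINT x|lebesgue. \<kappa> * (indicator T x * exp (- (\<tau> * y x))))"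
      proof (rule integral_mono_AE)
        show "integrable lebesgue (\<lambda>x. norm ((indicator T x *\<^sub>R (g x - r)) * E \<tau> x))" using iH by (rule integrable_norm)
        show "integrable lebesgue (\<lambda>x. \<kappa> * (indicator T x * exp (- (\<tau> * y x))))" using iX' by (rule integrable_mult_right)
        show "AE x in lebesgue. norm ((indicator T x *\<^sub>R (g x - r)) * E \<tau> x) \<le> \<kappa> * (indicator T x * exp (- (\<tau> * y x)))"
          using rhoT by eventually_elim (auto simp: norm_mult Enorm indicator_def)
      qed
      also have "\<dots> = \<kappa> * (LINT x|lborel. indicator T x * exp (- (\<tau> * y x)))"
        using borel_measurable_integrable[OF iX] by (simp add: integral_completion)
      also have "\<dots> \<le> \<kappa> * ((c2 - c1) / \<tau>\<^sup>2)"
        using fr.sector_integral_decay[OF TD(2)[unfolded T_def] c \<delta>(1) t0] \<kappa>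
        unfolding yz T_def by (intro mult_left_mono) auto
      finally show ?thesis .
    qed
    have "cmod (LINT x|lebesgue. g x * E \<tau> x) \<ge> cmod (r * J) - cmod H - exp (- (\<tau> * \<delta>)) * B"
      unfolding split TH using U1(2) norm_diff_ineq[of "r * J + H" "LINT x|lebesgue. (indicator U x *\<^sub>R g x) * E \<tau> x"]
        norm_diff_ineq[of "r * J" H] by linarith
    moreover have "cmod (r * J) \<ge> cmod r * ((c2 - c1) / K / \<tau>\<^sup>2 - 2 * exp (- (\<tau> * \<delta>)))"
      unfolding norm_mult using Jlow by (intro mult_left_mono) auto
    moreover have "\<kappa> * ((c2 - c1) / \<tau>\<^sup>2) = cmod r * (c2 - c1) / (2 * K) / \<tau>\<^sup>2" by (simp add: \<kappa>_def)
    moreover have "cmod r * ((c2 - c1) / K / \<tau>\<^sup>2 - 2 * exp (- (\<tau> * \<delta>))) =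
        2 * (cmod r * (c2 - c1) / (2 * K) / \<tau>\<^sup>2) - exp (- (\<tau> * \<delta>)) * (2 * cmod r)"
      using K t0 by (simp add: field_simps)
    moreover have "exp (- (\<tau> * \<delta>)) * (2 * cmod r + B) = exp (- (\<tau> * \<delta>)) * (2 * cmod r) + exp (- (\<tau> * \<delta>)) * B"
      by (simp add: algebra_simps)
    ultimately show ?thesis using Hup by linarith
  qed
  \<comment> \<open>Half of what the deviation leaves; the other half absorbs the exponentially
    small terms.\<close>
  define A where "A = cmod r * (c2 - c1) / (4 * K)"
  have A: "A > 0" using r c K by (simp add: A_def)
  have lim: "((\<lambda>\<tau>. \<tau>\<^sup>2 * exp (- (\<tau> * \<delta>)) * (2 * cmod r + B)) \<longlongrightarrow> 0) at_top"
  proof -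
    have "((\<lambda>u. u\<^sup>2 / exp u) \<longlongrightarrow> (0::real)) at_top" by (rule tendsto_power_div_exp_0)
    moreover have "filterlim (\<lambda>\<tau>. \<tau> * \<delta>) at_top at_top"
      using \<delta>(1) by (intro filterlim_at_top_mult_tendsto_pos[OF tendsto_const]) (auto intro: filterlim_ident)
    ultimately have "((\<lambda>\<tau>. (\<tau> * \<delta>)\<^sup>2 / exp (\<tau> * \<delta>)) \<longlongrightarrow> 0) at_top" by (rule filterlim_compose)
    note tendsto_mult_left[OF this, of "(2 * cmod r + B) / \<delta>\<^sup>2"]
    moreover have "C / \<delta>\<^sup>2 * ((\<tau> * \<delta>)\<^sup>2 / exp (\<tau> * \<delta>)) = \<tau>\<^sup>2 * exp (- (\<tau> * \<delta>)) * C" for C \<tau>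
      using \<delta>(1) by (simp add: exp_minus field_simps power_mult_distrib)
    ultimately show ?thesis by simp
  qed
  have "\<forall>\<^sub>F \<tau> in at_top. \<tau>\<^sup>2 * exp (- (\<tau> * \<delta>)) * (2 * cmod r + B) < A"
    by (rule order_tendstoD(2)[OF lim A])
  moreover have "\<forall>\<^sub>F \<tau> in at_top. \<tau> \<ge> (1::real)" "\<forall>\<^sub>F \<tau> in at_top. \<tau> \<ge> \<bar>k\<bar>" by (rule eventually_ge_at_top)+
  ultimately have "\<forall>\<^sub>F \<tau> in at_top. A / \<tau>\<^sup>2 \<le> cmod (LINT x|lebesgue_on D. \<rho> x * E \<tau> x) \<and> cmod (LINT x|lebesgue_on D. \<rho> x * E \<tau> x) \<le> B + 1"
  proof eventually_elim
    fix \<tau> :: real assume s: "\<tau>\<^sup>2 * exp (- (\<tau> * \<delta>)) * (2 * cmod r + B) < A" and \<tau>: "\<tau> \<ge> 1" "\<tau> \<ge> \<bar>k\<bar>"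
    have t2: "\<tau>\<^sup>2 > 0" using \<tau> by simp
    have "exp (- (\<tau> * \<delta>)) * (2 * cmod r + B) \<le> A / \<tau>\<^sup>2" using s t2 by (simp add: field_simps)
    moreover have "cmod r * (c2 - c1) / (2 * K) / \<tau>\<^sup>2 = A / \<tau>\<^sup>2 + A / \<tau>\<^sup>2" by (simp add: A_def add_divide_distrib[symmetric])
    ultimately have "A / \<tau>\<^sup>2 \<le> cmod (LINT x|lebesgue. g x * E \<tau> x)" using main[OF \<tau>] by linarith
    moreover have "cmod (LINT x|lebesgue. g x * E \<tau> x) \<le> B"
    proof -
      \<comment> \<open>All of \<open>D\<close> has positive depth, so the exponential has modulus
        at most 1 there.\<close>
      have "cmod (LINT x|lebesgue. (indicator UNIV x *\<^sub>R g x) * E \<tau> x) \<le> exp (- (\<tau> * 0)) * B"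
        by (rule bound_int(2)) (use pos \<tau> in \<open>auto simp: y_def intro: less_imp_le\<close>)
      then show ?thesis by simp
    qed
    ultimately show "A / \<tau>\<^sup>2 \<le> cmod (LINT x|lebesgue_on D. \<rho> x * E \<tau> x) \<and> cmod (LINT x|lebesgue_on D. \<rho> x * E \<tau> x) \<le> B + 1"
      unfolding IE by simp
  qed
  then show thesis
    using that[of A "B + 1"] A B0 unfolding E_def y_def z_def S_def by simp
qed


section \<open>The enclosure formula\<close>

text \<open>The abstractions are left unreduced so that they match \<open>\<zeta> 1\<close> and
  \<open>\<zeta> 2\<close> in \<open>smooth_exp_linear\<close>.\<close>

lemma cgo_exp:
  "cgo k \<omega> \<omega>' \<tau> t x = exp ((\<lambda>i. of_real (\<tau> * \<omega> $ i) + \<i> * of_real (sqrt (\<tau>\<^sup>2 + k\<^sup>2) * \<omega>' $ i)) 1 * of_real (x $ 1) +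
     (\<lambda>i. of_real (\<tau> * \<omega> $ i) + \<i> * of_real (sqrt (\<tau>\<^sup>2 + k\<^sup>2) * \<omega>' $ i)) 2 * of_real (x $ 2) + - of_real (\<tau> * t))"
  by (simp add: cgo_def bdot_def cvec_def sum_2 mult.commute)

lemma pd_cgo:
  "pd i (cgo k \<omega> \<omega>' \<tau> t) x = (of_real (\<tau> * \<omega> $ i) + \<i> * of_real (sqrt (\<tau>\<^sup>2 + k\<^sup>2) * \<omega>' $ i)) * cgo k \<omega> \<omega>' \<tau> t x"
  by (rule smooth_exp_linear(1)[OF cgo_exp])

lemma smooth_cgo: "smooth (cgo k \<omega> \<omega>' \<tau> t)"
  by (rule smooth_exp_linear(2)[OF cgo_exp])

text \<open>The bilinear square of the complex frequency is \<tau>^2 - (\<tau>^2 + k^2) = - k^2;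
  orthogonality removes its imaginary part.\<close>

lemma cgo_helmholtz:
  assumes "norm \<omega> = 1" "norm \<omega>' = 1" "\<omega> \<bullet> \<omega>' = 0"
  shows "pd 1 (pd 1 (cgo k \<omega> \<omega>' \<tau> t)) x + pd 2 (pd 2 (cgo k \<omega> \<omega>' \<tau> t)) x + of_real (k\<^sup>2) * cgo k \<omega> \<omega>' \<tau> t x = 0"
proof -
  let ?v = "cgo k \<omega> \<omega>' \<tau> t"
  define s where "s = sqrt (\<tau>\<^sup>2 + k\<^sup>2)"
  define \<zeta> where "\<zeta> i = of_real (\<tau> * \<omega> $ i) + \<i> * of_real (s * \<omega>' $ i)" for i
  have p: "pd i ?v = (\<lambda>x. \<zeta> i * ?v x)" for i by (rule ext) (simp add: pd_cgo \<zeta>_def s_def)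
  have pp: "pd i (pd i ?v) x = \<zeta> i * (\<zeta> i * ?v x)" for i
  proof -
    have "pd i (\<lambda>x. \<zeta> i * ?v x) x = \<zeta> i * pd i ?v x + pd i (\<lambda>x. \<zeta> i) x * ?v x"
      by (rule smooth_pd_mult[OF smooth_const smooth_cgo])
    then show ?thesis by (simp add: p)
  qed
  have s2: "s\<^sup>2 = \<tau>\<^sup>2 + k\<^sup>2" by (simp add: s_def)
  have n: "(\<omega> $ 1)\<^sup>2 + (\<omega> $ 2)\<^sup>2 = 1" "(\<omega>' $ 1)\<^sup>2 + (\<omega>' $ 2)\<^sup>2 = 1" "\<omega> $ 1 * \<omega>' $ 1 + \<omega> $ 2 * \<omega>' $ 2 = 0"
    using assms by (auto simp: norm_eq_1 inner_vec_def sum_2 power2_eq_square)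
  have "\<zeta> 1 * \<zeta> 1 + \<zeta> 2 * \<zeta> 2 =
      of_real (\<tau>\<^sup>2 * ((\<omega> $ 1)\<^sup>2 + (\<omega> $ 2)\<^sup>2) - s\<^sup>2 * ((\<omega>' $ 1)\<^sup>2 + (\<omega>' $ 2)\<^sup>2)) +
      \<i> * of_real (2 * \<tau> * s * (\<omega> $ 1 * \<omega>' $ 1 + \<omega> $ 2 * \<omega>' $ 2))"
    by (simp add: \<zeta>_def complex_eq_iff algebra_simps power2_eq_square)
  also have "\<dots> = - of_real (k\<^sup>2)" unfolding n s2 by simp
  finally have "\<zeta> 1 * \<zeta> 1 + \<zeta> 2 * \<zeta> 2 = - of_real (k\<^sup>2)" .
  then have "(\<zeta> 1 * \<zeta> 1 + \<zeta> 2 * \<zeta> 2) * ?v x + of_real (k\<^sup>2) * ?v x = 0" by simp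
  then show ?thesis by (simp add: pp algebra_simps)
qed

section \<open>The two kinds of source as first-order functionals\<close>

context bounded_open
begin

lemma source_coefficient_L2:
  fixes \<rho> :: "real^2 \<Rightarrow> complex"
  assumes "open D" "D \<subseteq> \<Omega>" "\<rho> \<in> L2 (lebesgue_on D)"
  shows "(\<lambda>x. indicator D x * \<rho> x) \<in> L2 M"
proof -
  have Ds: "D \<inter> space lebesgue \<in> sets lebesgue" using assms(1) by (simp add: borel_open)
  have "(\<lambda>x. indicator D x *\<^sub>R \<rho> x) \<in> borel_measurable lebesgue"
    using borel_measurable_restrict_space_iff[OF Ds, of \<rho>] L2_measurable[OF assms(3)] by simp
  then have m: "(\<lambda>x. indicator D x *\<^sub>R \<rho> x) \<in> borel_measurable M" by (rule measurable_restrict_space1)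
  have "integrable lebesgue (\<lambda>x. indicator D x *\<^sub>R (cmod (\<rho> x))\<^sup>2)"
    using integrable_restrict_space[OF Ds, of "\<lambda>x. (cmod (\<rho> x))\<^sup>2"] L2_integrable[OF assms(3)] by simp
  moreover have "(\<lambda>x. indicator \<Omega> x *\<^sub>R (cmod (indicator D x *\<^sub>R \<rho> x))\<^sup>2) = (\<lambda>x. indicator D x *\<^sub>R (cmod (\<rho> x))\<^sup>2)"
    using assms(2) by (auto simp: indicator_def fun_eq_iff)
  ultimately have "integrable M (\<lambda>x. (cmod (indicator D x *\<^sub>R \<rho> x))\<^sup>2)"
    using integrable_restrict_space[OF space_Int, of "\<lambda>x. (cmod (indicator D x *\<^sub>R \<rho> x))\<^sup>2"] by simp
  with m have "(\<lambda>x. indicator D x *\<^sub>R \<rho> x) \<in> L2 M" by (simp add: L2_def)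
  moreover have "(\<lambda>x. indicator D x *\<^sub>R \<rho> x) = (\<lambda>x. indicator D x * \<rho> x)" by (auto simp: indicator_def)
  ultimately show ?thesis by simp
qed

lemma integral_on_subset:
  fixes f :: "real^2 \<Rightarrow> complex"
  assumes "open D" "D \<subseteq> \<Omega>"
  shows "(LINT x|lebesgue_on D. f x) = (LINT x|M. indicator D x * f x)"
proof -
  have Ds: "D \<inter> space lebesgue \<in> sets lebesgue" using assms(1) by (simp add: borel_open)
  have "(\<lambda>x. indicator D x *\<^sub>R f x) = (\<lambda>x. indicator \<Omega> x *\<^sub>R (indicator D x * f x))"
    using assms(2) by (auto simp: indicator_def fun_eq_iff)
  then show ?thesis by (simp add: integral_restrict_space[OF Ds] integral_restrict_space[OF space_Int])
qed

lemma source_eq_functional: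
  assumes "open D" "D \<subseteq> \<Omega>"
  shows "source D \<rho> = functional (\<lambda>x. indicator D x * \<rho> x) (\<lambda>i x. 0)"
  by (rule ext) (simp add: source_def functional_def integral_on_subset[OF assms] mult.assoc)

lemma div_source_eq_functional:
  assumes "open D" "D \<subseteq> \<Omega>"
  shows "div_source \<Omega> D \<rho> a = functional (\<lambda>x. 0) (\<lambda>i x. - of_real (a $ i) * (indicator D x * \<rho> x))"
proof
  fix \<phi>
  have "div_source \<Omega> D \<rho> a \<phi> = (LINT x|M. - (indicator D x * (\<rho> x * bdot (cvec a) (wgrad \<Omega> \<phi> x))))"
    by (simp add: div_source_def integral_on_subset[OF assms])
  also have "\<dots> = functional (\<lambda>x. 0) (\<lambda>i x. - of_real (a $ i) * (indicator D x * \<rho> x)) \<phi>"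
    unfolding functional_def
    by (rule arg_cong[where f="integral\<^sup>L M"]) (simp add: fun_eq_iff bdot_def cvec_def sum_2 algebra_simps)
  finally show "div_source \<Omega> D \<rho> a \<phi> = functional (\<lambda>x. 0) (\<lambda>i x. - of_real (a $ i) * (indicator D x * \<rho> x)) \<phi>" .
qed

text \<open>The gradient of the exponential is a constant vector times the exponential, so the
  divergence source reduces to the plain one up to a constant factor.\<close>

lemma div_source_cgo:
  assumes D: "open D" "D \<subseteq> \<Omega>" and \<rho>: "\<rho> \<in> L2 (lebesgue_on D)"
  shows "div_source \<Omega> D \<rho> a (cgo k \<omega> \<omega>' \<tau> t) =
    - (of_real (\<tau> * (a \<bullet> \<omega>)) + \<i> * of_real (sqrt (\<tau>\<^sup>2 + k\<^sup>2) * (a \<bullet> \<omega>'))) * (LINT x|lebesgue_on D. \<rho> x * cgo k \<omega> \<omega>' \<tau> t x)"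
proof -
  let ?v = "cgo k \<omega> \<omega>' \<tau> t"
  let ?z = "of_real (\<tau> * (a \<bullet> \<omega>)) + \<i> * of_real (sqrt (\<tau>\<^sup>2 + k\<^sup>2) * (a \<bullet> \<omega>')) :: complex"
  have L0: "(\<lambda>x. 0 :: complex) \<in> L2 M" by (simp add: L2_def)
  have L1: "\<forall>i. (\<lambda>x. - of_real (a $ i) * (indicator D x * \<rho> x)) \<in> L2 M"
    by (intro allI smooth_mult_L2[OF smooth_const] source_coefficient_L2[OF D \<rho>])
  have "div_source \<Omega> D \<rho> a ?v = (LINT x|M. 0 * ?v x + ((- of_real (a $ 1) * (indicator D x * \<rho> x)) * cgrad ?v x $ 1 +
      (- of_real (a $ 2) * (indicator D x * \<rho> x)) * cgrad ?v x $ 2))"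
    unfolding div_source_eq_functional[OF D]
    by (rule functional_AE[OF L0 L1 smooth_H1[OF smooth_cgo] is_weak_grad_smooth[OF smooth_cgo]])
  also have "\<dots> = (LINT x|M. - ?z * (indicator D x * (\<rho> x * ?v x)))"
    by (rule arg_cong[where f="integral\<^sup>L M"])
       (simp add: fun_eq_iff pd_cgo inner_vec_def sum_2 algebra_simps)
  also have "\<dots> = - ?z * (LINT x|M. indicator D x * (\<rho> x * ?v x))" by (rule integral_mult_right_zero)
  finally show ?thesis by (simp only: integral_on_subset[OF D])
qed

end

text \<open>Both cases are brought under one locale, so that the boundary identity is proved
  once.\<close>

lemma source_functionalI:
  assumes "open \<Omega>" "bounded \<Omega>" "open D" "closure D \<subseteq> \<Omega>" "\<rho> \<in> L2 (lebesgue_on D)"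
    and F: "F = source D \<rho> \<or> F = div_source \<Omega> D \<rho> a"
  obtains c e where "source_functional \<Omega> D c e" "F = bounded_open.functional \<Omega> c e"
proof -
  interpret bounded_open \<Omega> using assms by unfold_locales
  have D: "open D" "D \<subseteq> \<Omega>" using assms closure_subset by auto
  have L: "(\<lambda>x. indicator D x * \<rho> x) \<in> L2 M" "(\<lambda>x. 0 :: complex) \<in> L2 M"
    "(\<lambda>x. - of_real (a $ i) * (indicator D x * \<rho> x)) \<in> L2 M" for i
    by (rule source_coefficient_L2[OF D assms(5)], simp add: L2_def,
        rule smooth_mult_L2[OF smooth_const source_coefficient_L2[OF D assms(5)]])
  from F show thesis
  proof
    assume F: "F = source D \<rho>"
    have "source_functional \<Omega> D (\<lambda>x. indicator D x * \<rho> x) (\<lambda>i x. 0)"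
      using L assms(4) by unfold_locales auto
    then show thesis by (rule that) (simp only: F source_eq_functional[OF D])
  next
    assume F: "F = div_source \<Omega> D \<rho> a"
    have "source_functional \<Omega> D (\<lambda>x. 0) (\<lambda>i x. - of_real (a $ i) * (indicator D x * \<rho> x))"
      using L assms(4) by unfold_locales auto
    then show thesis by (rule that) (simp only: F div_source_eq_functional[OF D])
  qed
qed

text \<open>Powers of \<tau> disappear because ln \<tau> / \<tau> tends to 0. The lower power is
  that of the corner integral, the upper one that of the factor of the divergence source.\<close>

lemma log_rate:
  fixes g :: "real \<Rightarrow> real"
  assumes "A > 0" "B > 0" "\<forall>\<^sub>F \<tau> in at_top. A / \<tau>\<^sup>2 \<le> g \<tau> \<and> g \<tau> \<le> B * \<tau>"
  shows "((\<lambda>\<tau>. ln (g \<tau>) / \<tau>) \<longlongrightarrow> 0) at_top"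
proof (rule tendsto_sandwich)
  have lim: "((\<lambda>\<tau>. (C + d * ln \<tau>) / \<tau>) \<longlongrightarrow> 0) at_top" for C d :: real
  proof -
    have "((\<lambda>\<tau>. C / \<tau> + d * (ln \<tau> / \<tau>)) \<longlongrightarrow> 0 + d * 0) at_top"
      by (intro tendsto_add tendsto_mult tendsto_const ln_x_over_x_tendsto_0 tendsto_divide_0[OF tendsto_const]
          filterlim_at_top_imp_at_infinity filterlim_ident)
    then show ?thesis by (simp add: add_divide_distrib)
  qed
  show "((\<lambda>\<tau>. (ln A - 2 * ln \<tau>) / \<tau>) \<longlongrightarrow> 0) at_top" using lim[of "ln A" "- 2"] by simp
  show "((\<lambda>\<tau>. (ln B + ln \<tau>) / \<tau>) \<longlongrightarrow> 0) at_top" using lim[of "ln B" 1] by simp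
  show "\<forall>\<^sub>F \<tau> in at_top. (ln A - 2 * ln \<tau>) / \<tau> \<le> ln (g \<tau>) / \<tau>"
    using assms(3) eventually_gt_at_top[of "0::real"]
  proof eventually_elim
    case (elim \<tau>)
    have "ln (A / \<tau>\<^sup>2) \<le> ln (g \<tau>)" using elim assms(1) by (intro ln_mono) auto
    moreover have "ln (A / \<tau>\<^sup>2) = ln A - 2 * ln \<tau>" using elim assms(1) by (simp add: ln_div ln_realpow)
    ultimately show ?case using elim by (simp add: divide_right_mono)
  qed
  show "\<forall>\<^sub>F \<tau> in at_top. ln (g \<tau>) / \<tau> \<le> (ln B + ln \<tau>) / \<tau>"
    using assms(3) eventually_gt_at_top[of "0::real"]
  proof eventually_elim
    case (elim \<tau>)
    have "A / \<tau>\<^sup>2 > 0" using elim assms(1) by simp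
    then have "ln (g \<tau>) \<le> ln (B * \<tau>)" using elim by (intro ln_mono) auto
    moreover have "ln (B * \<tau>) = ln B + ln \<tau>" using elim assms(2) by (simp add: ln_mult)
    ultimately show ?case using elim by (simp add: divide_right_mono)
  qed
qed

text \<open>Eventual non-vanishing is part of the claim because \<open>ln\<close> takes a default
  value at 0.\<close>

theorem theorem1p1:
  fixes \<Omega> D :: "(real^2) set"
    and k :: real
    and ps :: "(real^2) list"
    and \<rho> u f :: "real^2 \<Rightarrow> complex"
    and a \<omega> \<omega>' :: "real^2"
    and F N :: functional
  assumes "open \<Omega>" "connected \<Omega>" "bounded \<Omega>" "lipschitz_boundary \<Omega>"
    and "k \<ge> 0"
    and "open_polygon ps D" "closure D \<subseteq> \<Omega>"
    and "\<rho> \<in> L2 (lebesgue_on D)"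
    and "\<And>p. p \<in> set ps \<Longrightarrow>
           \<exists>\<eta>>0. \<exists>\<alpha>>0. \<alpha> \<le> 1 \<and>
             (\<exists>\<rho>'. holder_on (cball p \<eta>) \<alpha> \<rho>' \<and>
                   (AE x in lebesgue. x \<in> ball p \<eta> \<inter> closure D \<longrightarrow> \<rho> x = \<rho>' x) \<and>
                   \<rho>' p \<noteq> 0)"
    and "a \<noteq> 0"
    and "F = source D \<rho> \<or> F = div_source \<Omega> D \<rho> a"
    and "weak_solution \<Omega> k F u"
    and "is_trace \<Omega> u f" "N = neumann \<Omega> k F u"
    and "regular_direction D \<omega>"
    and "norm \<omega>' = 1" "\<omega> \<bullet> \<omega>' = 0"
  shows "\<forall>t. (\<forall>\<^sub>F \<tau> in at_top. indicator_fun \<Omega> k f N \<omega> \<omega>' \<tau> t \<noteq> 0) \<and>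
             ((\<lambda>\<tau>. ln (cmod (indicator_fun \<Omega> k f N \<omega> \<omega>' \<tau> t)) / \<tau>)
                \<longlongrightarrow> support_fun D \<omega> - t) at_top"
proof
  fix t :: real
  note top = open_polygon_topology[OF assms(6)]
  have \<omega>: "norm \<omega> = 1" using assms(15) by (simp add: regular_direction_def)
  interpret bounded_open \<Omega> using assms by unfold_locales
  have D: "open D" "D \<subseteq> \<Omega>" using top(1) assms(7) closure_subset by auto
  obtain c e where sf: "source_functional \<Omega> D c e" and F: "F = functional c e"
    using source_functionalI[OF assms(1,3) top(1) assms(7,8,11)] by metis
  interpret source_functional \<Omega> D c e by (rule sf)
  have I: "indicator_fun \<Omega> k f N \<omega> \<omega>' \<tau> t = F (cgo k \<omega> \<omega>' \<tau> t)" for \<tau>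
    unfolding indicator_fun_def assms(14) F
    by (rule neumann_difference[OF assms(4) assms(12)[unfolded F] assms(13) smooth_cgo cgo_helmholtz[OF \<omega> assms(16,17)]])
  obtain p c1 c2 where pps: "p \<in> set ps" and ph: "p \<bullet> \<omega> = support_fun D \<omega>" and c12: "c1 < c2"
    and pos: "\<And>x. x \<in> D \<Longrightarrow> 0 < (p - x) \<bullet> \<omega>"
    and corner: "corner D p \<omega> \<omega>' c1 c2"
    using polygon_corner[OF assms(6,15,16,17)] by metis
  obtain \<eta> \<alpha> \<rho>' where h: "\<eta> > 0" "\<alpha> > 0" "holder_on (cball p \<eta>) \<alpha> \<rho>'"
    "AE x in lebesgue. x \<in> ball p \<eta> \<inter> closure D \<longrightarrow> \<rho> x = \<rho>' x" "\<rho>' p \<noteq> 0"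
    using assms(9)[OF pps] by blast
  define J where "J \<tau> = (LINT x|lebesgue_on D. \<rho> x * exp (- of_real (\<tau> * ((p - x) \<bullet> \<omega>)) + \<i> * of_real (sqrt (\<tau>\<^sup>2 + k\<^sup>2) * ((x - p) \<bullet> \<omega>'))))" for \<tau>
  obtain A B where AB: "A > 0" "B > 0" and ev: "\<forall>\<^sub>F \<tau> in at_top. A / \<tau>\<^sup>2 \<le> cmod (J \<tau>) \<and> cmod (J \<tau>) \<le> B"
    unfolding J_def by (rule corner_integral_bounds[OF top(1,2) assms(8) \<omega> assms(16,17) c12 pos corner h, of k])
  define h where "h = support_fun D \<omega>"
  \<comment> \<open>Centring the exponent at \<open>p\<close> splits off a constant of modulus exp
    (\<tau> (h - t)), which carries the whole exponential rate.\<close>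
  have cgo: "cgo k \<omega> \<omega>' \<tau> t x = exp (of_real (\<tau> * (h - t)) + \<i> * of_real (sqrt (\<tau>\<^sup>2 + k\<^sup>2) * (p \<bullet> \<omega>'))) *
      exp (- of_real (\<tau> * ((p - x) \<bullet> \<omega>)) + \<i> * of_real (sqrt (\<tau>\<^sup>2 + k\<^sup>2) * ((x - p) \<bullet> \<omega>')))" for \<tau> x
  proof -
    define s where "s = sqrt (\<tau>\<^sup>2 + k\<^sup>2)"
    have "cgo k \<omega> \<omega>' \<tau> t x = exp (of_real (\<tau> * (x \<bullet> \<omega>) - \<tau> * t) + \<i> * of_real (s * (x \<bullet> \<omega>')))"
      unfolding cgo_exp s_def[symmetric] by (rule arg_cong[where f=exp]) (simp add: inner_vec_def sum_2 algebra_simps)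
    also have "of_real (\<tau> * (x \<bullet> \<omega>) - \<tau> * t) + \<i> * of_real (s * (x \<bullet> \<omega>')) =
        (of_real (\<tau> * (h - t)) + \<i> * of_real (s * (p \<bullet> \<omega>'))) + (- of_real (\<tau> * ((p - x) \<bullet> \<omega>)) + \<i> * of_real (s * ((x - p) \<bullet> \<omega>')))"
      by (simp add: inner_diff_left ph h_def algebra_simps)
    finally show ?thesis by (simp only: exp_add s_def)
  qed
  have Jv: "cmod (LINT x|lebesgue_on D. \<rho> x * cgo k \<omega> \<omega>' \<tau> t x) = exp (\<tau> * (h - t)) * cmod (J \<tau>)" for \<tau>
  proof -
    let ?w = "exp (of_real (\<tau> * (h - t)) + \<i> * of_real (sqrt (\<tau>\<^sup>2 + k\<^sup>2) * (p \<bullet> \<omega>')))"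
    have "(LINT x|lebesgue_on D. \<rho> x * cgo k \<omega> \<omega>' \<tau> t x) = ?w * J \<tau>"
      unfolding J_def cgo integral_mult_right_zero[symmetric]
      by (rule arg_cong[where f="integral\<^sup>L (lebesgue_on D)"]) (simp add: fun_eq_iff mult.left_commute)
    then show ?thesis by (simp add: norm_mult)
  qed
  \<comment> \<open>Modulus of the factor between the pairing with the source and the plain
    integral.\<close>
  define G where "G \<tau> = (if F = source D \<rho> then 1 else cmod (of_real (\<tau> * (a \<bullet> \<omega>)) + \<i> * of_real (sqrt (\<tau>\<^sup>2 + k\<^sup>2) * (a \<bullet> \<omega>'))))" for \<tau>
  have Iabs: "cmod (indicator_fun \<Omega> k f N \<omega> \<omega>' \<tau> t) = exp (\<tau> * (h - t)) * (G \<tau> * cmod (J \<tau>))" for \<tau>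
  proof (cases "F = source D \<rho>")
    case True
    then show ?thesis using Jv[of \<tau>] by (simp add: I G_def source_def)
  next
    case False
    then have "F = div_source \<Omega> D \<rho> a" using assms(11) by blast
    then have "indicator_fun \<Omega> k f N \<omega> \<omega>' \<tau> t = div_source \<Omega> D \<rho> a (cgo k \<omega> \<omega>' \<tau> t)" by (simp only: I)
    then have "cmod (indicator_fun \<Omega> k f N \<omega> \<omega>' \<tau> t) = G \<tau> * (exp (\<tau> * (h - t)) * cmod (J \<tau>))"
      using False by (simp only: div_source_cgo[OF D assms(8)] norm_mult norm_minus_cancel Jv G_def if_False)
    then show ?thesis by (simp only: mult.left_commute)
  qed
  interpret fr: frame 0 \<omega> \<omega>' using \<omega> assms(16,17) by unfold_locales
  have na: "(norm a)\<^sup>2 = (a \<bullet> \<omega>)\<^sup>2 + (a \<bullet> \<omega>')\<^sup>2"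
  proof -
    have a: "a = (a \<bullet> \<omega>) *\<^sub>R \<omega> + (a \<bullet> \<omega>') *\<^sub>R \<omega>'" using fr.fr_decomp[of a] by (simp add: fr.fr_def)
    have "(norm a)\<^sup>2 = a \<bullet> a" by (rule power2_norm_eq_inner)
    also have "\<dots> = ((a \<bullet> \<omega>) *\<^sub>R \<omega> + (a \<bullet> \<omega>') *\<^sub>R \<omega>') \<bullet> a" by (rule arg_cong[where f="\<lambda>v. v \<bullet> a", OF a])
    also have "\<dots> = (a \<bullet> \<omega>)\<^sup>2 + (a \<bullet> \<omega>')\<^sup>2"
      by (simp add: inner_add_left inner_commute[of _ a] inner_add_right power2_eq_square)
    finally show ?thesis .
  qed
  \<comment> \<open>For the divergence source the squared factor \<tau>^2 (a.\<omega>)^2 + (\<tau>^2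
    + k^2) (a.\<omega>')^2 lies between |a|^2 and (2 |a| \<tau>)^2 once \<tau> \<ge> 1 and \<tau>
    \<ge> k. Minimum and maximum with 1 cover the plain source; \<open>m\<close> is positive because
    \<open>a\<close> is non-zero.\<close>
  define m where "m = min 1 (norm a)"
  define n where "n = max 1 (2 * norm a)"
  have mn: "m > 0" "n > 0" using assms(10) by (auto simp: m_def n_def)
  have G: "m \<le> G \<tau> \<and> G \<tau> \<le> n * \<tau>" if \<tau>: "\<tau> \<ge> 1" "\<tau> \<ge> k" for \<tau>
  proof (cases "F = source D \<rho>")
    case True
    have "1 \<le> n * \<tau>" using \<tau> mult_mono[of 1 n 1 \<tau>] by (simp add: n_def)
    then show ?thesis using True by (simp add: G_def m_def)
  next
    case False
    let ?z = "of_real (\<tau> * (a \<bullet> \<omega>)) + \<i> * of_real (sqrt (\<tau>\<^sup>2 + k\<^sup>2) * (a \<bullet> \<omega>')) :: complex"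
    have z: "(cmod ?z)\<^sup>2 = \<tau>\<^sup>2 * (a \<bullet> \<omega>)\<^sup>2 + (\<tau>\<^sup>2 + k\<^sup>2) * (a \<bullet> \<omega>')\<^sup>2"
      by (simp add: cmod_power2 power_mult_distrib)
    have k2: "k\<^sup>2 \<le> \<tau>\<^sup>2" using \<tau> assms(5) by (intro power_mono) auto
    have "(1 * norm a)\<^sup>2 \<le> (\<tau> * norm a)\<^sup>2" using \<tau> by (intro power_mono mult_right_mono) auto
    also have "\<dots> = \<tau>\<^sup>2 * (a \<bullet> \<omega>)\<^sup>2 + \<tau>\<^sup>2 * (a \<bullet> \<omega>')\<^sup>2" by (simp add: power_mult_distrib na algebra_simps)
    also have "\<dots> \<le> (cmod ?z)\<^sup>2" unfolding z by (intro add_mono mult_right_mono) auto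
    finally have lo: "norm a \<le> cmod ?z" by (intro power2_le_imp_le[of "norm a"]) auto
    have "(cmod ?z)\<^sup>2 \<le> (4 * \<tau>\<^sup>2) * (a \<bullet> \<omega>)\<^sup>2 + (4 * \<tau>\<^sup>2) * (a \<bullet> \<omega>')\<^sup>2"
      unfolding z using k2 zero_le_power2[of \<tau>] by (intro add_mono mult_right_mono) (linarith | simp)+
    also have "\<dots> = (2 * norm a * \<tau>)\<^sup>2" by (simp add: power_mult_distrib na algebra_simps)
    finally have "cmod ?z \<le> 2 * norm a * \<tau>" using \<tau> by (intro power2_le_imp_le[of "cmod ?z"]) auto
    also have "\<dots> \<le> n * \<tau>" using \<tau> by (intro mult_right_mono) (auto simp: n_def)
    finally show ?thesis using False lo by (simp add: G_def m_def)
  qed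
  have bounds: "\<forall>\<^sub>F \<tau> in at_top. (m * A) / \<tau>\<^sup>2 \<le> G \<tau> * cmod (J \<tau>) \<and> G \<tau> * cmod (J \<tau>) \<le> (n * B) * \<tau>"
    using ev eventually_ge_at_top[of "1::real"] eventually_ge_at_top[of k]
  proof eventually_elim
    case (elim \<tau>)
    have g: "m \<le> G \<tau>" "G \<tau> \<le> n * \<tau>" using G elim by auto
    have "m * (A / \<tau>\<^sup>2) \<le> G \<tau> * cmod (J \<tau>)" using elim g mn AB by (intro mult_mono) auto
    moreover have "G \<tau> * cmod (J \<tau>) \<le> (n * \<tau>) * B" using elim g mn by (intro mult_mono) auto
    ultimately show ?case by (simp add: mult_ac)
  qed
  have ev_pos: "\<forall>\<^sub>F \<tau> in at_top. G \<tau> * cmod (J \<tau>) > 0 \<and> \<tau> > 0"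
    using bounds eventually_gt_at_top[of "0::real"]
  proof eventually_elim
    case (elim \<tau>)
    have "(m * A) / \<tau>\<^sup>2 > 0" using elim mn AB by simp
    then show ?case using elim by linarith
  qed
  have "\<forall>\<^sub>F \<tau> in at_top. (h - t) + ln (G \<tau> * cmod (J \<tau>)) / \<tau> = ln (cmod (indicator_fun \<Omega> k f N \<omega> \<omega>' \<tau> t)) / \<tau>"
    using ev_pos
  proof eventually_elim
    case (elim \<tau>)
    have "ln (exp (\<tau> * (h - t)) * (G \<tau> * cmod (J \<tau>))) = \<tau> * (h - t) + ln (G \<tau> * cmod (J \<tau>))"
      using elim by (subst ln_mult) auto
    then show ?case unfolding Iabs using elim by (simp add: add_divide_distrib)
  qed
  moreover have "((\<lambda>\<tau>. (h - t) + ln (G \<tau> * cmod (J \<tau>)) / \<tau>) \<longlongrightarrow> (h - t) + 0) at_top"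
    using mn AB by (intro tendsto_add tendsto_const log_rate[OF _ _ bounds]) auto
  ultimately have "((\<lambda>\<tau>. ln (cmod (indicator_fun \<Omega> k f N \<omega> \<omega>' \<tau> t)) / \<tau>) \<longlongrightarrow> h - t) at_top"
    by (simp add: filterlim_cong[OF refl refl])
  moreover have "\<forall>\<^sub>F \<tau> in at_top. indicator_fun \<Omega> k f N \<omega> \<omega>' \<tau> t \<noteq> 0"
    using ev_pos by eventually_elim (use Iabs in \<open>metis exp_gt_zero less_irrefl mult_pos_pos norm_zero\<close>)
  ultimately show "(\<forall>\<^sub>F \<tau> in at_top. indicator_fun \<Omega> k f N \<omega> \<omega>' \<tau> t \<noteq> 0) \<and>
             ((\<lambda>\<tau>. ln (cmod (indicator_fun \<Omega> k f N \<omega> \<omega>' \<tau> t)) / \<tau>) \<longlongrightarrow> support_fun D \<omega> - t) at_top"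
    unfolding h_def by blast
qed

end
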